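(* Consider the TAR(1) model $Y_t=\alpha Y_{t-1}+\varepsilon_t$ if $Y_{t-1}>r$, $Y_t=\beta Y_{t-1}+\varepsilon_t$ if $Y_{t-1}\le r$ ($t\ge1$), with $\mathbb{E}Y_0^2<\infty$. Suppose either (i) $\alpha=1$, $\beta<1$ and $r\le0$; or (ii) $\alpha=1$, $\beta=-1$ and $r\in\mathbb{R}$ arbitrary. Then $$\frac{Y_{[nt]}}{\sqrt n}\Rightarrow \sigma|B(t)|\quad\text{on }D[0,1]$$ as $n\to\infty$, where $B$ is a standard Brownian motion and $D[0,1]$ is the Skorokhod space.
   Context: Standing assumptions: $\{\varepsilon_t\}_{t\ge1}$ is an i.i.d. sequence of real random variables with $\mathbb{E}\varepsilon_1=0$ and $\mathbb{E}\varepsilon_1^2=\sigma^2\in(0,\infty)$; the initial value $Y_0$ is a random variable independent of $\{\varepsilon_t\}_{t\ge1}$. $[x]$ denotes the integer part of $x$; $\Rightarrow$ denotes weak convergence. *)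

theory Defs
  imports "HOL-Probability.Probability"
begin

fun tar1 :: "real \<Rightarrow> real \<Rightarrow> real \<Rightarrow> ('a \<Rightarrow> real) \<Rightarrow> (nat \<Rightarrow> 'a \<Rightarrow> real) \<Rightarrow> nat \<Rightarrow> 'a \<Rightarrow> real" where
  "tar1 \<alpha> \<beta> r Y0 eps 0 \<omega> = Y0 \<omega>"
| "tar1 \<alpha> \<beta> r Y0 eps (Suc t) \<omega> =
     (if tar1 \<alpha> \<beta> r Y0 eps t \<omega> > r then \<alpha> else \<beta>) * tar1 \<alpha> \<beta> r Y0 eps t \<omega> + eps (Suc t) \<omega>"

(* Skorokhod space D[0,1]: cadlag functions on [0,1] (values outside [0,1] are irrelevant) *)
definition cadlag :: "(real \<Rightarrow> real) \<Rightarrow> bool" where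
  "cadlag x \<longleftrightarrow> (\<forall>t\<in>{0..<1}. (x \<longlongrightarrow> x t) (at_right t)) \<and>
                 (\<forall>t\<in>{0<..1}. \<exists>l. (x \<longlongrightarrow> l) (at_left t))"

definition time_changes :: "(real \<Rightarrow> real) set" where
  "time_changes = {l. strict_mono_on {0..1} l \<and> continuous_on {0..1} l \<and> l 0 = 0 \<and> l 1 = 1}"

definition skorokhod_dist :: "(real \<Rightarrow> real) \<Rightarrow> (real \<Rightarrow> real) \<Rightarrow> real" where
  "skorokhod_dist x y = (INF l\<in>time_changes.
       max (SUP t\<in>{0..1}. \<bar>l t - t\<bar>) (SUP t\<in>{0..1}. \<bar>x t - y (l t)\<bar>))"

(* continuity of a functional on D[0,1] w.r.t. the Skorokhod topology (metric, so sequential) *)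
definition skorokhod_continuous :: "((real \<Rightarrow> real) \<Rightarrow> real) \<Rightarrow> bool" where
  "skorokhod_continuous F \<longleftrightarrow>
     (\<forall>xs x. cadlag x \<and> (\<forall>n. cadlag (xs n)) \<and> (\<lambda>n. skorokhod_dist (xs n) x) \<longlonglongrightarrow> 0
        \<longrightarrow> (\<lambda>n. F (xs n)) \<longlonglongrightarrow> F x)"

definition bounded_on_D :: "((real \<Rightarrow> real) \<Rightarrow> real) \<Rightarrow> bool" where
  "bounded_on_D F \<longleftrightarrow> (\<exists>K. \<forall>x. cadlag x \<longrightarrow> \<bar>F x\<bar> \<le> K)"

definition weak_conv_D ::
  "'a measure \<Rightarrow> (nat \<Rightarrow> 'a \<Rightarrow> real \<Rightarrow> real) \<Rightarrow> 'b measure \<Rightarrow> ('b \<Rightarrow> real \<Rightarrow> real) \<Rightarrow> bool" where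
  "weak_conv_D M Xs N X \<longleftrightarrow>
     (\<forall>F. skorokhod_continuous F \<and> bounded_on_D F \<longrightarrow>
        (\<lambda>n. integral\<^sup>L M (\<lambda>\<omega>. F (Xs n \<omega>))) \<longlonglongrightarrow> integral\<^sup>L N (\<lambda>\<omega>. F (X \<omega>)))"

definition standard_BM :: "'b measure \<Rightarrow> (real \<Rightarrow> 'b \<Rightarrow> real) \<Rightarrow> bool" where
  "standard_BM N B \<longleftrightarrow> prob_space N \<and>
     (\<forall>t. B t \<in> borel_measurable N) \<and>
     (\<forall>\<omega>\<in>space N. B 0 \<omega> = 0 \<and> continuous_on {0..1} (\<lambda>t. B t \<omega>)) \<and>
     (\<forall>s t. 0 \<le> s \<and> s < t \<and> t \<le> 1 \<longrightarrow>
        distributed N lborel (\<lambda>\<omega>. B t \<omega> - B s \<omega>) (normal_density 0 (sqrt (t - s)))) \<and>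
     (\<forall>(ts :: nat \<Rightarrow> real) k. 0 \<le> ts 0 \<and> (\<forall>i<k. ts i < ts (Suc i)) \<and> ts k \<le> 1 \<longrightarrow>
        prob_space.indep_vars N (\<lambda>_. borel) (\<lambda>i \<omega>. B (ts (Suc i)) \<omega> - B (ts i) \<omega>) {..<k})"

end

theory Submission
  imports Defs
begin

text \<open>
  When \<open>\<beta> = -1\<close>, each step multiplies the state by a sign and adds an innovation. Multiplying \<open>Y\<^sub>t\<close> by
  the product of the past signs gives \<open>Y\<^sub>0\<close> plus a martingale \<open>V\<^sub>t\<close> whose increments are innovations with
  predictable signs, so that \<open>\<bar>Y\<^sub>t\<bar>\<close> and \<open>\<bar>V\<^sub>t\<bar>\<close> differ by at most \<open>\<bar>Y\<^sub>0\<bar>\<close>, while the negative part of \<open>Y\<^sub>t\<close> is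
  at most of the order of one innovation. Hence a functional central limit theorem for \<open>V\<close> suffices.

  When \<open>\<beta> < 1\<close> and \<open>r \<le> 0\<close>, the difference between \<open>Y\<close> and the free random walk only increases while
  \<open>Y \<le> r\<close>, so \<open>Y\<close> is the Skorokhod reflection of the walk up to a multiple of the largest innovation.
  The reflection does not depend on \<open>\<beta>\<close>; comparing with \<open>\<beta> = -1\<close> replaces Levy's theorem that
  reflected Brownian motion is the modulus of a Brownian motion.

  The limit law charges only continuous paths, so all estimates are made in the supremum norm: a
  bounded Skorokhod-continuous functional is an increasing limit of functionals that are Lipschitz for
  that norm. Finite-dimensional convergence of \<open>V\<close> follows from Levy's continuity theorem applied under
  weights measurable with respect to the past, and tightness from Ottaviani's maximal inequality.
\<close>

section \<open>Reduction to functionals that are Lipschitz in the supremum norm\<close>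

text \<open>Two obstacles shape the proof. The signs depend on the past and the innovations need not
  be symmetric, so the increments of \<open>V\<close> need not be independent. But mean zero and
  finite variance give \<phi>(u / sqrt n) = exp (- \<sigma>^2 u^2 / (2 n)) + o(1/n), and the leading
  term is even in u: a sign flip alters each of at most n factors by o(1/n). Hence the signs
  disappear in the limit, and separate blocks of time become asymptotically independent. Only second
  moments are available, so tightness cannot use fourth moments of the walk. Ottaviani's inequality
  reduces the oscillation over a block to its total increment, whose limit is normal and does have a
  fourth moment. One of m blocks then oscillates with probability of order 1/m^2, all of them
  together of order 1/m. Functionals are not assumed Borel measurable. A functional that is
  Lipschitz for the supremum norm depends continuously on the finitely many values of a step path,
  which settles measurability for step paths and, by discretisation, for Brownian motion.\<close>

definition sup_lipschitz :: "real \<Rightarrow> ((real \<Rightarrow> real) \<Rightarrow> real) \<Rightarrow> bool" where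
  "sup_lipschitz k H \<longleftrightarrow> (\<forall>x y d. cadlag x \<longrightarrow> cadlag y \<longrightarrow>
     (\<forall>t\<in>{0..1}. \<bar>x t - y t\<bar> \<le> d) \<longrightarrow> \<bar>H x - H y\<bar> \<le> k * d)"

lemma sup_lipschitzD:
  "sup_lipschitz k H \<Longrightarrow> cadlag x \<Longrightarrow> cadlag y \<Longrightarrow> (\<And>t. 0 \<le> t \<Longrightarrow> t \<le> 1 \<Longrightarrow> \<bar>x t - y t\<bar> \<le> d)
    \<Longrightarrow> \<bar>H x - H y\<bar> \<le> k * d"
  unfolding sup_lipschitz_def by auto

section \<open>Cadlag paths, step paths and measurability of their functionals\<close>

lemma cadlag_abs: "cadlag x \<Longrightarrow> cadlag (\<lambda>t. \<bar>x t\<bar>)"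
  unfolding cadlag_def by (blast intro: tendsto_rabs)

lemma cadlag_continuous:
  assumes "continuous_on {0..1} x"
  shows "cadlag x"
  unfolding cadlag_def
proof (intro conjI ballI)
  fix t :: real
  assume t: "t \<in> {0..<1}"
  then have "continuous_on {t..1} x"
    using assms by (auto intro: continuous_on_subset)
  then show "(x \<longlongrightarrow> x t) (at_right t)"
    using t by (auto intro: continuous_on_Icc_at_rightD)
next
  fix t :: real
  assume t: "t \<in> {0<..1}"
  then have "continuous_on {0..t} x"
    using assms by (auto intro: continuous_on_subset)
  then show "\<exists>l. (x \<longlongrightarrow> l) (at_left t)"
    using t by (auto intro: continuous_on_Icc_at_leftD)
qed

text \<open>Serves two roles: with \<open>m = n\<close> it is the rescaled process itself, with
  fixed \<open>m\<close> a coarse discretisation. At \<open>t = 1\<close> it takes the value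
  \<open>v m\<close>, so the indices up to and including \<open>m\<close> matter.\<close>

definition step_path :: "nat \<Rightarrow> (nat \<Rightarrow> real) \<Rightarrow> real \<Rightarrow> real" where
  "step_path m v t = v (nat \<lfloor>real m * t\<rfloor>)"

lemma cadlag_step_path: "cadlag (step_path m v)"
proof (cases "m = 0")
  case True
  then show ?thesis by (auto simp: cadlag_def step_path_def[abs_def])
next
  case False
  then have m: "real m > 0" by simp
  show ?thesis unfolding cadlag_def
  proof (intro conjI ballI)
    fix t :: real
    have "eventually (\<lambda>s. s < (\<lfloor>real m * t\<rfloor> + 1) / m) (at_right t)"
      by (rule order_tendstoD(2)[OF tendsto_ident_at]) (use m in \<open>simp add: field_simps; linarith\<close>)
    moreover have "eventually (\<lambda>s. s > t) (at_right t)"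
      by (simp add: eventually_at_right_less)
    ultimately have "eventually (\<lambda>s. step_path m v s = step_path m v t) (at_right t)"
    proof eventually_elim
      case (elim s)
      then have "real m * s < \<lfloor>real m * t\<rfloor> + 1" "real m * t < real m * s"
        using m by (auto simp: field_simps)
      then have "\<lfloor>real m * s\<rfloor> = \<lfloor>real m * t\<rfloor>"
        by linarith
      then show ?case by (simp add: step_path_def)
    qed
    then show "(step_path m v \<longlongrightarrow> step_path m v t) (at_right t)"
      by (rule tendsto_eventually)
  next
    fix t :: real
    \<comment> \<open>Immediately to the left of \<open>t\<close> the index is the ceiling minus
      one, whether or not \<open>real m * t\<close> is an integer.\<close>
    have "eventually (\<lambda>s. s > (\<lceil>real m * t\<rceil> - 1) / m) (at_left t)"
      by (rule order_tendstoD(1)[OF tendsto_ident_at]) (use m in \<open>simp add: field_simps; linarith\<close>)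
    moreover have "eventually (\<lambda>s. s < t) (at_left t)"
      by (simp add: eventually_at_filter)
    ultimately have "eventually (\<lambda>s. step_path m v s = v (nat (\<lceil>real m * t\<rceil> - 1))) (at_left t)"
    proof eventually_elim
      case (elim s)
      then have "real m * s > \<lceil>real m * t\<rceil> - 1" "real m * s < real m * t"
        using m by (auto simp: field_simps)
      then have "\<lfloor>real m * s\<rfloor> = \<lceil>real m * t\<rceil> - 1"
        by linarith
      then show ?case by (simp add: step_path_def)
    qed
    then have "(step_path m v \<longlongrightarrow> v (nat (\<lceil>real m * t\<rceil> - 1))) (at_left t)"
      by (rule tendsto_eventually)
    then show "\<exists>l. (step_path m v \<longlongrightarrow> l) (at_left t)" by blast
  qed
qed

lemma nat_floor_le:
  assumes "0 \<le> t" "t \<le> 1"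
  shows "nat \<lfloor>real m * t\<rfloor> \<le> m"
proof -
  have "real m * t \<le> real m * 1" using assms by (intro mult_left_mono) auto
  then have "\<lfloor>real m * t\<rfloor> \<le> \<lfloor>real m\<rfloor>" by (intro floor_mono) simp
  then show ?thesis by simp
qed

lemma step_path_diff_le:
  assumes "\<And>i. i \<le> m \<Longrightarrow> \<bar>v i - w i\<bar> \<le> d" "0 \<le> t" "t \<le> 1"
  shows "\<bar>step_path m v t - step_path m w t\<bar> \<le> d"
  unfolding step_path_def using assms nat_floor_le by blast

text \<open>Nothing is known about measurability of \<open>H\<close>, but on the unit interval a
  step path has only \<open>m + 1\<close> coordinates. The Lipschitz bound therefore makes
  \<open>H\<close> composed with \<open>step_path m\<close> continuous on the product space, hence
  Borel.\<close>

lemma borel_measurable_step_path: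
  assumes H: "sup_lipschitz k H" and v[measurable]: "\<And>i. (\<lambda>\<omega>. v \<omega> i) \<in> borel_measurable M"
  shows "(\<lambda>\<omega>. H (step_path m (v \<omega>))) \<in> borel_measurable M"
proof -
  have "continuous_on UNIV (\<lambda>w. H (step_path m w))"
    unfolding continuous_on_sequentially
  proof (intro ballI allI impI, unfold comp_def)
    fix ws :: "nat \<Rightarrow> nat \<Rightarrow> real" and w
    assume lim0: "(\<forall>n. ws n \<in> UNIV) \<and> ws \<longlonglongrightarrow> w"
    have c: "(\<lambda>n. ws n i) \<longlonglongrightarrow> w i" for i
    proof -
      have "isCont (\<lambda>x::nat \<Rightarrow> real. x i) w"
        using continuous_on_product_coordinates[of i] continuous_on_eq_continuous_at open_UNIV by blast
      moreover have "ws \<longlonglongrightarrow> w" using lim0 by blast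
      ultimately show ?thesis by (rule isCont_tendsto_compose)
    qed
    have "(\<lambda>n. \<bar>ws n i - w i\<bar>) \<longlonglongrightarrow> 0" for i
      by (rule tendsto_rabs_zero[OF LIM_zero[OF c]])
    then have "(\<lambda>n. \<Sum>i\<le>m. \<bar>ws n i - w i\<bar>) \<longlonglongrightarrow> 0"
      by (rule tendsto_null_sum)
    then have lim: "(\<lambda>n. k * (\<Sum>i\<le>m. \<bar>ws n i - w i\<bar>)) \<longlonglongrightarrow> 0"
      by (rule tendsto_mult_right_zero)
    have b: "\<bar>H (step_path m (ws n)) - H (step_path m w)\<bar> \<le> k * (\<Sum>i\<le>m. \<bar>ws n i - w i\<bar>)" for n
    proof (rule sup_lipschitzD[OF H cadlag_step_path cadlag_step_path], rule step_path_diff_le)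
      fix i assume "i \<le> m"
      then show "\<bar>ws n i - w i\<bar> \<le> (\<Sum>i\<le>m. \<bar>ws n i - w i\<bar>)"
        by (intro member_le_sum[where f="\<lambda>i. \<bar>ws n i - w i\<bar>"]) auto
    qed
    show "(\<lambda>n. H (step_path m (ws n))) \<longlonglongrightarrow> H (step_path m w)"
      by (rule LIM_zero_cancel[OF Lim_null_comparison[OF _ lim]]) (simp add: b)
  qed
  then have "(\<lambda>w. H (step_path m w)) \<in> borel_measurable borel"
    by (rule borel_measurable_continuous_onI)
  moreover have "v \<in> borel_measurable M"
    by (rule measurable_coordinatewise_then_product) (rule v)
  ultimately show ?thesis
    by (rule measurable_compose_rev)
qed

text \<open>
  Infimal convolution with the supremum norm. The radius \<open>d\<close> is a separate variable so that no supremum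
  has to be formed.
\<close>

definition lipschitz_envelope :: "((real \<Rightarrow> real) \<Rightarrow> real) \<Rightarrow> real \<Rightarrow> (real \<Rightarrow> real) \<Rightarrow> real" where
  "lipschitz_envelope F k x =
     (INF (y, d)\<in>{(y, d). cadlag y \<and> 0 \<le> d \<and> (\<forall>t\<in>{0..1}. \<bar>x t - y t\<bar> \<le> d)}. F y + k * d)"

context
  fixes F :: "(real \<Rightarrow> real) \<Rightarrow> real" and K :: real
  assumes F_bound: "\<And>x. cadlag x \<Longrightarrow> \<bar>F x\<bar> \<le> K"
begin

lemma lipschitz_envelope_lower:
  assumes "cadlag x" "0 \<le> k"
    and "\<And>y d. cadlag y \<Longrightarrow> 0 \<le> d \<Longrightarrow> (\<And>t. 0 \<le> t \<Longrightarrow> t \<le> 1 \<Longrightarrow> \<bar>x t - y t\<bar> \<le> d) \<Longrightarrow> c \<le> F y + k * d"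
  shows "c \<le> lipschitz_envelope F k x"
  unfolding lipschitz_envelope_def
proof (rule cINF_greatest)
  show "{(y, d). cadlag y \<and> 0 \<le> d \<and> (\<forall>t\<in>{0..1}. \<bar>x t - y t\<bar> \<le> d)} \<noteq> {}"
    using assms(1) by (auto intro!: exI[of _ x] exI[of _ 0])
qed (auto intro: assms(3))

lemma lipschitz_envelope_upper:
  assumes "0 \<le> k" "cadlag y" "0 \<le> d" "\<And>t. 0 \<le> t \<Longrightarrow> t \<le> 1 \<Longrightarrow> \<bar>x t - y t\<bar> \<le> d"
  shows "lipschitz_envelope F k x \<le> F y + k * d"
proof -
  have "bdd_below ((\<lambda>(y, d). F y + k * d) ` {(y, d). cadlag y \<and> 0 \<le> d \<and> (\<forall>t\<in>{0..1}. \<bar>x t - y t\<bar> \<le> d)})"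
  proof (rule bdd_belowI2[of _ "-K"], clarsimp)
    fix y d assume "cadlag y" "0 \<le> (d::real)"
    then show "-K \<le> F y + k * d"
      using F_bound[of y] assms(1) mult_nonneg_nonneg[of k d] by linarith
  qed
  from cINF_lower[OF this, of "(y, d)"] show ?thesis
    using assms unfolding lipschitz_envelope_def by auto
qed

lemma lipschitz_envelope_le: "0 \<le> k \<Longrightarrow> cadlag x \<Longrightarrow> lipschitz_envelope F k x \<le> F x"
  using lipschitz_envelope_upper[of k x 0 x] by simp

lemma lipschitz_envelope_ge:
  assumes "0 \<le> k" "cadlag x"
  shows "-K \<le> lipschitz_envelope F k x"
proof (rule lipschitz_envelope_lower[OF assms(2,1)])
  fix y d assume "cadlag y" "0 \<le> (d::real)"
  then show "-K \<le> F y + k * d"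
    using F_bound[of y] assms(1) mult_nonneg_nonneg[of k d] by linarith
qed

lemma abs_lipschitz_envelope_le:
  "0 \<le> k \<Longrightarrow> cadlag x \<Longrightarrow> \<bar>lipschitz_envelope F k x\<bar> \<le> K"
  using lipschitz_envelope_ge[of k x] lipschitz_envelope_le[of k x] F_bound[of x] by linarith

text \<open>Triangle inequality: a competitor \<open>(z, e)\<close> for \<open>y\<close> becomes the
  competitor \<open>(z, d + e)\<close> for \<open>x\<close>, at the extra cost
  \<open>k * d\<close>.\<close>

lemma sup_lipschitz_envelope:
  assumes k: "0 \<le> k"
  shows "sup_lipschitz k (lipschitz_envelope F k)"
proof -
  have *: "lipschitz_envelope F k x \<le> lipschitz_envelope F k y + k * d"
    if "cadlag x" "cadlag y" "\<forall>t\<in>{0..1}. \<bar>x t - y t\<bar> \<le> d" for x y d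
  proof -
    have "lipschitz_envelope F k x - k * d \<le> lipschitz_envelope F k y"
    proof (rule lipschitz_envelope_lower[OF that(2) k])
      fix z e assume z: "cadlag z" "0 \<le> e" "\<And>t. 0 \<le> t \<Longrightarrow> t \<le> 1 \<Longrightarrow> \<bar>y t - z t\<bar> \<le> e"
      have d: "0 \<le> d" using that(3) by (metis abs_ge_zero atLeastAtMost_iff order.trans le_numeral_extra(3) zero_le_one)
      have "lipschitz_envelope F k x \<le> F z + k * (d + e)"
      proof (rule lipschitz_envelope_upper[OF k z(1)])
        fix t :: real assume t: "0 \<le> t" "t \<le> 1"
        have "\<bar>x t - y t\<bar> \<le> d" "\<bar>y t - z t\<bar> \<le> e" using that(3) z(3) t by auto
        then show "\<bar>x t - z t\<bar> \<le> d + e" by linarith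
      qed (use z d in auto)
      then show "lipschitz_envelope F k x - k * d \<le> F z + k * e" by (simp add: algebra_simps)
    qed
    then show ?thesis by simp
  qed
  show ?thesis unfolding sup_lipschitz_def
  proof (intro allI impI)
    fix x y d assume xy: "cadlag x" "cadlag y" "\<forall>t\<in>{0..1}. \<bar>x t - y t\<bar> \<le> d"
    then have "\<forall>t\<in>{0..1}. \<bar>y t - x t\<bar> \<le> d" by (simp add: abs_minus_commute)
    from *[OF xy] *[OF xy(2,1) this]
    show "\<bar>lipschitz_envelope F k x - lipschitz_envelope F k y\<bar> \<le> k * d" by linarith
  qed
qed

end

section \<open>Skorokhod continuity and uniform closeness\<close>

lemma skorokhod_dist_le_sup:
  assumes "\<And>t. 0 \<le> t \<Longrightarrow> t \<le> 1 \<Longrightarrow> \<bar>x t - y t\<bar> \<le> d"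
  shows "0 \<le> skorokhod_dist x y" "skorokhod_dist x y \<le> d"
proof -
  let ?f = "\<lambda>l. max (SUP t\<in>{0..1::real}. \<bar>l t - t\<bar>) (SUP t\<in>{0..1}. \<bar>x t - y (l t)\<bar>)"
  have id: "id \<in> time_changes"
    by (auto simp: time_changes_def strict_mono_on_def)
  \<comment> \<open>The displacement of a time change is bounded, by continuity on a compact
    interval, so its real supremum dominates its value \<open>0\<close> at time \<open>0\<close>.
    The same fact bounds the infimum over time changes from below.\<close>
  have nn: "0 \<le> ?f l" if "l \<in> time_changes" for l
  proof -
    have "continuous_on {0..1} (\<lambda>t. \<bar>l t - t\<bar>)"
      using that by (auto simp: time_changes_def intro!: continuous_intros)
    then have "compact ((\<lambda>t. \<bar>l t - t\<bar>) ` {0..1})"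
      by (rule compact_continuous_image) simp
    then have "bdd_above ((\<lambda>t. \<bar>l t - t\<bar>) ` {0..1})"
      by (intro bounded_imp_bdd_above compact_imp_bounded)
    then have "\<bar>l 0 - 0\<bar> \<le> (SUP t\<in>{0..1}. \<bar>l t - t\<bar>)"
      by (intro cSUP_upper) auto
    then show ?thesis by auto
  qed
  show "0 \<le> skorokhod_dist x y"
    unfolding skorokhod_dist_def using id by (intro cINF_greatest nn) auto
  have "skorokhod_dist x y \<le> ?f id"
    unfolding skorokhod_dist_def by (intro cINF_lower bdd_belowI2[of _ 0] nn id)
  also have "\<dots> \<le> d"
  proof (rule max.boundedI)
    have "0 \<le> d" using assms[of 0] by simp
    then show "(SUP t\<in>{0..1::real}. \<bar>id t - t\<bar>) \<le> d" by (simp add: cSUP_const)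
    show "(SUP t\<in>{0..1}. \<bar>x t - y (id t)\<bar>) \<le> d"
      by (rule cSUP_least) (auto intro: assms)
  qed
  finally show "skorokhod_dist x y \<le> d" .
qed

text \<open>Continuity is given through sequences. Were there no such radius, paths violating the
  conclusion at radii \<open>1 / (n + 1)\<close> would converge in the Skorokhod distance, because
  the identity is a time change.\<close>

lemma skorokhod_continuous_sup_nhd:
  assumes F: "skorokhod_continuous F" and x: "cadlag x" and e: "0 < e"
  obtains d where "0 < d" "\<And>y. cadlag y \<Longrightarrow> (\<And>t. 0 \<le> t \<Longrightarrow> t \<le> 1 \<Longrightarrow> \<bar>x t - y t\<bar> \<le> d) \<Longrightarrow> \<bar>F y - F x\<bar> < e"
proof -
  have "\<exists>d>0. \<forall>y. cadlag y \<longrightarrow> (\<forall>t. 0 \<le> t \<longrightarrow> t \<le> 1 \<longrightarrow> \<bar>x t - y t\<bar> \<le> d) \<longrightarrow> \<bar>F y - F x\<bar> < e"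
  proof (rule ccontr)
    assume "\<not> ?thesis"
    then have "\<forall>n. \<exists>y. cadlag y \<and> (\<forall>t. 0 \<le> t \<longrightarrow> t \<le> 1 \<longrightarrow> \<bar>x t - y t\<bar> \<le> inverse (real (Suc n))) \<and> \<not> \<bar>F y - F x\<bar> < e"
      by (metis inverse_positive_iff_positive of_nat_0_less_iff zero_less_Suc)
    then obtain ys where ys: "\<And>n. cadlag (ys n)"
      "\<And>n t. 0 \<le> t \<Longrightarrow> t \<le> 1 \<Longrightarrow> \<bar>x t - ys n t\<bar> \<le> inverse (real (Suc n))"
      "\<And>n. \<not> \<bar>F (ys n) - F x\<bar> < e"
      by metis
    have "(\<lambda>n. skorokhod_dist (ys n) x) \<longlonglongrightarrow> 0"
    proof (rule tendsto_sandwich[OF _ _ tendsto_const LIMSEQ_inverse_real_of_nat])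
      show "\<forall>\<^sub>F n in sequentially. 0 \<le> skorokhod_dist (ys n) x"
        by (intro always_eventually allI skorokhod_dist_le_sup(1)) (subst abs_minus_commute, rule ys)
      show "\<forall>\<^sub>F n in sequentially. skorokhod_dist (ys n) x \<le> inverse (real (Suc n))"
        by (intro always_eventually allI skorokhod_dist_le_sup(2)) (subst abs_minus_commute, rule ys)
    qed
    then have "(\<lambda>n. F (ys n)) \<longlonglongrightarrow> F x"
      using F x ys(1) unfolding skorokhod_continuous_def by blast
    then have "eventually (\<lambda>n. dist (F (ys n)) (F x) < e) sequentially"
      using e by (rule tendstoD)
    then show False
      using ys(3) by (auto simp: dist_real_def dest: eventually_happens)
  qed
  then show ?thesis using that by blast
qed

text \<open>A competitor within the continuity radius \<open>d\<close> changes \<open>F\<close> by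
  little. One farther away pays a penalty of at least \<open>k * d\<close>, which for large
  \<open>k\<close> exceeds the total oscillation \<open>2 * K\<close> of \<open>F\<close>.\<close>

lemma lipschitz_envelope_tendsto:
  assumes F: "skorokhod_continuous F" and b: "\<And>x. cadlag x \<Longrightarrow> \<bar>F x\<bar> \<le> K" and x: "cadlag x"
  shows "(\<lambda>k. lipschitz_envelope F (real k) x) \<longlonglongrightarrow> F x"
proof (rule LIMSEQ_I)
  fix e :: real assume e: "0 < e"
  obtain d where d: "0 < d" "\<And>y. cadlag y \<Longrightarrow> (\<And>t. 0 \<le> t \<Longrightarrow> t \<le> 1 \<Longrightarrow> \<bar>x t - y t\<bar> \<le> d) \<Longrightarrow> \<bar>F y - F x\<bar> < e / 2"
    using skorokhod_continuous_sup_nhd[OF F x, of "e/2"] e by auto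
  obtain k0 :: nat where k0: "2 * K / d < k0" using reals_Archimedean2 by blast
  have "norm (lipschitz_envelope F (real k) x - F x) < e" if "k0 \<le> k" for k
  proof -
    have k: "2 * K < k * d" using k0 that d(1) by (simp add: field_simps) (smt (verit) mult_left_mono of_nat_le_iff)
    have "F x - e / 2 \<le> lipschitz_envelope F (real k) x"
    proof (rule lipschitz_envelope_lower[OF b x])
      fix y d' assume y: "cadlag y" "0 \<le> d'" "\<And>t. 0 \<le> t \<Longrightarrow> t \<le> 1 \<Longrightarrow> \<bar>x t - y t\<bar> \<le> d'"
      show "F x - e / 2 \<le> F y + real k * d'"
      proof (cases "d' \<le> d")
        case True
        then have "\<bar>F y - F x\<bar> < e / 2" using y by (intro d(2)) (auto intro: order.trans)
        moreover have "0 \<le> real k * d'" using y by simp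
        ultimately show ?thesis by linarith
      next
        case False
        then have "real k * d \<le> real k * d'" by (intro mult_left_mono) auto
        then show ?thesis using k b[OF x] b[OF y(1)] e by linarith
      qed
    qed auto
    moreover have "lipschitz_envelope F (real k) x \<le> F x"
      by (rule lipschitz_envelope_le[OF b _ x]) auto
    ultimately show ?thesis using e by simp
  qed
  then show "\<exists>no. \<forall>n\<ge>no. norm (lipschitz_envelope F (real n) x - F x) < e" by blast
qed

text \<open>The envelopes lie below \<open>F\<close> and converge to it, so dominated convergence
  under \<open>X\<close> bounds the lower limit of the integrals; the same for \<open>- F\<close>
  bounds the upper limit. As pointwise limits the envelopes also supply measurability of
  \<open>F\<close> along the paths.\<close>

lemma weak_conv_D_sup_lipschitzI:
  assumes M: "prob_space M" and N: "prob_space N"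
    and Xs: "\<And>n \<omega>. \<omega> \<in> space M \<Longrightarrow> cadlag (Xs n \<omega>)" and X: "\<And>\<omega>. \<omega> \<in> space N \<Longrightarrow> cadlag (X \<omega>)"
    and Xs_m: "\<And>n k H. sup_lipschitz k H \<Longrightarrow> (\<lambda>\<omega>. H (Xs n \<omega>)) \<in> borel_measurable M"
    and X_m: "\<And>k H. sup_lipschitz k H \<Longrightarrow> (\<lambda>\<omega>. H (X \<omega>)) \<in> borel_measurable N"
    and conv: "\<And>k K H. 0 \<le> k \<Longrightarrow> sup_lipschitz k H \<Longrightarrow> (\<And>x. cadlag x \<Longrightarrow> \<bar>H x\<bar> \<le> K) \<Longrightarrow>
      (\<lambda>n. integral\<^sup>L M (\<lambda>\<omega>. H (Xs n \<omega>))) \<longlonglongrightarrow> integral\<^sup>L N (\<lambda>\<omega>. H (X \<omega>))"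
  shows "weak_conv_D M Xs N X"
proof -
  interpret M: prob_space M by fact
  interpret N: prob_space N by fact
  have lower: "eventually (\<lambda>n. integral\<^sup>L N (\<lambda>\<omega>. F (X \<omega>)) - e < integral\<^sup>L M (\<lambda>\<omega>. F (Xs n \<omega>))) sequentially"
    if F: "skorokhod_continuous F" and b': "\<forall>x. cadlag x \<longrightarrow> \<bar>F x\<bar> \<le> K" and e: "0 < e" for F K and e :: real
  proof -
    have b: "\<bar>F x\<bar> \<le> K" if "cadlag x" for x using b' that by blast
    let ?F = "\<lambda>k. lipschitz_envelope F (real k)"
    have lip: "sup_lipschitz (real k) (?F k)" for k
      by (rule sup_lipschitz_envelope[of F K]) (auto intro: b)
    have F_le: "?F k x \<le> F x" "\<bar>?F k x\<bar> \<le> K" if "cadlag x" for k x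
      using lipschitz_envelope_le[of F K "real k" x] abs_lipschitz_envelope_le[of F K "real k" x] that b by auto
    have env: "(\<lambda>k. ?F k x) \<longlonglongrightarrow> F x" if "cadlag x" for x
      by (rule lipschitz_envelope_tendsto[OF F _ that]) (rule b)
    have [measurable]: "(\<lambda>\<omega>. ?F k (X \<omega>)) \<in> borel_measurable N" for k
      by (rule X_m[OF lip])
    have [measurable]: "(\<lambda>\<omega>. ?F k (Xs n \<omega>)) \<in> borel_measurable M" for k n
      by (rule Xs_m[OF lip])
    have [measurable]: "(\<lambda>\<omega>. F (X \<omega>)) \<in> borel_measurable N"
      by (rule borel_measurable_LIMSEQ_real[where u="\<lambda>k \<omega>. ?F k (X \<omega>)"]) (simp_all add: env X)
    have [measurable]: "(\<lambda>\<omega>. F (Xs n \<omega>)) \<in> borel_measurable M" for n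
      by (rule borel_measurable_LIMSEQ_real[where u="\<lambda>k \<omega>. ?F k (Xs n \<omega>)"]) (simp_all add: env Xs)
    have "(\<lambda>k. integral\<^sup>L N (\<lambda>\<omega>. ?F k (X \<omega>))) \<longlonglongrightarrow> integral\<^sup>L N (\<lambda>\<omega>. F (X \<omega>))"
      by (rule integral_dominated_convergence[where w="\<lambda>_. K"])
         (auto intro!: AE_I2 env F_le X)
    then have "eventually (\<lambda>k. integral\<^sup>L N (\<lambda>\<omega>. F (X \<omega>)) - e / 2 < integral\<^sup>L N (\<lambda>\<omega>. ?F k (X \<omega>))) sequentially"
      by (rule order_tendstoD(1)) (use e in simp)
    then obtain k where k: "integral\<^sup>L N (\<lambda>\<omega>. F (X \<omega>)) - e / 2 < integral\<^sup>L N (\<lambda>\<omega>. ?F k (X \<omega>))"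
      by (auto dest: eventually_happens)
    have "(\<lambda>n. integral\<^sup>L M (\<lambda>\<omega>. ?F k (Xs n \<omega>))) \<longlonglongrightarrow> integral\<^sup>L N (\<lambda>\<omega>. ?F k (X \<omega>))"
      by (rule conv[OF of_nat_0_le_iff lip F_le(2)])
    then have "eventually (\<lambda>n. integral\<^sup>L N (\<lambda>\<omega>. F (X \<omega>)) - e < integral\<^sup>L M (\<lambda>\<omega>. ?F k (Xs n \<omega>))) sequentially"
      by (rule order_tendstoD(1)) (use k e in linarith)
    then show ?thesis
    proof eventually_elim
      case (elim n)
      have "integral\<^sup>L M (\<lambda>\<omega>. ?F k (Xs n \<omega>)) \<le> integral\<^sup>L M (\<lambda>\<omega>. F (Xs n \<omega>))"
        by (intro integral_mono M.integrable_const_bound[of _ K] AE_I2)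
           (use F_le b Xs in auto)
      with elim show ?case by linarith
    qed
  qed
  show ?thesis unfolding weak_conv_D_def
  proof (intro allI impI, elim conjE)
    fix F assume F: "skorokhod_continuous F" and "bounded_on_D F"
    then obtain K where K: "\<forall>x. cadlag x \<longrightarrow> \<bar>F x\<bar> \<le> K" unfolding bounded_on_D_def by blast
    have F': "skorokhod_continuous (\<lambda>x. - F x)"
      using F unfolding skorokhod_continuous_def by (auto intro: tendsto_minus)
    show "(\<lambda>n. integral\<^sup>L M (\<lambda>\<omega>. F (Xs n \<omega>))) \<longlonglongrightarrow> integral\<^sup>L N (\<lambda>\<omega>. F (X \<omega>))"
    proof (rule tendstoI)
      fix e :: real assume "0 < e"
      have K': "\<forall>x. cadlag x \<longrightarrow> \<bar>- F x\<bar> \<le> K" using K by simp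
      show "\<forall>\<^sub>F n in sequentially. dist (integral\<^sup>L M (\<lambda>\<omega>. F (Xs n \<omega>))) (integral\<^sup>L N (\<lambda>\<omega>. F (X \<omega>))) < e"
        using lower[OF F K \<open>0 < e\<close>] lower[OF F' K' \<open>0 < e\<close>]
        by eventually_elim (auto simp: dist_real_def)
    qed
  qed
qed

section \<open>Pathwise comparison of threshold models\<close>

text \<open>From above \<open>r\<close> one step ends no lower than \<open>r - D\<close>, hence
  above \<open>- 2 * D\<close>. From below, a coefficient \<open>\<beta> \<le> 0\<close> yields a
  nonnegative product and \<open>0 < \<beta> < 1\<close> contracts the negative part. The bound is
  the fixed point of \<open>L = 2 * D + \<rho> * L\<close> with
  \<open>\<rho> = max \<beta> 0\<close>.\<close>

lemma tar1_lower_bound: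
  assumes \<beta>: "\<beta> < 1" and r: "r \<le> 0" and D: "\<bar>Y0 \<omega>\<bar> \<le> D" "\<bar>r\<bar> \<le> D"
    and eps: "\<And>k. 1 \<le> k \<Longrightarrow> k \<le> n \<Longrightarrow> \<bar>eps k \<omega>\<bar> \<le> D"
  shows "t \<le> n \<Longrightarrow> - (2 * D / (1 - max \<beta> 0)) \<le> tar1 1 \<beta> r Y0 eps t \<omega>"
proof (induction t)
  define \<rho> where "\<rho> = max \<beta> 0"
  define L where "L = 2 * D / (1 - \<rho>)"
  have \<rho>: "0 \<le> \<rho>" "\<rho> < 1" "\<beta> \<le> \<rho>" using \<beta> by (auto simp: \<rho>_def)
  have D0: "0 \<le> D" using D by linarith
  have L: "2 * D + \<rho> * L = L" unfolding L_def using \<rho> by (simp add: field_simps)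
  have L0: "0 \<le> L" unfolding L_def using \<rho> D0 by simp
  have LD: "2 * D \<le> L" using L \<rho> L0 by (smt (verit) mult_nonneg_nonneg)
  {
    case 0
    show ?case using D LD D0 unfolding \<rho>_def[symmetric] L_def[symmetric] by simp
  next
    case (Suc t)
    let ?y = "tar1 1 \<beta> r Y0 eps t \<omega>"
    have IH: "- L \<le> ?y" using Suc unfolding L_def \<rho>_def by simp
    have e: "\<bar>eps (Suc t) \<omega>\<bar> \<le> D" using Suc by (intro eps) auto
    have "- L \<le> tar1 1 \<beta> r Y0 eps (Suc t) \<omega>"
    proof (cases "?y > r")
      case True
      then show ?thesis using e D LD by simp
    next
      case False
      have "- (\<rho> * L) \<le> \<beta> * ?y"
      proof (cases "\<beta> \<le> 0")
        case True
        then have "0 \<le> \<beta> * ?y" using False r by (intro mult_nonpos_nonpos) auto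
        then show ?thesis using \<rho> L0 by (smt (verit) mult_nonneg_nonneg)
      next
        case b: False
        then have "\<beta> * (- L) \<le> \<beta> * ?y" using IH by (intro mult_left_mono) auto
        then show ?thesis using b by (simp add: \<rho>_def)
      qed
      then show ?thesis using False e L D0 by simp
    qed
    then show ?case unfolding L_def \<rho>_def .
  }
qed

text \<open>
  \<open>free_walk + regulator\<close> is the discrete Skorokhod reflection of the random walk at \<open>0\<close>.
\<close>

fun free_walk :: "('a \<Rightarrow> real) \<Rightarrow> (nat \<Rightarrow> 'a \<Rightarrow> real) \<Rightarrow> nat \<Rightarrow> 'a \<Rightarrow> real" where
  "free_walk Y0 eps 0 \<omega> = Y0 \<omega>"
| "free_walk Y0 eps (Suc t) \<omega> = free_walk Y0 eps t \<omega> + eps (Suc t) \<omega>"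

fun regulator :: "('a \<Rightarrow> real) \<Rightarrow> (nat \<Rightarrow> 'a \<Rightarrow> real) \<Rightarrow> nat \<Rightarrow> 'a \<Rightarrow> real" where
  "regulator Y0 eps 0 \<omega> = max 0 (- Y0 \<omega>)"
| "regulator Y0 eps (Suc t) \<omega> = max (regulator Y0 eps t \<omega>) (- free_walk Y0 eps (Suc t) \<omega>)"

lemma free_walk_le_regulator: "- free_walk Y0 eps t \<omega> \<le> regulator Y0 eps t \<omega>"
  by (cases t) auto

text \<open>\<open>P\<close> is what the threshold adds to the free walk. It never decreases, and
  the lower bound \<open>- L\<close> for the state at every time forces \<open>P\<close> above the
  regulator minus \<open>L\<close>. It grows only while the state is at most
  \<open>r \<le> 0\<close>; just before such a jump \<open>P\<close> is at most
  \<open>- free_walk\<close>, hence at most the regulator, and the jump is at most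
  \<open>(1 - \<beta>) * L\<close>. So overshoots do not accumulate, and the constant is
  \<open>L + (1 - \<beta>) * L\<close>.\<close>

lemma tar1_near_reflected_walk:
  assumes \<beta>: "\<beta> < 1" and r: "r \<le> 0" and D: "\<bar>Y0 \<omega>\<bar> \<le> D" "\<bar>r\<bar> \<le> D"
    and eps: "\<And>k. 1 \<le> k \<Longrightarrow> k \<le> n \<Longrightarrow> \<bar>eps k \<omega>\<bar> \<le> D"
    and t: "t \<le> n"
  shows "\<bar>tar1 1 \<beta> r Y0 eps t \<omega> - (free_walk Y0 eps t \<omega> + regulator Y0 eps t \<omega>)\<bar>
    \<le> (2 - \<beta>) * (2 / (1 - max \<beta> 0)) * D"
proof -
  define L where "L = 2 * D / (1 - max \<beta> 0)"
  have low: "- L \<le> tar1 1 \<beta> r Y0 eps t \<omega>" if "t \<le> n" for t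
    unfolding L_def by (rule tar1_lower_bound[where n=n]) (use assms that in auto)
  have D0: "0 \<le> D" using D by linarith
  have "2 * D * 1 \<le> 2 * D * (1 / (1 - max \<beta> 0))"
    using \<beta> D0 by (intro mult_left_mono) (auto simp: field_simps)
  then have LD: "D \<le> L" using D0 by (simp add: L_def)
  have bL: "0 \<le> (1 - \<beta>) * L" using \<beta> LD D0 by simp
  define P where "P t = tar1 1 \<beta> r Y0 eps t \<omega> - free_walk Y0 eps t \<omega>" for t
  have "regulator Y0 eps t \<omega> - L \<le> P t \<and> P t \<le> regulator Y0 eps t \<omega> + (1 - \<beta>) * L" if "t \<le> n" for t
    using that
  proof (induction t)
    case 0
    have "0 \<le> regulator Y0 eps 0 \<omega>" by simp
    then show ?case using D LD D0 bL unfolding P_def by auto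
  next
    case (Suc t)
    let ?y = "tar1 1 \<beta> r Y0 eps t \<omega>"
    have IH: "regulator Y0 eps t \<omega> - L \<le> P t" "P t \<le> regulator Y0 eps t \<omega> + (1 - \<beta>) * L"
      using Suc by auto
    have low1: "- L - free_walk Y0 eps (Suc t) \<omega> \<le> P (Suc t)"
      using low[OF Suc.prems] unfolding P_def by simp
    show ?case
    proof (cases "?y > r")
      case True
      then have "P (Suc t) = P t" unfolding P_def by simp
      then show ?thesis using IH low1 by auto
    next
      case False
      then have inc: "P (Suc t) = P t + (1 - \<beta>) * (- ?y)"
        unfolding P_def by (simp add: algebra_simps)
      have "0 \<le> (1 - \<beta>) * (- ?y)" using False r \<beta> by (intro mult_nonneg_nonneg) auto
      moreover have "(1 - \<beta>) * (- ?y) \<le> (1 - \<beta>) * L"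
        using low[of t] Suc.prems \<beta> by (intro mult_left_mono) auto
      moreover have "P t \<le> - free_walk Y0 eps t \<omega>" using False r unfolding P_def by simp
      ultimately show ?thesis
        using IH low1 inc free_walk_le_regulator[of Y0 eps t \<omega>] by auto
    qed
  qed
  from this[OF t] have "regulator Y0 eps t \<omega> - L \<le> P t" "P t \<le> regulator Y0 eps t \<omega> + (1 - \<beta>) * L" by auto
  then have "\<bar>P t - regulator Y0 eps t \<omega>\<bar> \<le> L + (1 - \<beta>) * L" using bL LD D0 by auto
  also have "\<dots> = (2 - \<beta>) * (2 / (1 - max \<beta> 0)) * D" unfolding L_def by (simp add: algebra_simps flip: add_divide_distrib)
  finally show ?thesis unfolding P_def by (simp add: algebra_simps)
qed

text \<open>Running product of coefficients \<open>1\<close> and \<open>-1\<close>, each its own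
  inverse. The value at \<open>Suc t\<close> depends on the states up to \<open>t\<close> only, so
  it is known before \<open>eps (Suc t)\<close> enters.\<close>

fun tar_sign :: "real \<Rightarrow> ('a \<Rightarrow> real) \<Rightarrow> (nat \<Rightarrow> 'a \<Rightarrow> real) \<Rightarrow> nat \<Rightarrow> 'a \<Rightarrow> real" where
  "tar_sign r Y0 eps 0 \<omega> = 1"
| "tar_sign r Y0 eps (Suc t) \<omega> = (if tar1 1 (-1) r Y0 eps t \<omega> > r then 1 else -1) * tar_sign r Y0 eps t \<omega>"

definition signed_walk :: "real \<Rightarrow> ('a \<Rightarrow> real) \<Rightarrow> (nat \<Rightarrow> 'a \<Rightarrow> real) \<Rightarrow> nat \<Rightarrow> 'a \<Rightarrow> real" where
  "signed_walk r Y0 eps t \<omega> = (\<Sum>s<t. tar_sign r Y0 eps (Suc s) \<omega> * eps (Suc s) \<omega>)"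

lemma tar_sign_cases: "tar_sign r Y0 eps t \<omega> = 1 \<or> tar_sign r Y0 eps t \<omega> = -1"
  by (induction t) auto

text \<open>Multiplying the recursion by the new sign cancels the coefficient, whose square is
  1.\<close>

lemma tar_sign_mult_tar1:
  "tar_sign r Y0 eps t \<omega> * tar1 1 (-1) r Y0 eps t \<omega> = Y0 \<omega> + signed_walk r Y0 eps t \<omega>"
  by (induction t) (auto simp: signed_walk_def algebra_simps)

text \<open>\<open>5 * D\<close> consists of \<open>D\<close> for dropping \<open>Y0\<close> inside
  the modulus and \<open>4 * D\<close> for replacing the state by its modulus. The state is at least
  \<open>- 2 * D\<close>: a step from above \<open>r\<close> ends above \<open>r - D\<close>, and a
  step from at or below \<open>r\<close> ends at or above \<open>- r - D\<close>.\<close>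

lemma tar1_near_signed_walk:
  assumes D: "\<bar>Y0 \<omega>\<bar> \<le> D" "\<bar>r\<bar> \<le> D"
    and eps: "\<And>k. 1 \<le> k \<Longrightarrow> k \<le> n \<Longrightarrow> \<bar>eps k \<omega>\<bar> \<le> D"
    and t: "t \<le> n"
  shows "\<bar>tar1 1 (-1) r Y0 eps t \<omega> - \<bar>signed_walk r Y0 eps t \<omega>\<bar>\<bar> \<le> 5 * D"
proof -
  have "- (2 * D) \<le> tar1 1 (-1) r Y0 eps t \<omega>"
  proof (cases t)
    case (Suc s)
    have "\<bar>eps (Suc s) \<omega>\<bar> \<le> D" using eps t Suc by auto
    then show ?thesis using D Suc by auto
  qed (use D in auto)
  moreover have "\<bar>tar1 1 (-1) r Y0 eps t \<omega>\<bar> = \<bar>Y0 \<omega> + signed_walk r Y0 eps t \<omega>\<bar>"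
    using tar_sign_mult_tar1[of r Y0 eps t \<omega>] tar_sign_cases[of r Y0 eps t \<omega>] by auto
  ultimately show ?thesis using D by linarith
qed

text \<open>\<open>signed_walk\<close> always comes from the model with coefficient
  \<open>-1\<close>, driven by the same innovations. For other \<open>\<beta>\<close> the reflected
  walk is the intermediary: the two models are within \<open>C * D\<close> and \<open>6 * D\<close>
  of it, where \<open>6\<close> is the reflection constant at \<open>\<beta> = -1\<close>, and
  \<open>5 * D\<close> pays for the passage to the modulus.\<close>

lemma tar1_near_abs_signed_walk:
  assumes "(\<alpha> = 1 \<and> \<beta> < 1 \<and> r \<le> 0) \<or> (\<alpha> = 1 \<and> \<beta> = -1)"
  obtains C where "0 \<le> C" "\<And>Y0 eps \<omega> D n t. \<bar>Y0 \<omega>\<bar> \<le> D \<Longrightarrow> \<bar>r\<bar> \<le> D \<Longrightarrow>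
    (\<And>k. 1 \<le> k \<Longrightarrow> k \<le> n \<Longrightarrow> \<bar>eps k \<omega>\<bar> \<le> D) \<Longrightarrow> t \<le> n \<Longrightarrow>
    \<bar>tar1 \<alpha> \<beta> r Y0 eps t \<omega> - \<bar>signed_walk r Y0 eps t \<omega>\<bar>\<bar> \<le> C * D"
proof (cases "\<beta> = -1")
  case True
  show ?thesis
  proof (rule that[of 5])
    fix Y0 :: "'a \<Rightarrow> real" and eps :: "nat \<Rightarrow> 'a \<Rightarrow> real" and \<omega> D n t
    assume a: "\<bar>Y0 \<omega>\<bar> \<le> D" "\<bar>r\<bar> \<le> D" "\<And>k. 1 \<le> k \<Longrightarrow> k \<le> n \<Longrightarrow> \<bar>eps k \<omega>\<bar> \<le> D" "t \<le> n"
    show "\<bar>tar1 \<alpha> \<beta> r Y0 eps t \<omega> - \<bar>signed_walk r Y0 eps t \<omega>\<bar>\<bar> \<le> 5 * D"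
      using tar1_near_signed_walk[where n=n and ?Y0.0=Y0 and \<omega>=\<omega> and eps=eps] a True assms by auto
  qed simp
next
  case False
  then have \<beta>: "\<alpha> = 1" "\<beta> < 1" "r \<le> 0" using assms by auto
  define C where "C = (2 - \<beta>) * (2 / (1 - max \<beta> 0))"
  have "0 \<le> C" unfolding C_def using \<beta> by (intro mult_nonneg_nonneg divide_nonneg_nonneg) auto
  show ?thesis
  proof (rule that[of "C + 6 + 5"])
    fix Y0 :: "'a \<Rightarrow> real" and eps :: "nat \<Rightarrow> 'a \<Rightarrow> real" and \<omega> D n t
    assume a: "\<bar>Y0 \<omega>\<bar> \<le> D" "\<bar>r\<bar> \<le> D" "\<And>k. 1 \<le> k \<Longrightarrow> k \<le> n \<Longrightarrow> \<bar>eps k \<omega>\<bar> \<le> D" "t \<le> n"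
    have "\<bar>tar1 1 \<beta> r Y0 eps t \<omega> - (free_walk Y0 eps t \<omega> + regulator Y0 eps t \<omega>)\<bar> \<le> C * D"
      unfolding C_def by (rule tar1_near_reflected_walk[where n=n]) (use a \<beta> in auto)
    moreover have "\<bar>tar1 1 (-1) r Y0 eps t \<omega> - (free_walk Y0 eps t \<omega> + regulator Y0 eps t \<omega>)\<bar> \<le> 6 * D"
      using tar1_near_reflected_walk[where n=n and \<beta>="-1" and ?Y0.0=Y0 and \<omega>=\<omega> and eps=eps] a \<beta> by simp
    moreover have "\<bar>tar1 1 (-1) r Y0 eps t \<omega> - \<bar>signed_walk r Y0 eps t \<omega>\<bar>\<bar> \<le> 5 * D"
      by (rule tar1_near_signed_walk[where n=n]) (use a in auto)
    moreover have "(C + 6 + 5) * D = C * D + 6 * D + 5 * D" by (simp add: algebra_simps)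
    ultimately show "\<bar>tar1 \<alpha> \<beta> r Y0 eps t \<omega> - \<bar>signed_walk r Y0 eps t \<omega>\<bar>\<bar> \<le> (C + 6 + 5) * D"
      unfolding \<beta>(1) by linarith
  qed (use \<open>0 \<le> C\<close> in auto)
qed

section \<open>Sums of innovations with predictable signs\<close>

text \<open>\<open>\<xi> t\<close> stands for the innovation at time \<open>t + 1\<close>:
  \<open>F t\<close> is the past it is independent of, and \<open>c t\<close> is the sign chosen
  from that past.\<close>

locale signed_innovations = prob_space M for M :: "'a measure" +
  fixes F :: "nat \<Rightarrow> 'a measure" and \<xi> c :: "nat \<Rightarrow> 'a \<Rightarrow> real" and \<sigma> :: real
  assumes subalg: "\<And>t. subalgebra M (F t)"
    and F_mono: "\<And>s t. s \<le> t \<Longrightarrow> sets (F s) \<subseteq> sets (F t)"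
    and \<xi>_adapted: "\<And>t. \<xi> t \<in> borel_measurable (F (Suc t))"
    and c_predictable: "\<And>t. c t \<in> borel_measurable (F t)"
    and c_sign: "\<And>t \<omega>. c t \<omega> = 1 \<or> c t \<omega> = -1"
    and indep_\<xi>: "\<And>t. indep_set (sets (F t)) {\<xi> t -` A \<inter> space M | A. A \<in> sets borel}"
    and distr_\<xi>: "\<And>t. distr M borel (\<xi> t) = distr M borel (\<xi> 0)"
    and integrable_\<xi>2_0: "integrable M (\<lambda>\<omega>. (\<xi> 0 \<omega>)\<^sup>2)"
    and mean_\<xi>_0: "expectation (\<xi> 0) = 0"
    and \<sigma>_pos: "\<sigma> > 0"
    and var_\<xi>_0: "expectation (\<lambda>\<omega>. (\<xi> 0 \<omega>)\<^sup>2) = \<sigma>\<^sup>2"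
begin

lemma space_F [simp]: "space (F t) = space M"
  using subalg unfolding subalgebra_def by auto

lemma measurable_F_mono: "f \<in> measurable (F s) N \<Longrightarrow> s \<le> t \<Longrightarrow> f \<in> measurable (F t) N"
  using F_mono[of s t] by (auto simp: measurable_def)

lemma measurable_F_M: "f \<in> measurable (F s) N \<Longrightarrow> f \<in> measurable M N"
  by (rule measurable_from_subalg[OF subalg])

lemma sets_F_M: "A \<in> sets (F s) \<Longrightarrow> A \<in> sets M"
  using subalg unfolding subalgebra_def by auto

lemma \<xi>_meas [measurable]: "\<xi> t \<in> borel_measurable M"
  by (rule measurable_F_M[OF \<xi>_adapted])

lemma c_meas [measurable]: "c t \<in> borel_measurable M"
  by (rule measurable_F_M[OF c_predictable])

lemma abs_c [simp]: "\<bar>c t \<omega>\<bar> = 1"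
  using c_sign[of t \<omega>] by auto

lemma integral_\<xi>:
  fixes f :: "real \<Rightarrow> 'b::{banach, second_countable_topology}"
  assumes [measurable]: "f \<in> borel_measurable borel"
  shows "expectation (\<lambda>\<omega>. f (\<xi> t \<omega>)) = expectation (\<lambda>\<omega>. f (\<xi> 0 \<omega>))"
    and "integrable M (\<lambda>\<omega>. f (\<xi> t \<omega>)) \<longleftrightarrow> integrable M (\<lambda>\<omega>. f (\<xi> 0 \<omega>))"
proof -
  show "expectation (\<lambda>\<omega>. f (\<xi> t \<omega>)) = expectation (\<lambda>\<omega>. f (\<xi> 0 \<omega>))"
    using integral_distr[of "\<xi> t" M borel f] integral_distr[of "\<xi> 0" M borel f] distr_\<xi>[of t] by simp
  show "integrable M (\<lambda>\<omega>. f (\<xi> t \<omega>)) \<longleftrightarrow> integrable M (\<lambda>\<omega>. f (\<xi> 0 \<omega>))"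
    using integrable_distr_eq[of "\<xi> t" M borel f] integrable_distr_eq[of "\<xi> 0" M borel f] distr_\<xi>[of t] by simp
qed

lemma integrable_\<xi>2: "integrable M (\<lambda>\<omega>. (\<xi> t \<omega>)\<^sup>2)"
  using integral_\<xi>(2)[of "\<lambda>x. x\<^sup>2" t] integrable_\<xi>2_0 by simp

lemma var_\<xi>: "expectation (\<lambda>\<omega>. (\<xi> t \<omega>)\<^sup>2) = \<sigma>\<^sup>2"
  using integral_\<xi>(1)[of "\<lambda>x. x\<^sup>2" t] var_\<xi>_0 by simp

lemma integrable_\<xi>: "integrable M (\<xi> t)"
  by (rule square_integrable_imp_integrable[OF _ integrable_\<xi>2]) simp

lemma mean_\<xi>: "expectation (\<xi> t) = 0"
  using integral_\<xi>(1)[of "\<lambda>x. x" t] mean_\<xi>_0 by simp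

lemma indep_past:
  assumes A: "A \<in> measurable (F t) S" and f: "f \<in> measurable borel T"
  shows "indep_var S A T (\<lambda>\<omega>. f (\<xi> t \<omega>))"
  unfolding indep_var_eq
proof (intro conjI)
  show Am: "A \<in> measurable M S" by (rule measurable_F_M[OF A])
  show fm: "(\<lambda>\<omega>. f (\<xi> t \<omega>)) \<in> measurable M T" using f by simp
  have "indep_set {A -` B \<inter> space M | B. B \<in> sets S} {(\<lambda>\<omega>. f (\<xi> t \<omega>)) -` B \<inter> space M | B. B \<in> sets T}"
    unfolding indep_set_def
  proof (rule indep_sets_mono_sets[OF indep_\<xi>[of t, unfolded indep_set_def]], clarsimp split: bool.splits, safe)
    fix B assume "B \<in> sets S"
    then show "A -` B \<inter> space M \<in> sets (F t)" using measurable_sets[OF A] by simp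
  next
    fix B assume "B \<in> sets T"
    then have "f -` B \<in> sets borel" using measurable_sets[OF f] by simp
    then show "\<exists>A. (\<lambda>\<omega>. f (\<xi> t \<omega>)) -` B \<inter> space M = \<xi> t -` A \<inter> space M \<and> A \<in> sets borel"
      by (intro exI[of _ "f -` B"]) auto
  qed
  then show "indep_set (sigma_sets (space M) {A -` B \<inter> space M | B. B \<in> sets S})
     (sigma_sets (space M) {(\<lambda>\<omega>. f (\<xi> t \<omega>)) -` B \<inter> space M | B. B \<in> sets T})"
  proof (rule indep_set_sigma_sets)
    show "Int_stable {A -` B \<inter> space M | B. B \<in> sets S}"
      by (auto simp: Int_stable_def) (metis (no_types, lifting) Int_assoc Int_left_commute sets.Int vimage_Int inf.idem)
    show "Int_stable {(\<lambda>\<omega>. f (\<xi> t \<omega>)) -` B \<inter> space M | B. B \<in> sets T}"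
      by (auto simp: Int_stable_def) (metis (no_types, lifting) Int_assoc Int_left_commute sets.Int vimage_Int inf.idem)
  qed
qed

text \<open>Stands in for conditioning on \<open>F t\<close>.\<close>

lemma expectation_past_mult:
  fixes A :: "'a \<Rightarrow> 'b::{real_normed_field, banach, second_countable_topology}"
  assumes A: "A \<in> borel_measurable (F t)" "integrable M A"
    and f: "f \<in> borel_measurable borel" "integrable M (\<lambda>\<omega>. f (\<xi> t \<omega>))"
  shows "expectation (\<lambda>\<omega>. A \<omega> * f (\<xi> t \<omega>)) = expectation A * expectation (\<lambda>\<omega>. f (\<xi> 0 \<omega>))"
    and "integrable M (\<lambda>\<omega>. A \<omega> * f (\<xi> t \<omega>))"
  using indep_var_lebesgue_integral[OF indep_past[OF A(1) f(1)] A(2) f(2)]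
    indep_var_integrable[OF indep_past[OF A(1) f(1)] A(2) f(2)] integral_\<xi>(1)[OF f(1), of t]
  by auto

section \<open>Second moments of the signed walk, a maximal inequality and characteristic
  functions\<close>

definition V :: "nat \<Rightarrow> 'a \<Rightarrow> real" where
  "V t \<omega> = (\<Sum>s<t. c s \<omega> * \<xi> s \<omega>)"

lemma V_Suc: "V (Suc t) \<omega> = V t \<omega> + c t \<omega> * \<xi> t \<omega>"
  by (simp add: V_def)

lemma V_adapted: "t \<le> u \<Longrightarrow> V t \<in> borel_measurable (F u)"
  unfolding V_def
proof (rule borel_measurable_sum, rule borel_measurable_times)
  fix s assume "t \<le> u" "s \<in> {..<t}"
  then show "c s \<in> borel_measurable (F u)" "\<xi> s \<in> borel_measurable (F u)"
    by (auto intro: measurable_F_mono[OF c_predictable] measurable_F_mono[OF \<xi>_adapted])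
qed

lemma V_meas [measurable]: "V t \<in> borel_measurable M"
  by (rule measurable_F_M[OF V_adapted[OF order.refl]])

text \<open>Orthogonality of martingale increments: the cross term is a past variable times an
  innovation of mean zero, and squaring removes the sign. The past event \<open>A\<close> is carried
  along so that the identity can be used after a first passage.\<close>

lemma V_increment_second_moment:
  assumes A: "A \<in> sets (F a)"
  shows "integrable M (\<lambda>\<omega>. (V (a + N) \<omega> - V a \<omega>)\<^sup>2)"
    and "expectation (\<lambda>\<omega>. indicator A \<omega> * (V (a + N) \<omega> - V a \<omega>)\<^sup>2) = real N * \<sigma>\<^sup>2 * prob A"
proof (induction N)
  case 0
  { case 1 then show ?case by simp next case 2 then show ?case by simp }
next
  case (Suc N)
  define D where "D \<omega> = V (a + N) \<omega> - V a \<omega>" for \<omega>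
  have D_F: "D \<in> borel_measurable (F (a + N))"
    unfolding D_def by (intro borel_measurable_diff V_adapted) auto
  note D_M [measurable] = measurable_F_M[OF D_F]
  have AM [measurable]: "A \<in> sets M" by (rule sets_F_M[OF A])
  have AF: "A \<in> sets (F (a + N))" using A F_mono[of a "a + N"] by auto
  have D2: "integrable M (\<lambda>\<omega>. (D \<omega>)\<^sup>2)" using Suc(1) unfolding D_def .
  have D1: "integrable M D" by (rule square_integrable_imp_integrable[OF _ D2]) simp
  have cD: "integrable M (\<lambda>\<omega>. 2 * c (a + N) \<omega> * D \<omega>)"
  proof (rule Bochner_Integration.integrable_bound[OF integrable_mult_right[OF integrable_abs[OF D1], of 2]])
    show "AE \<omega> in M. norm (2 * c (a + N) \<omega> * D \<omega>) \<le> norm (2 * \<bar>D \<omega>\<bar>)"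
      by (intro AE_I2) (simp add: abs_mult)
  qed simp
  have cDA: "integrable M (\<lambda>\<omega>. indicator A \<omega> * (2 * c (a + N) \<omega> * D \<omega>))"
    using integrable_real_mult_indicator[OF AM cD] by (simp add: mult.commute)
  have cDF: "(\<lambda>\<omega>. 2 * c (a + N) \<omega> * D \<omega>) \<in> borel_measurable (F (a + N))"
    by (intro borel_measurable_times D_F c_predictable borel_measurable_const)
  have eq: "(V (a + Suc N) \<omega> - V a \<omega>)\<^sup>2 = (D \<omega>)\<^sup>2 + 2 * c (a + N) \<omega> * D \<omega> * \<xi> (a + N) \<omega> + (\<xi> (a + N) \<omega>)\<^sup>2" for \<omega>
  proof -
    have "(c (a + N) \<omega>)\<^sup>2 = 1" using c_sign[of "a + N" \<omega>] by auto
    moreover have "V (a + Suc N) \<omega> - V a \<omega> = D \<omega> + c (a + N) \<omega> * \<xi> (a + N) \<omega>"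
      by (simp add: D_def V_Suc)
    ultimately show ?thesis by (simp add: power2_sum power_mult_distrib algebra_simps)
  qed
  have i1: "integrable M (\<lambda>\<omega>. 2 * c (a + N) \<omega> * D \<omega> * \<xi> (a + N) \<omega>)"
    using expectation_past_mult(2)[OF cDF cD, of "\<lambda>x. x"] integrable_\<xi> by simp
  {
    case 1
    show ?case unfolding eq by (intro Bochner_Integration.integrable_add D2 i1 integrable_\<xi>2)
  next
    case 2
    have iA: "(\<lambda>\<omega>. indicator A \<omega> * (2 * c (a + N) \<omega> * D \<omega>)) \<in> borel_measurable (F (a + N))"
      by (rule borel_measurable_times[OF borel_measurable_indicator[OF AF] cDF])
    have e1: "expectation (\<lambda>\<omega>. indicator A \<omega> * (2 * c (a + N) \<omega> * D \<omega>) * \<xi> (a + N) \<omega>) = 0"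
      using expectation_past_mult(1)[OF iA cDA, of "\<lambda>x. x"] integrable_\<xi> mean_\<xi> by simp
    have i1': "integrable M (\<lambda>\<omega>. indicator A \<omega> * (2 * c (a + N) \<omega> * D \<omega>) * \<xi> (a + N) \<omega>)"
      using expectation_past_mult(2)[OF iA cDA, of "\<lambda>x. x"] integrable_\<xi> by simp
    have iI: "integrable M (indicator A :: 'a \<Rightarrow> real)"
      using AM by (simp add: integrable_indicator_iff emeasure_eq_measure)
    have iF: "(indicator A :: 'a \<Rightarrow> real) \<in> borel_measurable (F (a + N))"
      by (intro borel_measurable_indicator AF)
    have e2: "expectation (\<lambda>\<omega>. indicator A \<omega> * (\<xi> (a + N) \<omega>)\<^sup>2) = prob A * \<sigma>\<^sup>2"
      using expectation_past_mult(1)[OF iF iI, of "\<lambda>x. x\<^sup>2"] integrable_\<xi>2 var_\<xi> by simp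
    have i2: "integrable M (\<lambda>\<omega>. indicator A \<omega> * (\<xi> (a + N) \<omega>)\<^sup>2)"
      using expectation_past_mult(2)[OF iF iI, of "\<lambda>x. x\<^sup>2"] integrable_\<xi>2 by simp
    have i3: "integrable M (\<lambda>\<omega>. indicator A \<omega> * (D \<omega>)\<^sup>2)"
      using integrable_real_mult_indicator[OF AM D2] by (simp add: mult.commute)
    have "expectation (\<lambda>\<omega>. indicator A \<omega> * (V (a + Suc N) \<omega> - V a \<omega>)\<^sup>2) =
      expectation (\<lambda>\<omega>. indicator A \<omega> * (D \<omega>)\<^sup>2 + indicator A \<omega> * (2 * c (a + N) \<omega> * D \<omega>) * \<xi> (a + N) \<omega>
         + indicator A \<omega> * (\<xi> (a + N) \<omega>)\<^sup>2)"
      by (simp only: eq) (simp add: algebra_simps)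
    also have "\<dots> = expectation (\<lambda>\<omega>. indicator A \<omega> * (D \<omega>)\<^sup>2) + 0 + prob A * \<sigma>\<^sup>2"
      by (simp only: Bochner_Integration.integral_add Bochner_Integration.integrable_add i1' i2 i3 e1 e2)
    also have "expectation (\<lambda>\<omega>. indicator A \<omega> * (D \<omega>)\<^sup>2) = real N * \<sigma>\<^sup>2 * prob A"
      using Suc(2) unfolding D_def .
    finally show ?case by (simp add: algebra_simps)
  }
qed

text \<open>Decompose by the first index \<open>k\<close> at which the level \<open>2 * l\<close> is
  exceeded. If the final increment stays within \<open>l\<close>, the walk must move by more than
  \<open>l\<close> after \<open>k\<close>. Chebyshev's inequality on the past event
  \<open>E k\<close> shows that this takes at most half of its probability, which is where the
  variance condition enters.\<close>

lemma ottaviani: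
  assumes l: "0 < l" and N: "real N * \<sigma>\<^sup>2 \<le> l\<^sup>2 / 2"
  shows "prob {\<omega>\<in>space M. \<exists>k\<le>N. \<bar>V (a + k) \<omega> - V a \<omega>\<bar> > 2 * l} \<le>
     2 * prob {\<omega>\<in>space M. \<bar>V (a + N) \<omega> - V a \<omega>\<bar> > l}"
proof -
  define D where "D k \<omega> = V (a + k) \<omega> - V a \<omega>" for k \<omega>
  define E where "E k = {\<omega>\<in>space M. \<bar>D k \<omega>\<bar> > 2 * l \<and> (\<forall>i<k. \<bar>D i \<omega>\<bar> \<le> 2 * l)}" for k
  define G where "G = {\<omega>\<in>space M. \<bar>D N \<omega>\<bar> > l}"
  have D_F: "D k \<in> borel_measurable (F (a + j))" if "k \<le> j" for k j
    unfolding D_def using that by (intro borel_measurable_diff V_adapted) auto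
  note D_M [measurable] = measurable_F_M[OF D_F[OF order.refl]]
  have E_F: "E k \<in> sets (F (a + k))" for k
  proof -
    have m: "{\<omega>\<in>space (F (a + k)). \<bar>D i \<omega>\<bar> \<le> 2 * l} \<in> sets (F (a + k))"
      "{\<omega>\<in>space (F (a + k)). \<bar>D i \<omega>\<bar> > 2 * l} \<in> sets (F (a + k))" if "i \<le> k" for i
    proof -
      have [measurable]: "D i \<in> borel_measurable (F (a + k))" using that by (rule D_F)
      show "{\<omega>\<in>space (F (a + k)). \<bar>D i \<omega>\<bar> \<le> 2 * l} \<in> sets (F (a + k))"
        "{\<omega>\<in>space (F (a + k)). \<bar>D i \<omega>\<bar> > 2 * l} \<in> sets (F (a + k))"
        by measurable
    qed
    have "{\<omega>\<in>space (F (a + k)). \<bar>D k \<omega>\<bar> > 2 * l \<and> (\<forall>i\<in>{..<k}. \<bar>D i \<omega>\<bar> \<le> 2 * l)} \<in> sets (F (a + k))"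
      by (intro sets.sets_Collect_conj sets.sets_Collect_finite_All finite_lessThan m) auto
    then show ?thesis by (simp add: E_def Ball_def)
  qed
  have E_M [measurable]: "E k \<in> sets M" for k by (rule sets_F_M[OF E_F])
  have G_M [measurable]: "G \<in> sets M" unfolding G_def by measurable
  have disj: "disjoint_family_on E {..N}"
    unfolding disjoint_family_on_def E_def by (auto simp: not_less) (metis linorder_neqE_nat not_less)
  have U: "{\<omega>\<in>space M. \<exists>k\<le>N. \<bar>D k \<omega>\<bar> > 2 * l} = (\<Union>k\<le>N. E k)"
  proof (intro set_eqI iffI)
    fix \<omega> assume "\<omega> \<in> {\<omega>\<in>space M. \<exists>k\<le>N. \<bar>D k \<omega>\<bar> > 2 * l}"
    then obtain k0 where k0: "k0 \<le> N" "\<bar>D k0 \<omega>\<bar> > 2 * l" "\<omega> \<in> space M" by auto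
    define k where "k = (LEAST k. \<bar>D k \<omega>\<bar> > 2 * l)"
    have "\<bar>D k \<omega>\<bar> > 2 * l" unfolding k_def using k0(2) by (rule LeastI)
    moreover have "k \<le> k0" unfolding k_def using k0(2) by (rule Least_le)
    moreover have "\<forall>i<k. \<bar>D i \<omega>\<bar> \<le> 2 * l" unfolding k_def using not_less_Least linorder_not_less by blast
    ultimately show "\<omega> \<in> (\<Union>k\<le>N. E k)" using k0 unfolding E_def by auto
  qed (auto simp: E_def)
  have half: "prob (E k) \<le> 2 * prob (E k \<inter> G)" if k: "k \<le> N" for k
  proof -
    define B where "B = {\<omega>\<in>space M. \<bar>V (a + N) \<omega> - V (a + k) \<omega>\<bar> > l}"
    have B_M [measurable]: "B \<in> sets M" unfolding B_def by measurable
    have eq: "a + k + (N - k) = a + N" using k by simp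
    note m2 = V_increment_second_moment[OF E_F[of k], of "N - k", unfolded eq]
    have i: "integrable M (\<lambda>\<omega>. indicator (E k) \<omega> * (V (a + N) \<omega> - V (a + k) \<omega>)\<^sup>2)"
      using integrable_real_mult_indicator[OF E_M m2(1)] by (simp add: mult.commute)
    have "l\<^sup>2 * prob (E k \<inter> B) = expectation (\<lambda>\<omega>. l\<^sup>2 * indicator (E k \<inter> B) \<omega>)"
      by simp
    also have "\<dots> \<le> expectation (\<lambda>\<omega>. indicator (E k) \<omega> * (V (a + N) \<omega> - V (a + k) \<omega>)\<^sup>2)"
    proof (rule integral_mono[OF _ i])
      show "integrable M (\<lambda>\<omega>. l\<^sup>2 * indicator (E k \<inter> B) \<omega>)"
        by (intro integrable_mult_right) (simp add: integrable_indicator_iff emeasure_eq_measure)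
      fix \<omega>
      have "l\<^sup>2 \<le> (V (a + N) \<omega> - V (a + k) \<omega>)\<^sup>2" if "\<omega> \<in> B"
        using that l unfolding B_def by (simp add: abs_le_square_iff[symmetric])
      then show "l\<^sup>2 * indicator (E k \<inter> B) \<omega> \<le> indicator (E k) \<omega> * (V (a + N) \<omega> - V (a + k) \<omega>)\<^sup>2"
        by (auto simp: indicator_def)
    qed
    also have "\<dots> = real (N - k) * \<sigma>\<^sup>2 * prob (E k)" by (rule m2(2))
    also have "\<dots> \<le> real N * \<sigma>\<^sup>2 * prob (E k)" by (intro mult_right_mono) auto
    also have "\<dots> \<le> l\<^sup>2 / 2 * prob (E k)" using N by (intro mult_right_mono) auto
    finally have "prob (E k \<inter> B) \<le> prob (E k) / 2" using l by (simp add: field_simps)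
    moreover have "prob (E k) \<le> prob (E k \<inter> B \<union> E k \<inter> G)"
    proof (rule finite_measure_mono)
      show "E k \<subseteq> E k \<inter> B \<union> E k \<inter> G"
        unfolding E_def B_def G_def D_def by auto
    qed simp
    moreover have "prob (E k \<inter> B \<union> E k \<inter> G) \<le> prob (E k \<inter> B) + prob (E k \<inter> G)"
      by (rule measure_Un_le) auto
    ultimately show ?thesis by linarith
  qed
  have "prob (\<Union>k\<le>N. E k) = (\<Sum>k\<le>N. prob (E k))"
    by (rule finite_measure_finite_Union) (auto intro: disj)
  also have "\<dots> \<le> (\<Sum>k\<le>N. 2 * prob (E k \<inter> G))" by (intro sum_mono half) auto
  also have "\<dots> = 2 * prob (\<Union>k\<le>N. E k \<inter> G)"
  proof -
    have "disjoint_family_on (\<lambda>k. E k \<inter> G) {..N}"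
      using disj unfolding disjoint_family_on_def by auto
    then have "prob (\<Union>k\<le>N. E k \<inter> G) = (\<Sum>k\<le>N. prob (E k \<inter> G))"
      by (intro finite_measure_finite_Union) auto
    then show ?thesis by (simp add: sum_distrib_left)
  qed
  also have "\<dots> \<le> 2 * prob G" by (intro mult_left_mono finite_measure_mono) auto
  finally show ?thesis unfolding U[symmetric] G_def D_def by simp
qed

text \<open>One innovation is replaced per induction step. On each of the two events for its sign
  the factor is the characteristic function at \<open>u\<close> or at \<open>-u\<close>, both within
  \<open>\<eta>\<close> of the common value \<open>\<psi>\<close>, at a cost of
  \<open>K * \<eta>\<close> per event. Since \<open>norm \<psi> \<le> 1\<close>, earlier errors are
  not amplified.\<close>

lemma expectation_iexp_increment:
  fixes W :: "'a \<Rightarrow> complex"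
  assumes W: "W \<in> borel_measurable (F a)" "\<And>\<omega>. \<omega> \<in> space M \<Longrightarrow> norm (W \<omega>) \<le> K"
    and \<psi>: "norm \<psi> \<le> 1" "norm (char (distr M borel (\<xi> 0)) u - \<psi>) \<le> \<eta>" "norm (char (distr M borel (\<xi> 0)) (-u) - \<psi>) \<le> \<eta>"
    and K: "0 \<le> K"
  shows "norm (expectation (\<lambda>\<omega>. W \<omega> * iexp (u * (V (a + N) \<omega> - V a \<omega>))) - expectation W * \<psi> ^ N) \<le> real N * (2 * K * \<eta>)"
proof (induction N)
  case 0
  then show ?case by simp
next
  case (Suc N)
  have \<eta>0: "0 \<le> \<eta>" using \<psi>(2) norm_ge_zero order.trans by blast
  define W' where "W' \<omega> = W \<omega> * iexp (u * (V (a + N) \<omega> - V a \<omega>))" for \<omega>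
  define P where "P = {\<omega>\<in>space M. c (a + N) \<omega> = 1}"
  define \<phi> where "\<phi> = char (distr M borel (\<xi> 0))"
  have P_F: "P \<in> sets (F (a + N))"
    using measurable_sets[OF c_predictable[of "a + N"], of "{1}"] unfolding P_def
    by (simp add: vimage_def Int_def conj_commute)
  note P_M [measurable] = sets_F_M[OF P_F]
  have W'_F: "W' \<in> borel_measurable (F (a + N))"
  proof -
    have [measurable]: "W \<in> borel_measurable (F (a + N))" "V (a + N) \<in> borel_measurable (F (a + N))" "V a \<in> borel_measurable (F (a + N))"
      using W(1) by (auto intro: measurable_F_mono V_adapted)
    show ?thesis unfolding W'_def by measurable
  qed
  note W'_M [measurable] = measurable_F_M[OF W'_F]
  have W'_K: "norm (W' \<omega>) \<le> K" if "\<omega> \<in> space M" for \<omega>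
    unfolding W'_def using W(2)[OF that] by (simp add: norm_mult)
  \<comment> \<open>On \<open>P\<close> and on its complement the sign is constant, so independence
    from the past applies to each piece with a deterministic argument of the characteristic
    function.\<close>
  let ?W1 = "\<lambda>\<omega>. W' \<omega> * indicator P \<omega>" and ?W2 = "\<lambda>\<omega>. W' \<omega> * indicator (space M - P) \<omega>"
  have WF: "?W1 \<in> borel_measurable (F (a + N))" "?W2 \<in> borel_measurable (F (a + N))"
    using P_F sets.compl_sets[OF P_F]
    by (auto intro!: borel_measurable_times W'_F borel_measurable_indicator)
  have Wi: "integrable M ?W1" "integrable M ?W2" "integrable M W'"
    by (auto intro!: integrable_const_bound[of _ K] AE_I2 simp: norm_mult indicator_def W'_K K)
  have ii: "integrable M (\<lambda>\<omega>. iexp (v * \<xi> (a + N) \<omega>))" for v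
    by (rule integrable_const_bound[of _ 1]) auto
  have ch: "expectation (\<lambda>\<omega>. iexp (v * \<xi> 0 \<omega>)) = \<phi> v" for v
    unfolding \<phi>_def char_def by (subst integral_distr) auto
  have step: "expectation (\<lambda>\<omega>. Z \<omega> * iexp (v * \<xi> (a + N) \<omega>)) = expectation Z * \<phi> v"
    "integrable M (\<lambda>\<omega>. Z \<omega> * iexp (v * \<xi> (a + N) \<omega>))"
    if "Z \<in> borel_measurable (F (a + N))" "integrable M Z" for Z v
    using expectation_past_mult[OF that, of "\<lambda>x. iexp (v * x)"] ii[of v] ch[of v] by auto
  have split: "W \<omega> * iexp (u * (V (a + Suc N) \<omega> - V a \<omega>)) =
      ?W1 \<omega> * iexp (u * \<xi> (a + N) \<omega>) + ?W2 \<omega> * iexp ((-u) * \<xi> (a + N) \<omega>)" if "\<omega> \<in> space M" for \<omega>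
  proof -
    have "W \<omega> * iexp (u * (V (a + Suc N) \<omega> - V a \<omega>)) = W' \<omega> * iexp (u * c (a + N) \<omega> * \<xi> (a + N) \<omega>)"
      unfolding W'_def V_Suc add_Suc_right by (simp add: algebra_simps flip: exp_add)
    then show ?thesis using c_sign[of "a + N" \<omega>] that unfolding P_def by (auto simp: indicator_def)
  qed
  have "expectation (\<lambda>\<omega>. W \<omega> * iexp (u * (V (a + Suc N) \<omega> - V a \<omega>))) =
     expectation (\<lambda>\<omega>. ?W1 \<omega> * iexp (u * \<xi> (a + N) \<omega>) + ?W2 \<omega> * iexp ((-u) * \<xi> (a + N) \<omega>))"
    by (rule Bochner_Integration.integral_cong[OF refl split])
  also have "\<dots> = expectation ?W1 * \<phi> u + expectation ?W2 * \<phi> (-u)"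
    by (simp only: Bochner_Integration.integral_add step[OF WF(1) Wi(1)] step[OF WF(2) Wi(2)])
  finally have e: "expectation (\<lambda>\<omega>. W \<omega> * iexp (u * (V (a + Suc N) \<omega> - V a \<omega>))) = expectation ?W1 * \<phi> u + expectation ?W2 * \<phi> (-u)" .
  have s: "expectation W' = expectation ?W1 + expectation ?W2"
  proof -
    have "expectation W' = expectation (\<lambda>\<omega>. ?W1 \<omega> + ?W2 \<omega>)"
      by (rule Bochner_Integration.integral_cong) (auto simp: indicator_def)
    then show ?thesis using Wi by simp
  qed
  have n: "norm (expectation ?W1) \<le> K" "norm (expectation ?W2) \<le> K"
  proof -
    have K': "norm (expectation Z) \<le> K" if "integrable M Z" "\<And>\<omega>. \<omega> \<in> space M \<Longrightarrow> norm (Z \<omega>) \<le> K" for Z :: "'a \<Rightarrow> complex"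
    proof -
      have "norm (expectation Z) \<le> expectation (\<lambda>\<omega>. norm (Z \<omega>))" by (rule integral_norm_bound)
      also have "\<dots> \<le> expectation (\<lambda>\<omega>. K)" using that by (intro integral_mono) auto
      finally show ?thesis by (simp add: prob_space)
    qed
    show "norm (expectation ?W1) \<le> K" "norm (expectation ?W2) \<le> K"
      by (rule K'; use Wi K W'_K in \<open>simp add: norm_mult indicator_def\<close>)+
  qed
  have "norm (expectation ?W1 * \<phi> u + expectation ?W2 * \<phi> (-u) - expectation W' * \<psi>) =
     norm (expectation ?W1 * (\<phi> u - \<psi>) + expectation ?W2 * (\<phi> (-u) - \<psi>))"
    unfolding s by (simp add: algebra_simps)
  also have "\<dots> \<le> norm (expectation ?W1) * norm (\<phi> u - \<psi>) + norm (expectation ?W2) * norm (\<phi> (-u) - \<psi>)"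
    by (rule order.trans[OF norm_triangle_ineq]) (simp add: norm_mult)
  also have "\<dots> \<le> K * \<eta> + K * \<eta>"
    using \<psi> n K \<eta>0 unfolding \<phi>_def by (intro add_mono mult_mono) auto
  finally have 1: "norm (expectation (\<lambda>\<omega>. W \<omega> * iexp (u * (V (a + Suc N) \<omega> - V a \<omega>))) - expectation W' * \<psi>) \<le> 2 * K * \<eta>"
    unfolding e by simp
  have "norm (expectation W' * \<psi> - expectation W * \<psi> ^ Suc N) = norm (expectation W' - expectation W * \<psi> ^ N) * norm \<psi>"
    unfolding norm_mult[symmetric] by (simp add: algebra_simps)
  also have "\<dots> \<le> norm (expectation W' - expectation W * \<psi> ^ N) * 1"
    using \<psi>(1) by (intro mult_left_mono) auto
  also have "\<dots> \<le> real N * (2 * K * \<eta>)" using Suc unfolding W'_def by simp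
  finally have 2: "norm (expectation W' * \<psi> - expectation W * \<psi> ^ Suc N) \<le> real N * (2 * K * \<eta>)" .
  from norm_triangle_mono[OF 1 2] show ?case by (simp add: algebra_simps)
qed

end

section \<open>Finite-dimensional convergence\<close>

text \<open>A pushforward rather than a density, so that \<open>s = 0\<close> is included as the
  point mass at \<open>0\<close>.\<close>

definition centered_normal :: "real \<Rightarrow> real measure" where
  "centered_normal s = distr std_normal_distribution borel (\<lambda>z. s * z)"

lemma real_distribution_centered_normal: "real_distribution (centered_normal s)"
proof -
  interpret real_distribution std_normal_distribution by (rule real_dist_normal_dist)
  show ?thesis unfolding centered_normal_def by (intro real_distribution_distr) simp
qed

lemma char_centered_normal: "char (centered_normal s) t = complex_of_real (exp (- (s\<^sup>2 * t\<^sup>2 / 2)))"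
proof -
  have "char (centered_normal s) t = char std_normal_distribution (t * s)"
    unfolding centered_normal_def char_def by (subst integral_distr) (auto simp: mult_ac)
  then show ?thesis by (simp add: char_std_normal_distribution power_mult_distrib mult.commute)
qed

context signed_innovations
begin

text \<open>Up to \<open>n\<close> factors are replaced, so the error of each must be
  \<open>o(1/n)\<close>. The second-order expansion leaves the integral of a truncated cubic,
  dominated by \<open>6 * x\<^sup>2\<close>, which vanishes by dominated convergence without a third
  moment. The gap between \<open>1 - z\<close> and \<open>exp (- z)\<close> is at most
  \<open>z\<^sup>2\<close>, here of order \<open>1 / n\<^sup>2\<close>.\<close>

lemma char_\<xi>_error:
  "(\<lambda>n. real n * cmod (char (distr M borel (\<xi> 0)) (v / sqrt n) - complex_of_real (exp (- (\<sigma>\<^sup>2 * v\<^sup>2 / 2) / n)))) \<longlonglongrightarrow> 0"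
proof -
  define \<mu> where "\<mu> = distr M borel (\<xi> 0)"
  interpret \<mu>: real_distribution \<mu> unfolding \<mu>_def by (rule real_distribution_distr) simp
  have mom: "integrable \<mu> (\<lambda>x. x)" "\<mu>.expectation (\<lambda>x. x) = 0" "integrable \<mu> (\<lambda>x. x\<^sup>2)" "\<mu>.expectation (\<lambda>x. x\<^sup>2) = \<sigma>\<^sup>2"
    unfolding \<mu>_def using integrable_\<xi> mean_\<xi>_0 integrable_\<xi>2_0 var_\<xi>_0
    by (simp_all add: integrable_distr_eq integral_distr)
  have var: "\<mu>.variance (\<lambda>x. x) = \<sigma>\<^sup>2" using mom by simp
  define y where "y = \<sigma>\<^sup>2 * v\<^sup>2 / 2"
  have y0: "0 \<le> y" by (simp add: y_def)
  let ?E = "\<lambda>n. (LINT x|\<mu>. min (6 * x\<^sup>2) (\<bar>v / sqrt (real n)\<bar> * \<bar>x\<bar> ^ 3))"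
  have bound: "real n * cmod (char \<mu> (v / sqrt n) - complex_of_real (exp (- y / n))) \<le> v\<^sup>2 / 6 * ?E n + y\<^sup>2 / n" for n :: nat
  proof (cases "n = 0")
    case True
    then show ?thesis by (simp add: min_absorb2)
  next
    case False
    then have n: "real n > 0" by simp
    have sq: "(v / sqrt n)\<^sup>2 = v\<^sup>2 / n" by (simp add: power_divide)
    have 1: "cmod (char \<mu> (v / sqrt n) - (1 - (v / sqrt n)\<^sup>2 * \<sigma>\<^sup>2 / 2)) \<le> (v / sqrt n)\<^sup>2 / 6 * ?E n"
      by (rule \<mu>.char_approx3[OF mom(1-3) var])
    have eq: "(1 - (v / sqrt n)\<^sup>2 * \<sigma>\<^sup>2 / 2) = 1 - y / n" unfolding sq y_def by (simp add: field_simps)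
    define z where "z = y / n"
    have z0: "0 \<le> z" using y0 n by (simp add: z_def)
    have "1 - z \<le> exp (- z)" using exp_ge_add_one_self[of "-z"] by simp
    moreover have "exp (- z) \<le> 1 - z + z\<^sup>2"
    proof -
      have "1 + z \<le> exp z" by (rule exp_ge_add_one_self)
      then have "exp (- z) \<le> 1 / (1 + z)" using z0 by (simp add: exp_minus field_simps)
      \<comment> \<open>Clearing the denominator leaves \<open>1 \<le> 1 + z ^ 3\<close>.\<close>
      also have "\<dots> \<le> 1 - z + z\<^sup>2" using z0 by (simp add: field_simps power2_eq_square)
      finally show ?thesis .
    qed
    ultimately have "\<bar>(1 - z) - exp (- z)\<bar> \<le> z\<^sup>2" by linarith
    then have 2: "cmod (complex_of_real (1 - y / n) - complex_of_real (exp (- y / n))) \<le> y\<^sup>2 / n\<^sup>2"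
      unfolding of_real_diff[symmetric] norm_of_real by (simp add: z_def power_divide)
    have "cmod (char \<mu> (v / sqrt n) - complex_of_real (exp (- y / n))) \<le> v\<^sup>2 / n / 6 * ?E n + y\<^sup>2 / n\<^sup>2"
      using norm_triangle_mono[OF 1[unfolded eq] 2] unfolding sq by simp
    then have "real n * cmod (char \<mu> (v / sqrt n) - complex_of_real (exp (- y / n))) \<le> real n * (v\<^sup>2 / n / 6 * ?E n + y\<^sup>2 / n\<^sup>2)"
      using n by (intro mult_left_mono) auto
    also have "\<dots> = v\<^sup>2 / 6 * ?E n + y\<^sup>2 / n"
      using n by (simp add: field_simps power2_eq_square)
    finally show ?thesis .
  qed
  have "(\<lambda>n. 1 / sqrt (real n)) \<longlonglongrightarrow> 0"
    using tendsto_divide_0[OF tendsto_const filterlim_at_top_imp_at_infinity[OF filterlim_compose[OF sqrt_at_top filterlim_real_sequentially]]] .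
  then have lim1: "(\<lambda>n. min (6 * x\<^sup>2) (\<bar>v\<bar> * \<bar>x\<bar> ^ 3 * (1 / sqrt (real n)))) \<longlonglongrightarrow> min (6 * x\<^sup>2) (\<bar>v\<bar> * \<bar>x\<bar> ^ 3 * 0)" for x
    by (intro tendsto_min tendsto_const tendsto_mult)
  have "?E \<longlonglongrightarrow> (LINT x|\<mu>. 0)"
  proof (rule integral_dominated_convergence[where w="\<lambda>x. 6 * x\<^sup>2"])
    show "AE x in \<mu>. (\<lambda>n. min (6 * x\<^sup>2) (\<bar>v / sqrt (real n)\<bar> * \<bar>x\<bar> ^ 3)) \<longlonglongrightarrow> 0"
      using lim1 by (intro AE_I2) (simp add: abs_divide min_absorb2 mult_ac)
    show "integrable \<mu> (\<lambda>x. 6 * x\<^sup>2)" using mom(3) by simp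
    show "AE x in \<mu>. norm (min (6 * x\<^sup>2) (\<bar>v / sqrt (real n)\<bar> * \<bar>x\<bar> ^ 3)) \<le> 6 * x\<^sup>2" for n :: nat
      by (intro AE_I2) auto
  qed simp_all
  then have "(\<lambda>n. v\<^sup>2 / 6 * ?E n + y\<^sup>2 / real n) \<longlonglongrightarrow> v\<^sup>2 / 6 * 0 + 0"
    by (intro tendsto_add tendsto_mult tendsto_const lim_const_over_n) simp
  then have lim: "(\<lambda>n. v\<^sup>2 / 6 * ?E n + y\<^sup>2 / real n) \<longlonglongrightarrow> 0" by simp
  show ?thesis
    by (rule Lim_null_comparison[OF _ lim]) (use bound in \<open>simp add: \<mu>_def y_def\<close>)
qed

text \<open>At most \<open>n\<close> replacements, each with error \<open>o(1/n)\<close>, leave a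
  weight that enters only through its expectation. \<open>\<eta>\<close> collects the errors at
  \<open>v\<close> and at \<open>- v\<close>, because either sign may occur.\<close>

lemma block_char_tendsto:
  fixes W :: "nat \<Rightarrow> 'a \<Rightarrow> real"
  assumes W: "\<And>n. W n \<in> borel_measurable (F (a n))" "\<And>n \<omega>. \<omega> \<in> space M \<Longrightarrow> \<bar>W n \<omega>\<bar> \<le> K"
    and w: "(\<lambda>n. expectation (W n)) \<longlonglongrightarrow> w"
    and N: "\<And>n. N n \<le> n" "(\<lambda>n. real (N n) / real n) \<longlonglongrightarrow> s" and K: "0 \<le> K"
  shows "(\<lambda>n. expectation (\<lambda>\<omega>. complex_of_real (W n \<omega>) * iexp (v * ((V (a n + N n) \<omega> - V (a n) \<omega>) / sqrt n))))
     \<longlonglongrightarrow> complex_of_real (w * exp (- (\<sigma>\<^sup>2 * s * v\<^sup>2 / 2)))"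
proof -
  define y where "y = \<sigma>\<^sup>2 * v\<^sup>2 / 2"
  have y0: "0 \<le> y" by (simp add: y_def)
  define \<psi> where "\<psi> n = complex_of_real (exp (- y / real n))" for n :: nat
  define \<eta> where "\<eta> n = cmod (char (distr M borel (\<xi> 0)) (v / sqrt n) - \<psi> n) + cmod (char (distr M borel (\<xi> 0)) ((- v) / sqrt n) - \<psi> n)" for n :: nat
  let ?L = "\<lambda>n. expectation (\<lambda>\<omega>. complex_of_real (W n \<omega>) * iexp (v * ((V (a n + N n) \<omega> - V (a n) \<omega>) / sqrt n)))"
  have b: "cmod (?L n - expectation (\<lambda>\<omega>. complex_of_real (W n \<omega>)) * \<psi> n ^ N n) \<le> 2 * K * (real n * \<eta> n)" for n
  proof -
    have "cmod (expectation (\<lambda>\<omega>. complex_of_real (W n \<omega>) * iexp ((v / sqrt n) * (V (a n + N n) \<omega> - V (a n) \<omega>)))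
        - expectation (\<lambda>\<omega>. complex_of_real (W n \<omega>)) * \<psi> n ^ N n) \<le> real (N n) * (2 * K * \<eta> n)"
    proof (rule expectation_iexp_increment)
      show "(\<lambda>\<omega>. complex_of_real (W n \<omega>)) \<in> borel_measurable (F (a n))" using W(1)[of n] by simp
      show "cmod (\<psi> n) \<le> 1" using y0 by (simp add: \<psi>_def)
    qed (use W(2) K in \<open>auto simp: \<eta>_def\<close>)
    also have "\<dots> \<le> real n * (2 * K * \<eta> n)"
      using N(1)[of n] K by (intro mult_right_mono) (auto simp: \<eta>_def)
    finally show ?thesis by (simp add: mult_ac)
  qed
  have "(\<lambda>n. real n * \<eta> n) \<longlonglongrightarrow> 0 + 0"
    unfolding \<eta>_def distrib_left \<psi>_def y_def
    by (intro tendsto_add char_\<xi>_error) (use char_\<xi>_error[of "- v"] in simp)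
  then have "(\<lambda>n. 2 * K * (real n * \<eta> n)) \<longlonglongrightarrow> 0"
    using tendsto_mult_right_zero by fastforce
  then have d: "(\<lambda>n. ?L n - expectation (\<lambda>\<omega>. complex_of_real (W n \<omega>)) * \<psi> n ^ N n) \<longlonglongrightarrow> 0"
    by (rule Lim_null_comparison[OF always_eventually, rotated]) (rule allI, rule b)
  have pw: "\<psi> n ^ N n = complex_of_real (exp (- y * (real (N n) / real n)))" for n
    unfolding \<psi>_def of_real_power[symmetric] exp_of_nat_mult[symmetric] by (simp add: mult_ac)
  have "(\<lambda>n. complex_of_real (expectation (W n) * exp (- y * (real (N n) / real n)))) \<longlonglongrightarrow> complex_of_real (w * exp (- y * s))"
    by (intro tendsto_of_real tendsto_mult w tendsto_exp tendsto_const N(2))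
  then have "(\<lambda>n. expectation (\<lambda>\<omega>. complex_of_real (W n \<omega>)) * \<psi> n ^ N n) \<longlonglongrightarrow> complex_of_real (w * exp (- y * s))"
    unfolding pw by simp
  from tendsto_add[OF d this] show ?thesis unfolding y_def by (simp add: mult_ac)
qed

text \<open>
  Levy's continuity theorem is applied to the law of the block increment under the measure with
  density \<open>W n / E (W n)\<close>. Taking for \<open>W n\<close> a function of the earlier increments yields joint convergence.
\<close>

lemma weighted_block_clt:
  fixes W :: "nat \<Rightarrow> 'a \<Rightarrow> real" and f :: "real \<Rightarrow> real"
  assumes W: "\<And>n. W n \<in> borel_measurable (F (a n))" "\<And>n \<omega>. \<omega> \<in> space M \<Longrightarrow> 0 \<le> W n \<omega>" "\<And>n \<omega>. \<omega> \<in> space M \<Longrightarrow> W n \<omega> \<le> K"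
    and w: "(\<lambda>n. expectation (W n)) \<longlonglongrightarrow> w"
    and N: "\<And>n. N n \<le> n" "(\<lambda>n. real (N n) / real n) \<longlonglongrightarrow> s" and s: "0 \<le> s"
    and f: "continuous_on UNIV f" "\<And>x. \<bar>f x\<bar> \<le> C"
  shows "(\<lambda>n. expectation (\<lambda>\<omega>. W n \<omega> * f ((V (a n + N n) \<omega> - V (a n) \<omega>) / sqrt n)))
     \<longlonglongrightarrow> w * integral\<^sup>L (centered_normal (\<sigma> * sqrt s)) f"
proof -
  note W_M [measurable] = measurable_F_M[OF W(1)]
  have f_M [measurable]: "f \<in> borel_measurable borel" by (rule borel_measurable_continuous_onI[OF f(1)])
  obtain \<omega>0 where "\<omega>0 \<in> space M" using not_empty by blast
  then have K0: "0 \<le> K" using W(2,3)[of \<omega>0 0] by linarith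
  have C0: "0 \<le> C" using f(2)[of 0] by linarith
  have Wi: "integrable M (W n)" for n
    by (rule integrable_const_bound[of _ K]) (use W in auto)
  have W0: "0 \<le> expectation (W n)" for n using W(2) by (intro integral_nonneg_AE AE_I2)
  then have w0: "0 \<le> w" using w by (intro LIMSEQ_le_const[OF w]) auto
  define D where "D n \<omega> = (V (a n + N n) \<omega> - V (a n) \<omega>) / sqrt n" for n :: nat and \<omega>
  have D_M [measurable]: "D n \<in> borel_measurable M" for n unfolding D_def by measurable
  let ?\<nu> = "centered_normal (\<sigma> * sqrt s)"
  show ?thesis unfolding D_def[symmetric]
  proof (cases "w = 0")
    case True
    \<comment> \<open>With \<open>w = 0\<close> normalising the weights is of no use; boundedness of
      \<open>f\<close> settles this case.\<close>
    have "norm (expectation (\<lambda>\<omega>. W n \<omega> * f (D n \<omega>))) \<le> C * expectation (W n)" for n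
    proof -
      have i: "integrable M (\<lambda>\<omega>. W n \<omega> * f (D n \<omega>))"
        by (rule integrable_const_bound[of _ "K * C"]) (use W f(2) K0 in \<open>auto simp: abs_mult intro!: mult_mono\<close>)
      have "norm (expectation (\<lambda>\<omega>. W n \<omega> * f (D n \<omega>))) \<le> expectation (\<lambda>\<omega>. norm (W n \<omega> * f (D n \<omega>)))"
        by (rule integral_norm_bound)
      also have "\<dots> \<le> expectation (\<lambda>\<omega>. C * W n \<omega>)"
      proof (rule integral_mono)
        show "integrable M (\<lambda>\<omega>. norm (W n \<omega> * f (D n \<omega>)))" by (rule integrable_norm[OF i])
        show "integrable M (\<lambda>\<omega>. C * W n \<omega>)" using Wi by simp
        fix \<omega> assume "\<omega> \<in> space M"
        then have "W n \<omega> * \<bar>f (D n \<omega>)\<bar> \<le> W n \<omega> * C" using W(2) f(2) by (intro mult_left_mono) auto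
        then show "norm (W n \<omega> * f (D n \<omega>)) \<le> C * W n \<omega>" using W(2) \<open>\<omega> \<in> space M\<close> by (simp add: abs_mult mult.commute)
      qed
      finally show ?thesis by simp
    qed
    note b = this
    have l: "(\<lambda>n. C * expectation (W n)) \<longlonglongrightarrow> 0"
      using w unfolding True by (rule tendsto_mult_right_zero)
    have "(\<lambda>n. expectation (\<lambda>\<omega>. W n \<omega> * f (D n \<omega>))) \<longlonglongrightarrow> 0"
      by (rule Lim_null_comparison[OF always_eventually l]) (rule allI, rule b)
    then show "(\<lambda>n. expectation (\<lambda>\<omega>. W n \<omega> * f (D n \<omega>))) \<longlonglongrightarrow> w * integral\<^sup>L ?\<nu> f"
      using True by simp
  next
    case False
    then have wpos: "0 < w" using w0 by simp
    define p where "p n = expectation (W n)" for n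
    define \<rho> where "\<rho> n = density M (\<lambda>\<omega>. ennreal (W n \<omega> / p n))" for n
    \<comment> \<open>Where \<open>p n\<close> is not positive there is no normalised law, and the
      limit law serves as a placeholder, so that \<open>\<mu> n\<close> is a probability for every
      \<open>n\<close>. As \<open>w > 0\<close>, this concerns finitely many
      \<open>n\<close>.\<close>
    define \<mu> where "\<mu> n = (if 0 < p n then distr (\<rho> n) borel (D n) else ?\<nu>)" for n
    have prob_\<rho>: "prob_space (\<rho> n)" if "0 < p n" for n
    proof
      have "emeasure (\<rho> n) (space (\<rho> n)) = (\<integral>\<^sup>+\<omega>. ennreal (W n \<omega> / p n) \<partial>M)"
        unfolding \<rho>_def by (simp add: emeasure_density cong: nn_integral_cong)
      also have "\<dots> = ennreal (expectation (\<lambda>\<omega>. W n \<omega> / p n))"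
        using Wi[of n] W(2) that by (intro nn_integral_eq_integral AE_I2) auto
      also have "expectation (\<lambda>\<omega>. W n \<omega> / p n) = 1" using that by (simp add: p_def)
      finally show "emeasure (\<rho> n) (space (\<rho> n)) = 1" by simp
    qed
    have int_\<mu>: "integral\<^sup>L (\<mu> n) g = expectation (\<lambda>\<omega>. (W n \<omega> / p n) *\<^sub>R g (D n \<omega>))"
      if "0 < p n" and [measurable]: "g \<in> borel_measurable borel" for n and g :: "real \<Rightarrow> 'c::{banach, second_countable_topology}"
    proof -
      have "integral\<^sup>L (\<mu> n) g = integral\<^sup>L (\<rho> n) (\<lambda>\<omega>. g (D n \<omega>))"
        unfolding \<mu>_def using that(1) by (simp add: integral_distr \<rho>_def)
      also have "\<dots> = expectation (\<lambda>\<omega>. (W n \<omega> / p n) *\<^sub>R g (D n \<omega>))"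
        unfolding \<rho>_def using that(1) W(2) by (intro integral_density) auto
      finally show ?thesis .
    qed
    have rd: "real_distribution (\<mu> n)" for n
    proof (cases "0 < p n")
      case True
      then interpret \<rho>: prob_space "\<rho> n" by (rule prob_\<rho>)
      have "D n \<in> borel_measurable (\<rho> n)" unfolding \<rho>_def by simp
      then show ?thesis using True unfolding \<mu>_def by (simp add: \<rho>.real_distribution_distr)
    qed (simp add: \<mu>_def real_distribution_centered_normal)
    have ev: "eventually (\<lambda>n. 0 < p n) sequentially"
      unfolding p_def using w wpos by (rule order_tendstoD)
    have "weak_conv_m \<mu> ?\<nu>"
    proof (rule levy_continuity[OF rd real_distribution_centered_normal])
      fix t :: real
      have l: "(\<lambda>n. expectation (\<lambda>\<omega>. complex_of_real (W n \<omega>) * iexp (t * D n \<omega>)) / complex_of_real (p n))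
        \<longlonglongrightarrow> complex_of_real (w * exp (- (\<sigma>\<^sup>2 * s * t\<^sup>2 / 2))) / complex_of_real w"
        unfolding D_def using wpos W K0
        by (intro tendsto_divide block_char_tendsto[OF W(1) _ w N K0] tendsto_of_real w[folded p_def]) auto
      have lim_eq: "complex_of_real (w * exp (- (\<sigma>\<^sup>2 * s * t\<^sup>2 / 2))) / complex_of_real w = char ?\<nu> t"
        using wpos s by (simp add: char_centered_normal power_mult_distrib)
      have "eventually (\<lambda>n. expectation (\<lambda>\<omega>. complex_of_real (W n \<omega>) * iexp (t * D n \<omega>)) / complex_of_real (p n) = char (\<mu> n) t) sequentially"
        using ev
      proof eventually_elim
        case (elim n)
        have "char (\<mu> n) t = expectation (\<lambda>\<omega>. (W n \<omega> / p n) *\<^sub>R iexp (t * D n \<omega>))"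
          unfolding char_def by (rule int_\<mu>[OF elim]) simp
        also have "\<dots> = expectation (\<lambda>\<omega>. complex_of_real (W n \<omega>) * iexp (t * D n \<omega>) / complex_of_real (p n))"
          by (simp add: scaleR_conv_of_real)
        also have "\<dots> = expectation (\<lambda>\<omega>. complex_of_real (W n \<omega>) * iexp (t * D n \<omega>)) / complex_of_real (p n)"
          by (rule integral_divide_zero)
        finally show ?case by simp
      qed
      from Lim_transform_eventually[OF l this] show "(\<lambda>n. char (\<mu> n) t) \<longlonglongrightarrow> char ?\<nu> t"
        unfolding lim_eq .
    qed
    then have "(\<lambda>n. integral\<^sup>L (\<mu> n) f) \<longlonglongrightarrow> integral\<^sup>L ?\<nu> f"
      using f by (intro weak_conv_imp_integral_bdd_continuous_conv[OF rd real_distribution_centered_normal, where B=C])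
        (auto simp: continuous_on_eq_continuous_at)
    from tendsto_mult[OF w this]
    have l: "(\<lambda>n. p n * integral\<^sup>L (\<mu> n) f) \<longlonglongrightarrow> w * integral\<^sup>L ?\<nu> f" unfolding p_def .
    have "eventually (\<lambda>n. p n * integral\<^sup>L (\<mu> n) f = expectation (\<lambda>\<omega>. W n \<omega> * f (D n \<omega>))) sequentially"
      using ev
    proof eventually_elim
      case (elim n)
      have "integral\<^sup>L (\<mu> n) f = expectation (\<lambda>\<omega>. W n \<omega> * f (D n \<omega>) / p n)"
        using int_\<mu>[OF elim f_M] by simp
      also have "\<dots> = expectation (\<lambda>\<omega>. W n \<omega> * f (D n \<omega>)) / p n"
        by (rule integral_divide_zero)
      finally show ?case using elim by simp
    qed
    from Lim_transform_eventually[OF l this]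
    show "(\<lambda>n. expectation (\<lambda>\<omega>. W n \<omega> * f (D n \<omega>))) \<longlonglongrightarrow> w * integral\<^sup>L ?\<nu> f" .
  qed
qed

end

text \<open>
  A partition of unity by tent functions centred at \<open>\<delta> (i - L)\<close>, written as differences of ramps so that
  its sums telescope.
\<close>

definition tent :: "real \<Rightarrow> nat \<Rightarrow> nat \<Rightarrow> real \<Rightarrow> real" where
  "tent \<delta> L i x = min 1 (max 0 (x / \<delta> + real L - real i + 1)) - min 1 (max 0 (x / \<delta> + real L - real i))"

lemma continuous_on_tent: "continuous_on S (tent \<delta> L i)"
  unfolding tent_def divide_inverse by (intro continuous_intros)

lemma tent_bounds: "0 \<le> tent \<delta> L i x" "tent \<delta> L i x \<le> 1"
  unfolding tent_def by linarith+

lemma tent_support: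
  assumes "tent \<delta> L i x \<noteq> 0" "0 < \<delta>"
  shows "\<bar>x - \<delta> * (real i - real L)\<bar> \<le> \<delta>"
proof -
  have "\<bar>x / \<delta> - (real i - real L)\<bar> \<le> 1" using assms(1) unfolding tent_def by linarith
  then have "\<delta> * \<bar>x / \<delta> - (real i - real L)\<bar> \<le> \<delta> * 1" using assms(2) by (intro mult_left_mono) auto
  also have "\<delta> * \<bar>x / \<delta> - (real i - real L)\<bar> = \<bar>\<delta> * (x / \<delta> - (real i - real L))\<bar>"
    using assms(2) by (simp add: abs_mult)
  also have "\<delta> * (x / \<delta> - (real i - real L)) = x - \<delta> * (real i - real L)"
    using assms(2) by (simp add: algebra_simps)
  finally show ?thesis by simp
qed

lemma sum_tent: "(\<Sum>i<2 * L + 1. tent \<delta> L i x) = min 1 (max 0 (x / \<delta> + real L + 1)) - min 1 (max 0 (x / \<delta> - real L))"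
proof -
  let ?g = "\<lambda>i. min 1 (max 0 (x / \<delta> + real L - real i + 1))"
  have "tent \<delta> L i x = ?g i - ?g (Suc i)" for i
    unfolding tent_def by (simp add: algebra_simps)
  then have "(\<Sum>i<2 * L + 1. tent \<delta> L i x) = (\<Sum>i<2 * L + 1. ?g i - ?g (Suc i))"
    by (rule sum.cong[OF refl])
  also have "\<dots> = ?g 0 - ?g (2 * L + 1)" by (rule sum_lessThan_telescope')
  finally show ?thesis by (simp add: algebra_simps)
qed

lemma sum_tent_bounds: "0 \<le> (\<Sum>i<2 * L + 1. tent \<delta> L i x)" "(\<Sum>i<2 * L + 1. tent \<delta> L i x) \<le> 1"
  unfolding sum_tent by linarith+

lemma sum_tent_eq_1: "\<bar>x / \<delta>\<bar> \<le> real L \<Longrightarrow> (\<Sum>i<2 * L + 1. tent \<delta> L i x) = 1"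
  unfolding sum_tent by linarith

text \<open>\<open>h\<close> is replaced by the sum over grid points of its value there times a
  product of tents, to which \<open>prods\<close> applies term by term. The error is
  \<open>k * \<delta>\<close> on the grid and \<open>K * (1 - T)\<close> off it. \<open>T\<close> is
  itself a product of test functions, so the mass escaping the grid converges to that of the limit:
  tightness is inherited from \<open>Z\<close>.\<close>

lemma prod_test_functions_imp_lipschitz:
  fixes X :: "nat \<Rightarrow> nat \<Rightarrow> 'a \<Rightarrow> real" and Z :: "nat \<Rightarrow> 'b \<Rightarrow> real" and h :: "(nat \<Rightarrow> real) \<Rightarrow> real"
  assumes M: "prob_space M" and N: "prob_space N"
    and X [measurable]: "\<And>n j. X n j \<in> borel_measurable M" and Z [measurable]: "\<And>j. Z j \<in> borel_measurable N"
    and prods: "\<And>f :: nat \<Rightarrow> real \<Rightarrow> real. (\<And>j. continuous_on UNIV (f j)) \<Longrightarrow> (\<And>j x. 0 \<le> f j x \<and> f j x \<le> 1) \<Longrightarrow>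
      (\<lambda>n. integral\<^sup>L M (\<lambda>\<omega>. \<Prod>j<m. f j (X n j \<omega>))) \<longlonglongrightarrow> integral\<^sup>L N (\<lambda>\<omega>. \<Prod>j<m. f j (Z j \<omega>))"
    and h_bound: "\<And>x. \<bar>h x\<bar> \<le> K"
    and h_lip: "\<And>x y d. (\<And>j. j < m \<Longrightarrow> \<bar>x j - y j\<bar> \<le> d) \<Longrightarrow> 0 \<le> d \<Longrightarrow> \<bar>h x - h y\<bar> \<le> k * d"
    and hX [measurable]: "\<And>n. (\<lambda>\<omega>. h (\<lambda>j. X n j \<omega>)) \<in> borel_measurable M"
    and hZ [measurable]: "(\<lambda>\<omega>. h (\<lambda>j. Z j \<omega>)) \<in> borel_measurable N"
    and k: "0 \<le> k"
  shows "(\<lambda>n. integral\<^sup>L M (\<lambda>\<omega>. h (\<lambda>j. X n j \<omega>))) \<longlonglongrightarrow> integral\<^sup>L N (\<lambda>\<omega>. h (\<lambda>j. Z j \<omega>))"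
proof -
  interpret M: prob_space M by fact
  interpret N: prob_space N by fact
  have K: "0 \<le> K" using h_bound[of "\<lambda>_. 0"] by linarith
  define \<tau> where "\<tau> \<delta> L x = (\<Sum>i<2 * L + 1. tent \<delta> L i x)" for \<delta> L x
  have \<tau>_c: "continuous_on UNIV (\<tau> \<delta> L)" for \<delta> L unfolding \<tau>_def by (intro continuous_intros continuous_on_tent)
  have \<tau>_b: "0 \<le> \<tau> \<delta> L x \<and> \<tau> \<delta> L x \<le> 1" for \<delta> L x unfolding \<tau>_def using sum_tent_bounds by blast
  have \<tau>_1: "\<tau> \<delta> L x = 1" if "\<bar>x / \<delta>\<bar> \<le> real L" for \<delta> L x unfolding \<tau>_def by (rule sum_tent_eq_1[OF that])
  have [measurable]: "tent \<delta> L i \<in> borel_measurable borel" for \<delta> L i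
    by (rule borel_measurable_continuous_onI[OF continuous_on_tent])
  have [measurable]: "\<tau> \<delta> L \<in> borel_measurable borel" for \<delta> L
    by (rule borel_measurable_continuous_onI[OF \<tau>_c])
  define P where "P L = PiE {..<m} (\<lambda>_. {..<2 * L + 1::nat})" for L
  have finP: "finite (P L)" for L unfolding P_def by (intro finite_PiE) auto
  \<comment> \<open>Outside \<open>{..<m}\<close> the grid index \<open>p\<close> is unspecified; by
    \<open>h_lip\<close> with \<open>d = 0\<close> those coordinates do not affect
    \<open>h\<close>.\<close>
  define A where "A \<delta> L x = (\<Sum>p\<in>P L. h (\<lambda>j. \<delta> * (real (p j) - real L)) * (\<Prod>j<m. tent \<delta> L (p j) (x j)))" for \<delta> L x
  define T where "T \<delta> L x = (\<Prod>j<m. \<tau> \<delta> L (x j))" for \<delta> L and x :: "nat \<Rightarrow> real"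
  have T_sum: "T \<delta> L x = (\<Sum>p\<in>P L. \<Prod>j<m. tent \<delta> L (p j) (x j))" for \<delta> L x
    unfolding T_def \<tau>_def P_def by (rule prod_sum_PiE) auto
  have T_b: "0 \<le> T \<delta> L x" "T \<delta> L x \<le> 1" for \<delta> L x
    unfolding T_def using \<tau>_b by (auto intro: prod_nonneg prod_le_1)
  have approx: "\<bar>h x - A \<delta> L x\<bar> \<le> k * \<delta> + K * (1 - T \<delta> L x)" if \<delta>: "0 < \<delta>" for \<delta> L x
  proof -
    have "\<bar>h x * T \<delta> L x - A \<delta> L x\<bar> = \<bar>\<Sum>p\<in>P L. (h x - h (\<lambda>j. \<delta> * (real (p j) - real L))) * (\<Prod>j<m. tent \<delta> L (p j) (x j))\<bar>"
      unfolding T_sum A_def by (simp add: sum_distrib_left sum_subtractf algebra_simps)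
    also have "\<dots> \<le> (\<Sum>p\<in>P L. \<bar>(h x - h (\<lambda>j. \<delta> * (real (p j) - real L))) * (\<Prod>j<m. tent \<delta> L (p j) (x j))\<bar>)"
      by (rule sum_abs)
    also have "\<dots> \<le> (\<Sum>p\<in>P L. k * \<delta> * (\<Prod>j<m. tent \<delta> L (p j) (x j)))"
    proof (rule sum_mono)
      fix p
      have nn: "0 \<le> (\<Prod>j<m. tent \<delta> L (p j) (x j))" using tent_bounds by (intro prod_nonneg) auto
      show "\<bar>(h x - h (\<lambda>j. \<delta> * (real (p j) - real L))) * (\<Prod>j<m. tent \<delta> L (p j) (x j))\<bar> \<le> k * \<delta> * (\<Prod>j<m. tent \<delta> L (p j) (x j))"
      proof (cases "(\<Prod>j<m. tent \<delta> L (p j) (x j)) = 0")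
        case False
        then have "\<And>j. j < m \<Longrightarrow> tent \<delta> L (p j) (x j) \<noteq> 0" by auto
        then have "\<bar>h x - h (\<lambda>j. \<delta> * (real (p j) - real L))\<bar> \<le> k * \<delta>"
          using \<delta> by (intro h_lip tent_support) auto
        then show ?thesis using nn by (simp add: abs_mult mult_right_mono)
      next
        case True
        show ?thesis unfolding True by simp
      qed
    qed
    also have "\<dots> = k * \<delta> * T \<delta> L x" unfolding T_sum by (simp add: sum_distrib_left)
    also have "\<dots> \<le> k * \<delta> * 1" using T_b k \<delta> by (intro mult_left_mono) auto
    finally have 1: "\<bar>h x * T \<delta> L x - A \<delta> L x\<bar> \<le> k * \<delta>" by simp
    have "\<bar>h x - h x * T \<delta> L x\<bar> = \<bar>h x\<bar> * (1 - T \<delta> L x)"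
    proof -
      have "h x - h x * T \<delta> L x = h x * (1 - T \<delta> L x)" by (simp add: right_diff_distrib)
      then show ?thesis using T_b[of \<delta> L x] by (simp only: abs_mult)
    qed
    also have "\<dots> \<le> K * (1 - T \<delta> L x)" using T_b h_bound by (intro mult_right_mono) auto
    finally show ?thesis using 1 by linarith
  qed
  have A_conv: "(\<lambda>n. integral\<^sup>L M (\<lambda>\<omega>. A \<delta> L (\<lambda>j. X n j \<omega>))) \<longlonglongrightarrow> integral\<^sup>L N (\<lambda>\<omega>. A \<delta> L (\<lambda>j. Z j \<omega>))" for \<delta> L
  proof -
    have b: "\<bar>\<Prod>j<m. tent \<delta> L (p j) (x j)\<bar> \<le> 1" for p x
      using tent_bounds by (simp add: abs_prod prod_le_1)
    have iM: "integrable M (\<lambda>\<omega>. (\<Prod>j<m. tent \<delta> L (p j) (X n j \<omega>)))" for p n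
      by (rule M.integrable_const_bound[of _ 1]) (use b in auto)
    have iN: "integrable N (\<lambda>\<omega>. (\<Prod>j<m. tent \<delta> L (p j) (Z j \<omega>)))" for p
      by (rule N.integrable_const_bound[of _ 1]) (use b in auto)
    show ?thesis unfolding A_def
      using iM iN by (simp, intro tendsto_sum tendsto_mult tendsto_const prods)
        (auto intro: continuous_on_tent tent_bounds)
  qed
  have T_conv: "(\<lambda>n. integral\<^sup>L M (\<lambda>\<omega>. T \<delta> L (\<lambda>j. X n j \<omega>))) \<longlonglongrightarrow> integral\<^sup>L N (\<lambda>\<omega>. T \<delta> L (\<lambda>j. Z j \<omega>))" for \<delta> L
    unfolding T_def by (intro prods \<tau>_c \<tau>_b)
  have [measurable]: "(\<lambda>\<omega>. T \<delta> L (\<lambda>j. X n j \<omega>)) \<in> borel_measurable M" "(\<lambda>\<omega>. A \<delta> L (\<lambda>j. X n j \<omega>)) \<in> borel_measurable M"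
    "(\<lambda>\<omega>. T \<delta> L (\<lambda>j. Z j \<omega>)) \<in> borel_measurable N" "(\<lambda>\<omega>. A \<delta> L (\<lambda>j. Z j \<omega>)) \<in> borel_measurable N" for \<delta> L n
    unfolding T_def A_def by measurable
  have T_lim: "(\<lambda>L. integral\<^sup>L N (\<lambda>\<omega>. T \<delta> L (\<lambda>j. Z j \<omega>))) \<longlonglongrightarrow> 1" for \<delta>
  proof -
    have "(\<lambda>L. integral\<^sup>L N (\<lambda>\<omega>. T \<delta> L (\<lambda>j. Z j \<omega>))) \<longlonglongrightarrow> integral\<^sup>L N (\<lambda>\<omega>. 1)"
    proof (rule integral_dominated_convergence[where w="\<lambda>_. 1"])
      show "AE \<omega> in N. (\<lambda>L. T \<delta> L (\<lambda>j. Z j \<omega>)) \<longlonglongrightarrow> 1"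
      proof (intro AE_I2 tendsto_eventually)
        fix \<omega>
        have "eventually (\<lambda>L. \<forall>j\<in>{..<m}. \<bar>Z j \<omega> / \<delta>\<bar> \<le> real L) sequentially"
          by (intro eventually_ball_finite ballI finite_lessThan) (metis eventually_sequentiallyI nat_ceiling_le_eq)
        then show "eventually (\<lambda>L. T \<delta> L (\<lambda>j. Z j \<omega>) = 1) sequentially"
          unfolding T_def by eventually_elim (auto intro!: prod.neutral \<tau>_1)
      qed
    qed (use T_b in auto)
    then show ?thesis by (simp add: N.prob_space)
  qed
  have err: "\<bar>integral\<^sup>L Q (\<lambda>\<omega>. h (\<lambda>j. Y j \<omega>)) - integral\<^sup>L Q (\<lambda>\<omega>. A \<delta> L (\<lambda>j. Y j \<omega>))\<bar> \<le> k * \<delta> + K * (1 - integral\<^sup>L Q (\<lambda>\<omega>. T \<delta> L (\<lambda>j. Y j \<omega>)))"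
    if Q: "prob_space Q" and m: "(\<lambda>\<omega>. h (\<lambda>j. Y j \<omega>)) \<in> borel_measurable Q" "(\<lambda>\<omega>. T \<delta> L (\<lambda>j. Y j \<omega>)) \<in> borel_measurable Q" "(\<lambda>\<omega>. A \<delta> L (\<lambda>j. Y j \<omega>)) \<in> borel_measurable Q"
      and \<delta>: "0 < \<delta>" for Q :: "'c measure" and Y \<delta> L
  proof -
    interpret Q: prob_space Q by fact
    have ih: "integrable Q (\<lambda>\<omega>. h (\<lambda>j. Y j \<omega>))"
      by (rule Q.integrable_const_bound[of _ K]) (use m h_bound in auto)
    have iT: "integrable Q (\<lambda>\<omega>. T \<delta> L (\<lambda>j. Y j \<omega>))"
      by (rule Q.integrable_const_bound[of _ 1]) (use m T_b in auto)
    have iA: "integrable Q (\<lambda>\<omega>. A \<delta> L (\<lambda>j. Y j \<omega>))"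
    proof (rule Q.integrable_const_bound[of _ "K + (k * \<delta> + K)"])
      have "\<bar>A \<delta> L x\<bar> \<le> K + (k * \<delta> + K)" for x
        using approx[OF \<delta>, of x L] h_bound[of x] T_b[of \<delta> L x] mult_left_mono[of "1 - T \<delta> L x" 1 K] K by auto
      then show "AE \<omega> in Q. norm (A \<delta> L (\<lambda>j. Y j \<omega>)) \<le> K + (k * \<delta> + K)" by auto
    qed (rule m)
    have "\<bar>integral\<^sup>L Q (\<lambda>\<omega>. h (\<lambda>j. Y j \<omega>)) - integral\<^sup>L Q (\<lambda>\<omega>. A \<delta> L (\<lambda>j. Y j \<omega>))\<bar> = \<bar>integral\<^sup>L Q (\<lambda>\<omega>. h (\<lambda>j. Y j \<omega>) - A \<delta> L (\<lambda>j. Y j \<omega>))\<bar>"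
      using ih iA by simp
    also have "\<dots> \<le> integral\<^sup>L Q (\<lambda>\<omega>. \<bar>h (\<lambda>j. Y j \<omega>) - A \<delta> L (\<lambda>j. Y j \<omega>)\<bar>)"
      by (rule integral_abs_bound)
    also have "\<dots> \<le> integral\<^sup>L Q (\<lambda>\<omega>. k * \<delta> + K * (1 - T \<delta> L (\<lambda>j. Y j \<omega>)))"
      using ih iA iT approx[OF \<delta>] by (intro integral_mono) auto
    also have "\<dots> = k * \<delta> + K * (1 - integral\<^sup>L Q (\<lambda>\<omega>. T \<delta> L (\<lambda>j. Y j \<omega>)))"
      using iT by (simp add: Q.prob_space)
    finally show ?thesis .
  qed
  show ?thesis
  proof (rule tendstoI)
    fix e :: real assume e: "0 < e"
    \<comment> \<open>Five errors of at most \<open>e / 8\<close> will arise: discretisation and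
      escaping mass on either side, and the distance between the two approximations.\<close>
    define \<delta> where "\<delta> = e / (8 * (k + 1))"
    have \<delta>: "0 < \<delta>" using e k by (simp add: \<delta>_def)
    have "k * \<delta> = (e / 8) * (k / (k + 1))" by (simp add: \<delta>_def)
    also have "\<dots> \<le> (e / 8) * 1" using e k by (intro mult_left_mono) auto
    finally have k\<delta>: "k * \<delta> \<le> e / 8" by simp
    have "(\<lambda>L. K * (1 - integral\<^sup>L N (\<lambda>\<omega>. T \<delta> L (\<lambda>j. Z j \<omega>)))) \<longlonglongrightarrow> K * (1 - 1)"
      by (intro tendsto_intros T_lim)
    then have "eventually (\<lambda>L. K * (1 - integral\<^sup>L N (\<lambda>\<omega>. T \<delta> L (\<lambda>j. Z j \<omega>))) < e / 8) sequentially"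
      by (rule order_tendstoD) (use e in simp)
    then obtain L where L: "K * (1 - integral\<^sup>L N (\<lambda>\<omega>. T \<delta> L (\<lambda>j. Z j \<omega>))) < e / 8"
      by (auto dest: eventually_happens)
    have "(\<lambda>n. K * (1 - integral\<^sup>L M (\<lambda>\<omega>. T \<delta> L (\<lambda>j. X n j \<omega>)))) \<longlonglongrightarrow> K * (1 - integral\<^sup>L N (\<lambda>\<omega>. T \<delta> L (\<lambda>j. Z j \<omega>)))"
      by (intro tendsto_intros T_conv)
    then have ev1: "eventually (\<lambda>n. K * (1 - integral\<^sup>L M (\<lambda>\<omega>. T \<delta> L (\<lambda>j. X n j \<omega>))) < e / 8) sequentially"
      using L by (rule order_tendstoD)
    have ev2: "eventually (\<lambda>n. dist (integral\<^sup>L M (\<lambda>\<omega>. A \<delta> L (\<lambda>j. X n j \<omega>))) (integral\<^sup>L N (\<lambda>\<omega>. A \<delta> L (\<lambda>j. Z j \<omega>))) < e / 8) sequentially"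
      using A_conv by (rule tendstoD) (use e in simp)
    from ev1 ev2 show "eventually (\<lambda>n. dist (integral\<^sup>L M (\<lambda>\<omega>. h (\<lambda>j. X n j \<omega>))) (integral\<^sup>L N (\<lambda>\<omega>. h (\<lambda>j. Z j \<omega>))) < e) sequentially"
    proof eventually_elim
      case (elim n)
      have "\<bar>integral\<^sup>L M (\<lambda>\<omega>. h (\<lambda>j. X n j \<omega>)) - integral\<^sup>L M (\<lambda>\<omega>. A \<delta> L (\<lambda>j. X n j \<omega>))\<bar> \<le> k * \<delta> + K * (1 - integral\<^sup>L M (\<lambda>\<omega>. T \<delta> L (\<lambda>j. X n j \<omega>)))"
        by (rule err[OF M _ _ _ \<delta>]) auto
      moreover have "\<bar>integral\<^sup>L N (\<lambda>\<omega>. h (\<lambda>j. Z j \<omega>)) - integral\<^sup>L N (\<lambda>\<omega>. A \<delta> L (\<lambda>j. Z j \<omega>))\<bar> \<le> k * \<delta> + K * (1 - integral\<^sup>L N (\<lambda>\<omega>. T \<delta> L (\<lambda>j. Z j \<omega>)))"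
        by (rule err[OF N _ _ _ \<delta>]) auto
      ultimately show ?case using elim k\<delta> L e unfolding dist_real_def by linarith
    qed
  qed
qed

section \<open>Cutting the time range into blocks\<close>

lemma block_boundary_tendsto:
  assumes "0 < m"
  shows "(\<lambda>n. real (n * j div m) / real n) \<longlonglongrightarrow> real j / real m"
proof (rule tendsto_sandwich)
  have fl: "real (n * j div m) = real_of_int \<lfloor>real (n * j) / real m\<rfloor>" for n
    by (simp only: floor_divide_of_nat_eq of_int_of_nat_eq)
  have l: "(\<lambda>n. real j / real m - 1 / real n) \<longlonglongrightarrow> real j / real m - 0"
    by (intro tendsto_intros lim_const_over_n)
  then show "(\<lambda>n. real j / real m - 1 / real n) \<longlonglongrightarrow> real j / real m" by simp
  show "\<forall>\<^sub>F n in sequentially. real j / real m - 1 / real n \<le> real (n * j div m) / real n"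
  proof (rule eventually_sequentiallyI[of 1])
    fix n :: nat assume "1 \<le> n"
    then have n: "0 < real n" by simp
    have "real (n * j) / real m - real (n * j div m) \<le> 1"
      unfolding fl by linarith
    then have "(real (n * j) / real m - 1) / real n \<le> real (n * j div m) / real n"
      using n by (intro divide_right_mono) auto
    moreover have "(real (n * j) / real m - 1) / real n = real j / real m - 1 / real n"
      using n by (simp add: diff_divide_distrib)
    ultimately show "real j / real m - 1 / real n \<le> real (n * j div m) / real n" by simp
  qed
  show "\<forall>\<^sub>F n in sequentially. real (n * j div m) / real n \<le> real j / real m"
  proof (rule eventually_sequentiallyI[of 1])
    fix n :: nat assume "1 \<le> n"
    then have n: "0 < real n" by simp
    have "real (n * j div m) / real n \<le> (real (n * j) / real m) / real n"
      using n unfolding fl by (intro divide_right_mono of_int_floor_le) auto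
    then show "real (n * j div m) / real n \<le> real j / real m" using n by simp
  qed
qed simp

lemma block_boundary_Suc_le:
  assumes "0 < m"
  shows "n * j div m \<le> n * Suc j div m" "n * Suc j div m \<le> n * j div m + n"
proof -
  show "n * j div m \<le> n * Suc j div m" by (intro div_le_mono) simp
  have "n * Suc j div m \<le> (n * j + m * n) div m" using assms by (intro div_le_mono) simp
  also have "\<dots> = n * j div m + n" using assms by simp
  finally show "n * Suc j div m \<le> n * j div m + n" .
qed

lemma block_length_tendsto:
  assumes m: "0 < m"
  shows "(\<lambda>n. real (n * Suc j div m - n * j div m) / real n) \<longlonglongrightarrow> 1 / real m"
proof -
  have "(\<lambda>n. real (n * Suc j div m) / real n - real (n * j div m) / real n) \<longlonglongrightarrow> real (Suc j) / real m - real j / real m"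
    by (intro tendsto_diff block_boundary_tendsto m)
  also have "(\<lambda>n. real (n * Suc j div m) / real n - real (n * j div m) / real n) = (\<lambda>n. real (n * Suc j div m - n * j div m) / real n)"
    using block_boundary_Suc_le(1)[OF m] by (simp add: of_nat_diff diff_divide_distrib)
  also have "real (Suc j) / real m - real j / real m = 1 / real m" by (simp add: diff_divide_distrib[symmetric])
  finally show ?thesis .
qed

context signed_innovations
begin

text \<open>Boundaries are \<open>n * j / m\<close> rounded down. For positive \<open>m\<close> the
  first is \<open>0\<close> and the one for \<open>j = m\<close> is exactly \<open>n\<close>, so
  \<open>m\<close> blocks exhaust the time range.\<close>

definition block_increment :: "nat \<Rightarrow> nat \<Rightarrow> nat \<Rightarrow> 'a \<Rightarrow> real" where
  "block_increment m n j \<omega> = (V (n * Suc j div m) \<omega> - V (n * j div m) \<omega>) / sqrt n"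

lemma block_increment_meas [measurable]: "block_increment m n j \<in> borel_measurable M"
  unfolding block_increment_def by measurable

text \<open>Induction over blocks: the weight for block \<open>J\<close> is the product of the
  earlier test functions, measurable at the boundary \<open>n * J div m\<close>, and its expectation
  converges by the induction hypothesis. The product form of the limit is asymptotic
  independence.\<close>

lemma block_increments_clt:
  assumes m: "0 < m" and f: "\<And>j. continuous_on UNIV (f j)" "\<And>j x. 0 \<le> f j x \<and> f j x \<le> (1::real)"
  shows "(\<lambda>n. expectation (\<lambda>\<omega>. \<Prod>j<J. f j (block_increment m n j \<omega>)))
     \<longlonglongrightarrow> (\<Prod>j<J. integral\<^sup>L (centered_normal (\<sigma> * sqrt (1 / m))) (f j))"
proof (induction J)
  case 0
  then show ?case by (simp add: prob_space)
next
  case (Suc J)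
  have f_M [measurable]: "f j \<in> borel_measurable borel" for j by (rule borel_measurable_continuous_onI[OF f(1)])
  let ?W = "\<lambda>n \<omega>. \<Prod>j<J. f j (block_increment m n j \<omega>)"
  define N where "N n = n * Suc J div m - n * J div m" for n
  have aN: "n * J div m + N n = n * Suc J div m" for n
    unfolding N_def using block_boundary_Suc_le(1)[OF m, of n J] by linarith
  have N: "N n \<le> n" for n unfolding N_def using block_boundary_Suc_le(2)[OF m, of n J] by linarith
  have Nlim: "(\<lambda>n. real (N n) / real n) \<longlonglongrightarrow> 1 / real m"
    unfolding N_def by (rule block_length_tendsto[OF m])
  have WF: "?W n \<in> borel_measurable (F (n * J div m))" for n
  proof (rule borel_measurable_prod)
    fix j assume j: "j \<in> {..<J}"
    have le: "n * Suc j div m \<le> n * J div m" "n * j div m \<le> n * J div m"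
      using j by (auto intro!: div_le_mono mult_le_mono2 simp del: mult_Suc_right)
    have "block_increment m n j \<in> borel_measurable (F (n * J div m))"
      unfolding block_increment_def using le by (intro borel_measurable_divide borel_measurable_diff V_adapted) auto
    then show "(\<lambda>\<omega>. f j (block_increment m n j \<omega>)) \<in> borel_measurable (F (n * J div m))"
      by (rule measurable_compose) (rule f_M)
  qed
  have "(\<lambda>n. expectation (\<lambda>\<omega>. ?W n \<omega> * f J ((V (n * J div m + N n) \<omega> - V (n * J div m) \<omega>) / sqrt n)))
     \<longlonglongrightarrow> (\<Prod>j<J. integral\<^sup>L (centered_normal (\<sigma> * sqrt (1 / m))) (f j)) * integral\<^sup>L (centered_normal (\<sigma> * sqrt (1 / m))) (f J)"
    by (rule weighted_block_clt[OF WF _ _ Suc N Nlim _ f(1), where K=1 and C=1])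
       (use f(2) in \<open>auto intro: prod_nonneg prod_le_1\<close>)
  then show ?case unfolding aN block_increment_def by simp
qed

end

section \<open>Tightness and the functional central limit theorem\<close>

text \<open>\<open>t = 1\<close> is excluded because the block index would then be \<open>m\<close>,
  one past the last block.\<close>

lemma nat_floor_in_block:
  assumes m: "0 < m" and t: "0 \<le> t" "t < 1"
  shows "n * nat \<lfloor>real m * t\<rfloor> div m \<le> nat \<lfloor>real n * t\<rfloor>"
    and "nat \<lfloor>real n * t\<rfloor> \<le> n * Suc (nat \<lfloor>real m * t\<rfloor>) div m"
    and "nat \<lfloor>real m * t\<rfloor> < m"
proof -
  define j where "j = nat \<lfloor>real m * t\<rfloor>"
  have jr: "real j = real_of_int \<lfloor>real m * t\<rfloor>" unfolding j_def using t by (simp add: of_nat_nat)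
  have j1: "real j \<le> real m * t" unfolding jr by simp
  have j2: "real m * t < real j + 1" unfolding jr by linarith
  have "real m * t < real m * 1" using m t by (intro mult_strict_left_mono) auto
  then have "real j < real m" using j1 by linarith
  then show "nat \<lfloor>real m * t\<rfloor> < m" unfolding j_def by simp
  have fl: "n * i div m = nat \<lfloor>real (n * i) / real m\<rfloor>" for i
    by (simp only: floor_divide_of_nat_eq nat_int)
  have "real (n * j) / real m \<le> real n * t"
    using m j1 mult_left_mono[OF j1, of "real n"] by (simp add: field_simps)
  then show "n * nat \<lfloor>real m * t\<rfloor> div m \<le> nat \<lfloor>real n * t\<rfloor>"
    unfolding j_def[symmetric] fl by (intro nat_mono floor_mono)
  have "real n * t \<le> real (n * Suc j) / real m"
    using m mult_left_mono[OF less_imp_le[OF j2], of "real n"] by (simp add: field_simps)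
  then show "nat \<lfloor>real n * t\<rfloor> \<le> n * Suc (nat \<lfloor>real m * t\<rfloor>) div m"
    unfolding j_def[symmetric] fl by (intro nat_mono floor_mono)
qed

lemma step_path_approx_continuous:
  assumes x: "continuous_on {0..1} x" and e: "0 < e"
  shows "eventually (\<lambda>m. \<forall>t. 0 \<le> t \<longrightarrow> t \<le> 1 \<longrightarrow> \<bar>x t - step_path m (\<lambda>j. x (real j / real m)) t\<bar> \<le> e) sequentially"
proof -
  have "uniformly_continuous_on {0..1} x"
    using x by (rule compact_uniformly_continuous) simp
  then obtain d where d: "0 < d" "\<And>s t. s \<in> {0..1} \<Longrightarrow> t \<in> {0..1} \<Longrightarrow> dist s t < d \<Longrightarrow> dist (x s) (x t) < e"
    using e unfolding uniformly_continuous_on_def by metis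
  obtain m0 :: nat where m0: "1 / d < m0" using reals_Archimedean2 by blast
  show ?thesis
  proof (rule eventually_sequentiallyI[of "Suc m0"], intro allI impI)
    fix m and t :: real assume m: "Suc m0 \<le> m" and t: "0 \<le> t" "t \<le> 1"
    have mpos: "0 < real m" using m by simp
    define j where "j = nat \<lfloor>real m * t\<rfloor>"
    have jr: "real j = real_of_int \<lfloor>real m * t\<rfloor>" unfolding j_def using t by (simp add: of_nat_nat)
    have j1: "real j \<le> real m * t" unfolding jr by simp
    have j2: "real m * t < real j + 1" unfolding jr by linarith
    have "j \<le> m" unfolding j_def by (rule nat_floor_le[OF t])
    then have jm: "real j / real m \<in> {0..1}" using mpos by simp
    have a: "real j / real m \<le> t" using j1 mpos by (simp add: field_simps)
    have "t < (real j + 1) / real m" using j2 mpos by (simp add: pos_less_divide_eq mult.commute)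
    then have a': "t - real j / real m < 1 / real m" by (simp add: add_divide_distrib)
    have "1 / d < real m" using m0 m by linarith
    then have "1 / real m < d" using mpos d(1) by (simp add: field_simps)
    then have "dist t (real j / real m) < d" using a a' unfolding dist_real_def by linarith
    then have "dist (x t) (x (real j / real m)) < e" using d(2) t jm by auto
    then show "\<bar>x t - step_path m (\<lambda>j. x (real j / real m)) t\<bar> \<le> e"
      unfolding step_path_def j_def[symmetric] dist_real_def by simp
  qed
qed

lemma sup_lipschitz_tendsto_step_path:
  assumes H: "sup_lipschitz k H" and k: "0 \<le> k" and x: "continuous_on {0..1} x"
  shows "(\<lambda>m. H (step_path m (\<lambda>j. x (real j / real m)))) \<longlonglongrightarrow> H x"
proof (rule tendstoI)
  fix e :: real assume e: "0 < e"
  have "0 < e / (k + 1)" using e k by simp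
  from step_path_approx_continuous[OF x this]
  show "eventually (\<lambda>m. dist (H (step_path m (\<lambda>j. x (real j / real m)))) (H x) < e) sequentially"
  proof eventually_elim
    case (elim m)
    have "\<bar>H x - H (step_path m (\<lambda>j. x (real j / real m)))\<bar> \<le> k * (e / (k + 1))"
      by (rule sup_lipschitzD[OF H cadlag_continuous[OF x] cadlag_step_path]) (use elim in auto)
    also have "\<dots> < e" using e k by (simp add: field_simps)
    finally show ?case by (simp add: dist_real_def abs_minus_commute)
  qed
qed

text \<open>A fourth power, because the bounds for \<open>m\<close> blocks of variance of order
  \<open>1 / m\<close> must have a vanishing sum. Truncation at \<open>1\<close> makes it a bounded
  continuous test function, so only the normal limit needs a fourth moment; that of the standard
  normal law is \<open>3\<close>.\<close>

lemma integral_centered_normal_fourth: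
  assumes \<eta>: "0 < \<eta>"
  shows "integral\<^sup>L (centered_normal s) (\<lambda>x. min 1 (x ^ 4 / \<eta> ^ 4)) \<le> 3 * s ^ 4 / \<eta> ^ 4"
proof -
  have i: "integrable std_normal_distribution (\<lambda>z. z ^ 4)"
    by (rule integrable_std_normal_distribution_moment)
  have v: "integral\<^sup>L std_normal_distribution (\<lambda>z. z ^ 4) = 3"
    using std_normal_distribution_even_moments(1)[of 2] by (simp add: fact_numeral)
  interpret real_distribution std_normal_distribution by (rule real_dist_normal_dist)
  have "integral\<^sup>L (centered_normal s) (\<lambda>x. min 1 (x ^ 4 / \<eta> ^ 4)) = integral\<^sup>L std_normal_distribution (\<lambda>z. min 1 ((s * z) ^ 4 / \<eta> ^ 4))"
    unfolding centered_normal_def by (rule integral_distr) auto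
  also have "\<dots> \<le> integral\<^sup>L std_normal_distribution (\<lambda>z. s ^ 4 / \<eta> ^ 4 * z ^ 4)"
  proof (rule integral_mono)
    show "integrable std_normal_distribution (\<lambda>z. min 1 ((s * z) ^ 4 / \<eta> ^ 4))"
      by (rule integrable_const_bound[of _ 1]) (auto intro!: AE_I2)
    show "integrable std_normal_distribution (\<lambda>z. s ^ 4 / \<eta> ^ 4 * z ^ 4)" using i by simp
  qed (simp add: power_mult_distrib)
  also have "\<dots> = 3 * s ^ 4 / \<eta> ^ 4" using v by simp
  finally show ?thesis .
qed

context signed_innovations
begin

definition oscillation :: "nat \<Rightarrow> nat \<Rightarrow> real \<Rightarrow> nat \<Rightarrow> 'a set" where
  "oscillation m n \<eta> j = {\<omega>\<in>space M. \<exists>i\<le>n * Suc j div m - n * j div m. \<bar>V (n * j div m + i) \<omega> - V (n * j div m) \<omega>\<bar> > 2 * (\<eta> * sqrt n)}"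

lemma oscillation_sets [measurable]: "oscillation m n \<eta> j \<in> sets M"
proof -
  have "oscillation m n \<eta> j = (\<Union>i\<le>n * Suc j div m - n * j div m. {\<omega>\<in>space M. \<bar>V (n * j div m + i) \<omega> - V (n * j div m) \<omega>\<bar> > 2 * (\<eta> * sqrt n)})"
    unfolding oscillation_def by auto
  also have "\<dots> \<in> sets M" by measurable
  finally show ?thesis .
qed

text \<open>Ottaviani's inequality at level \<open>\<eta> * sqrt n\<close>, then Markov's inequality
  for the truncated fourth power. A block has length about \<open>n / m\<close>, so the hypothesis
  on \<open>m\<close> yields the variance condition for large \<open>n\<close>. The factor
  \<open>7\<close> leaves room above \<open>2 * 3\<close>, the bound for the limit.\<close>

lemma prob_oscillation:
  assumes m: "2 * \<sigma>\<^sup>2 / \<eta>\<^sup>2 < real m" and \<eta>: "0 < \<eta>"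
  shows "eventually (\<lambda>n. prob (oscillation m n \<eta> j) \<le> 7 * \<sigma> ^ 4 / (real m ^ 2 * \<eta> ^ 4)) sequentially"
proof -
  have m0: "0 < m" using m \<eta> by (metis divide_nonneg_nonneg linorder_not_less mult_nonneg_nonneg of_nat_le_0_iff order.strict_trans2 zero_le_numeral zero_le_power2 gr0I of_nat_0)
  define N where "N n = n * Suc j div m - n * j div m" for n
  have N: "N n \<le> n" for n unfolding N_def using block_boundary_Suc_le(2)[OF m0, of n j] by linarith
  have Nlim: "(\<lambda>n. real (N n) / real n) \<longlonglongrightarrow> 1 / real m"
    unfolding N_def by (rule block_length_tendsto[OF m0])
  let ?f = "\<lambda>x::real. min 1 (x ^ 4 / \<eta> ^ 4)"
  let ?D = "\<lambda>n \<omega>. (V (n * j div m + N n) \<omega> - V (n * j div m) \<omega>) / sqrt n"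
  have "(\<lambda>n. expectation (\<lambda>\<omega>. 1 * ?f (?D n \<omega>))) \<longlonglongrightarrow> 1 * integral\<^sup>L (centered_normal (\<sigma> * sqrt (1 / real m))) ?f"
  proof (rule weighted_block_clt[where K=1 and C=1 and W="\<lambda>_ _. 1", OF _ _ _ _ N Nlim])
    show "continuous_on UNIV ?f" using \<eta> by (intro continuous_intros) auto
  qed (auto simp: prob_space)
  then have lim: "(\<lambda>n. 2 * expectation (\<lambda>\<omega>. ?f (?D n \<omega>))) \<longlonglongrightarrow> 2 * integral\<^sup>L (centered_normal (\<sigma> * sqrt (1 / real m))) ?f"
    by (intro tendsto_mult tendsto_const) simp
  have "2 * integral\<^sup>L (centered_normal (\<sigma> * sqrt (1 / real m))) ?f \<le> 2 * (3 * (\<sigma> * sqrt (1 / real m)) ^ 4 / \<eta> ^ 4)"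
    using integral_centered_normal_fourth[OF \<eta>] by (intro mult_left_mono) auto
  also have "(\<sigma> * sqrt (1 / real m)) ^ 4 = \<sigma> ^ 4 / (real m)\<^sup>2"
  proof -
    have "y ^ 4 = (y\<^sup>2)\<^sup>2" for y :: real by (simp flip: power_mult)
    then have "sqrt (1 / real m) ^ 4 = (sqrt (1 / real m) ^ 2) ^ 2" .
    also have "\<dots> = 1 / (real m)\<^sup>2" by (simp add: power_divide)
    finally show ?thesis by (simp add: power_mult_distrib)
  qed
  also have "2 * (3 * (\<sigma> ^ 4 / (real m)\<^sup>2) / \<eta> ^ 4) = 6 * \<sigma> ^ 4 / (real m ^ 2 * \<eta> ^ 4)" by simp
  also have "\<dots> < 7 * \<sigma> ^ 4 / (real m ^ 2 * \<eta> ^ 4)"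
    using \<sigma>_pos \<eta> m0 by (intro divide_strict_right_mono mult_strict_right_mono mult_pos_pos) auto
  finally have "2 * integral\<^sup>L (centered_normal (\<sigma> * sqrt (1 / real m))) ?f < 7 * \<sigma> ^ 4 / (real m ^ 2 * \<eta> ^ 4)" .
  with lim have ev1: "eventually (\<lambda>n. 2 * expectation (\<lambda>\<omega>. ?f (?D n \<omega>)) < 7 * \<sigma> ^ 4 / (real m ^ 2 * \<eta> ^ 4)) sequentially"
    by (rule order_tendstoD)
  have "2 * \<sigma>\<^sup>2 / \<eta>\<^sup>2 < real m" by (rule m)
  then have "1 / real m < \<eta>\<^sup>2 / (2 * \<sigma>\<^sup>2)" using \<eta> \<sigma>_pos m0 by (simp add: field_simps)
  with Nlim have ev2: "eventually (\<lambda>n. real (N n) / real n < \<eta>\<^sup>2 / (2 * \<sigma>\<^sup>2)) sequentially"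
    by (rule order_tendstoD)
  from ev1 ev2 eventually_gt_at_top[of 0] show ?thesis
  proof eventually_elim
    case (elim n)
    have n: "0 < real n" using elim(3) by simp
    have l: "0 < \<eta> * sqrt n" using \<eta> n by simp
    have "real (N n) * \<sigma>\<^sup>2 \<le> \<eta>\<^sup>2 * real n / 2"
      using elim(2) n \<sigma>_pos by (simp add: field_simps)
    also have "\<eta>\<^sup>2 * real n / 2 = (\<eta> * sqrt n)\<^sup>2 / 2" using n by (simp add: power_mult_distrib)
    finally have "prob (oscillation m n \<eta> j) \<le> 2 * prob {\<omega>\<in>space M. \<bar>V (n * j div m + N n) \<omega> - V (n * j div m) \<omega>\<bar> > \<eta> * sqrt n}"
      unfolding oscillation_def N_def[symmetric] by (rule ottaviani[OF l])
    also have "prob {\<omega>\<in>space M. \<bar>V (n * j div m + N n) \<omega> - V (n * j div m) \<omega>\<bar> > \<eta> * sqrt n} \<le> expectation (\<lambda>\<omega>. ?f (?D n \<omega>))"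
    proof -
      let ?B = "{\<omega>\<in>space M. \<bar>V (n * j div m + N n) \<omega> - V (n * j div m) \<omega>\<bar> > \<eta> * sqrt n}"
      have B: "?B \<in> sets M" by measurable
      have "prob ?B = expectation (indicator ?B)" using B by simp
      also have "\<dots> \<le> expectation (\<lambda>\<omega>. ?f (?D n \<omega>))"
      proof (rule integral_mono)
        show "integrable M (indicator ?B :: 'a \<Rightarrow> real)" using B by (simp add: integrable_indicator_iff emeasure_eq_measure)
        show "integrable M (\<lambda>\<omega>. ?f (?D n \<omega>))"
          by (rule integrable_const_bound[of _ 1]) (auto intro!: AE_I2)
        fix \<omega> assume "\<omega> \<in> space M"
        show "indicator ?B \<omega> \<le> ?f (?D n \<omega>)"
        proof (cases "\<omega> \<in> ?B")
          case True
          then have "\<eta> < \<bar>?D n \<omega>\<bar>" using n by (simp add: abs_divide field_simps)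
          then have "\<eta> ^ 4 \<le> \<bar>?D n \<omega>\<bar> ^ 4" using \<eta> by (intro power_mono) auto
          then have "\<eta> ^ 4 \<le> ?D n \<omega> ^ 4" by (simp only: power_even_abs_numeral even_numeral)
          then show ?thesis using True \<eta> by simp
        next
          case False
          then show ?thesis by simp
        qed
      qed
      finally show ?thesis .
    qed
    finally show ?case using elim(1) by linarith
  qed
qed

lemma path_near_block_path:
  assumes m: "0 < m" and n: "0 < n" and \<omega>: "\<omega> \<in> space M" "\<And>j. j < m \<Longrightarrow> \<omega> \<notin> oscillation m n \<eta> j"
    and t: "0 \<le> t" "t \<le> 1" and \<eta>: "0 < \<eta>"
  shows "\<bar>step_path n (\<lambda>i. V i \<omega> / sqrt n) t - step_path m (\<lambda>j. V (n * j div m) \<omega> / sqrt n) t\<bar> \<le> 2 * \<eta>"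
proof (cases "t = 1")
  case True
  \<comment> \<open>Both paths end in \<open>V n \<omega> / sqrt n\<close>, the last block boundary
    being exactly \<open>n\<close>.\<close>
  then show ?thesis using m \<eta> by (simp add: step_path_def)
next
  case False
  then have t1: "t < 1" using t by simp
  define j where "j = nat \<lfloor>real m * t\<rfloor>"
  define i where "i = nat \<lfloor>real n * t\<rfloor>"
  note b = nat_floor_in_block(1,2)[OF m t(1) t1, where n=n, folded j_def i_def]
    nat_floor_in_block(3)[OF m t(1) t1, folded j_def]
  have "\<bar>V (n * j div m + (i - n * j div m)) \<omega> - V (n * j div m) \<omega>\<bar> \<le> 2 * (\<eta> * sqrt n)"
    using \<omega>(2)[OF b(3)] \<omega>(1) b unfolding oscillation_def
    by (auto simp: not_less dest!: spec[of _ "i - n * j div m"])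
  then have "\<bar>V i \<omega> - V (n * j div m) \<omega>\<bar> \<le> 2 * (\<eta> * sqrt n)" using b by simp
  then have "\<bar>V i \<omega> - V (n * j div m) \<omega>\<bar> / sqrt n \<le> 2 * (\<eta> * sqrt n) / sqrt n"
    by (intro divide_right_mono) auto
  also have "2 * (\<eta> * sqrt n) / sqrt n = 2 * \<eta>" using n by simp
  finally show ?thesis
    unfolding step_path_def j_def[symmetric] i_def[symmetric]
    by (simp add: diff_divide_distrib[symmetric] abs_divide)
qed

lemma block_path_eq_sum:
  assumes "0 < m"
  shows "V (n * j div m) \<omega> / sqrt n = (\<Sum>i<j. block_increment m n i \<omega>)"
proof (induction j)
  case 0
  then show ?case by (simp add: V_def)
next
  case (Suc j)
  then show ?case by (simp add: block_increment_def diff_divide_distrib)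
qed

end

lemma (in prob_space) expectation_diff_le:
  fixes A B :: "'a \<Rightarrow> real"
  assumes A: "A \<in> borel_measurable M" "\<And>\<omega>. \<omega> \<in> space M \<Longrightarrow> \<bar>A \<omega>\<bar> \<le> K"
    and B: "B \<in> borel_measurable M" "\<And>\<omega>. \<omega> \<in> space M \<Longrightarrow> \<bar>B \<omega>\<bar> \<le> K"
    and E: "E \<in> sets M" and close: "\<And>\<omega>. \<omega> \<in> space M \<Longrightarrow> \<omega> \<notin> E \<Longrightarrow> \<bar>A \<omega> - B \<omega>\<bar> \<le> a" and a: "0 \<le> a"
  shows "\<bar>expectation A - expectation B\<bar> \<le> a + 2 * K * prob E"
proof -
  have iA: "integrable M A" by (rule integrable_const_bound[of _ K]) (use A in auto)
  have iB: "integrable M B" by (rule integrable_const_bound[of _ K]) (use B in auto)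
  have iE: "integrable M (indicator E :: 'a \<Rightarrow> real)" using E by (simp add: integrable_indicator_iff emeasure_eq_measure)
  have "\<bar>expectation A - expectation B\<bar> = \<bar>expectation (\<lambda>\<omega>. A \<omega> - B \<omega>)\<bar>" using iA iB by simp
  also have "\<dots> \<le> expectation (\<lambda>\<omega>. \<bar>A \<omega> - B \<omega>\<bar>)" by (rule integral_abs_bound)
  also have "\<dots> \<le> expectation (\<lambda>\<omega>. a + 2 * K * indicator E \<omega>)"
  proof (rule integral_mono)
    show "integrable M (\<lambda>\<omega>. \<bar>A \<omega> - B \<omega>\<bar>)" using iA iB by (intro integrable_abs Bochner_Integration.integrable_diff)
    show "integrable M (\<lambda>\<omega>. a + 2 * K * indicator E \<omega>)"
      by (intro Bochner_Integration.integrable_add integrable_const integrable_mult_right iE)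
    fix \<omega> assume \<omega>: "\<omega> \<in> space M"
    show "\<bar>A \<omega> - B \<omega>\<bar> \<le> a + 2 * K * indicator E \<omega>"
    proof (cases "\<omega> \<in> E")
      case True
      then show ?thesis using A(2)[OF \<omega>] B(2)[OF \<omega>] a by simp
    next
      case False
      then show ?thesis using close[OF \<omega>] by simp
    qed
  qed
  also have "\<dots> = a + 2 * K * prob E" using iE E by (simp add: prob_space)
  finally show ?thesis .
qed

text \<open>Dominated convergence: \<open>n\<close> times the indicator of the event is at most
  \<open>(X \<omega>)\<^sup>2 / \<eta>\<^sup>2\<close> and vanishes for large \<open>n\<close> at
  each point. The factor \<open>n\<close> is what a union bound over \<open>n\<close> innovations
  costs.\<close>

lemma (in prob_space) square_integrable_tail:
  fixes X :: "'a \<Rightarrow> real"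
  assumes X [measurable]: "X \<in> borel_measurable M" and X2: "integrable M (\<lambda>\<omega>. (X \<omega>)\<^sup>2)" and \<eta>: "0 < \<eta>"
  shows "(\<lambda>n. real n * prob {\<omega>\<in>space M. \<bar>X \<omega>\<bar> > \<eta> * sqrt n}) \<longlonglongrightarrow> 0"
proof -
  let ?E = "\<lambda>n::nat. {\<omega>\<in>space M. \<bar>X \<omega>\<bar> > \<eta> * sqrt n}"
  have "(\<lambda>n. expectation (\<lambda>\<omega>. real n * indicator (?E n) \<omega>)) \<longlonglongrightarrow> expectation (\<lambda>\<omega>. 0)"
  proof (rule integral_dominated_convergence[where w="\<lambda>\<omega>. (X \<omega>)\<^sup>2 / \<eta>\<^sup>2"])
    show "integrable M (\<lambda>\<omega>. (X \<omega>)\<^sup>2 / \<eta>\<^sup>2)" using X2 by simp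
    show "AE \<omega> in M. (\<lambda>n. real n * indicator (?E n) \<omega>) \<longlonglongrightarrow> 0"
    proof (intro AE_I2 tendsto_eventually)
      fix \<omega> assume "\<omega> \<in> space M"
      obtain n0 :: nat where n0: "(\<bar>X \<omega>\<bar> / \<eta>)\<^sup>2 < n0" using reals_Archimedean2 by blast
      show "eventually (\<lambda>n. real n * indicator (?E n) \<omega> = 0) sequentially"
      proof (rule eventually_sequentiallyI[of n0])
        fix n assume "n0 \<le> n"
        then have "(\<bar>X \<omega>\<bar> / \<eta>)\<^sup>2 \<le> real n" using n0 by linarith
        then have "\<bar>X \<omega>\<bar> / \<eta> \<le> sqrt n" by (rule real_le_rsqrt)
        then have "\<bar>X \<omega>\<bar> \<le> \<eta> * sqrt n" using \<eta> by (simp add: field_simps)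
        then show "real n * indicator (?E n) \<omega> = 0" by simp
      qed
    qed
    fix n :: nat
    show "AE \<omega> in M. norm (real n * indicator (?E n) \<omega>) \<le> (X \<omega>)\<^sup>2 / \<eta>\<^sup>2"
    proof (intro AE_I2)
      fix \<omega> assume "\<omega> \<in> space M"
      show "norm (real n * indicator (?E n) \<omega>) \<le> (X \<omega>)\<^sup>2 / \<eta>\<^sup>2"
      proof (cases "\<omega> \<in> ?E n")
        case True
        then have "(\<eta> * sqrt n)\<^sup>2 \<le> \<bar>X \<omega>\<bar>\<^sup>2" using \<eta> by (intro power_mono) auto
        then show ?thesis using True \<eta> by (simp add: power_mult_distrib field_simps)
      qed simp
    qed
  qed simp_all
  then show ?thesis by simp
qed

section \<open>Increments and functionals of Brownian motion\<close>

lemma standard_BM_increment_distr: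
  assumes B: "standard_BM N B" and st: "0 \<le> s" "s < t" "t \<le> 1"
  shows "distr N borel (\<lambda>\<omega>. \<sigma> * (B t \<omega> - B s \<omega>)) = centered_normal (\<sigma> * sqrt (t - s))"
proof -
  interpret N: prob_space N using B unfolding standard_BM_def by blast
  have [measurable]: "B t \<in> borel_measurable N" for t using B unfolding standard_BM_def by blast
  have "distributed N lborel (\<lambda>\<omega>. B t \<omega> - B s \<omega>) (normal_density 0 (sqrt (t - s)))"
    using B st unfolding standard_BM_def by blast
  then have "distributed N lborel (\<lambda>\<omega>. (B t \<omega> - B s \<omega>) / sqrt (t - s)) std_normal_density"
    using N.normal_standard_normal_convert[of "sqrt (t - s)" "\<lambda>\<omega>. B t \<omega> - B s \<omega>" 0] st by simp
  then have "distr N lborel (\<lambda>\<omega>. (B t \<omega> - B s \<omega>) / sqrt (t - s)) = std_normal_distribution"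
    by (rule distributed_distr_eq_density)
  then have "centered_normal (\<sigma> * sqrt (t - s)) = distr (distr N lborel (\<lambda>\<omega>. (B t \<omega> - B s \<omega>) / sqrt (t - s))) borel (\<lambda>z. \<sigma> * sqrt (t - s) * z)"
    by (simp add: centered_normal_def)
  also have "\<dots> = distr N borel (\<lambda>\<omega>. \<sigma> * sqrt (t - s) * ((B t \<omega> - B s \<omega>) / sqrt (t - s)))"
    by (subst distr_distr) (auto simp: comp_def)
  also have "\<dots> = distr N borel (\<lambda>\<omega>. \<sigma> * (B t \<omega> - B s \<omega>))" using st by simp
  finally show ?thesis by simp
qed

lemma standard_BM_increments_prod:
  assumes B: "standard_BM N B" and m: "0 < m"
    and f: "\<And>j. continuous_on UNIV (f j)" "\<And>j x. 0 \<le> f j x \<and> f j x \<le> (1::real)"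
  shows "integral\<^sup>L N (\<lambda>\<omega>. \<Prod>j<m. f j (\<sigma> * (B (real (Suc j) / real m) \<omega> - B (real j / real m) \<omega>)))
    = (\<Prod>j<m. integral\<^sup>L (centered_normal (\<sigma> * sqrt (1 / real m))) (f j))"
proof -
  interpret N: prob_space N using B unfolding standard_BM_def by blast
  have [measurable]: "B t \<in> borel_measurable N" for t using B unfolding standard_BM_def by blast
  have f_M [measurable]: "f j \<in> borel_measurable borel" for j by (rule borel_measurable_continuous_onI[OF f(1)])
  let ?ts = "\<lambda>i. real i / real m"
  have ind: "N.indep_vars (\<lambda>_. borel) (\<lambda>i \<omega>. B (?ts (Suc i)) \<omega> - B (?ts i) \<omega>) {..<m}"
  proof -
    have "0 \<le> ?ts 0 \<and> (\<forall>i<m. ?ts i < ?ts (Suc i)) \<and> ?ts m \<le> 1"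
      using m by (auto intro: divide_strict_right_mono)
    note ts = this
    have "\<forall>(ts :: nat \<Rightarrow> real) k. 0 \<le> ts 0 \<and> (\<forall>i<k. ts i < ts (Suc i)) \<and> ts k \<le> 1 \<longrightarrow>
        N.indep_vars (\<lambda>_. borel) (\<lambda>i \<omega>. B (ts (Suc i)) \<omega> - B (ts i) \<omega>) {..<k}"
      using B unfolding standard_BM_def by (elim conjE) assumption
    from this[THEN spec, THEN spec, THEN mp, OF ts] show ?thesis .
  qed
  have "N.indep_vars (\<lambda>_. borel) (\<lambda>j \<omega>. f j (\<sigma> * (B (?ts (Suc j)) \<omega> - B (?ts j) \<omega>))) {..<m}"
    by (rule N.indep_vars_compose2[OF ind, where Y="\<lambda>j x. f j (\<sigma> * x)"]) simp
  then have "integral\<^sup>L N (\<lambda>\<omega>. \<Prod>j<m. f j (\<sigma> * (B (?ts (Suc j)) \<omega> - B (?ts j) \<omega>))) =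
      (\<Prod>j<m. integral\<^sup>L N (\<lambda>\<omega>. f j (\<sigma> * (B (?ts (Suc j)) \<omega> - B (?ts j) \<omega>))))"
  proof (rule N.indep_vars_lebesgue_integral[rotated])
    show "integrable N (\<lambda>\<omega>. f j (\<sigma> * (B (?ts (Suc j)) \<omega> - B (?ts j) \<omega>)))" for j
      by (rule N.integrable_const_bound[of _ 1]) (use f(2) in \<open>auto simp: abs_le_iff intro: order.trans[of _ 0]\<close>)
  qed simp
  also have "\<dots> = (\<Prod>j<m. integral\<^sup>L (centered_normal (\<sigma> * sqrt (1 / real m))) (f j))"
  proof (rule prod.cong[OF refl])
    fix j assume "j \<in> {..<m}"
    then have "0 \<le> ?ts j" "?ts j < ?ts (Suc j)" "?ts (Suc j) \<le> 1" using m by (auto intro: divide_strict_right_mono)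
    note d = standard_BM_increment_distr[OF B this, of \<sigma>]
    have "?ts (Suc j) - ?ts j = 1 / real m" by (simp add: diff_divide_distrib[symmetric])
    with d have "centered_normal (\<sigma> * sqrt (1 / real m)) = distr N borel (\<lambda>\<omega>. \<sigma> * (B (?ts (Suc j)) \<omega> - B (?ts j) \<omega>))" by simp
    then show "integral\<^sup>L N (\<lambda>\<omega>. f j (\<sigma> * (B (?ts (Suc j)) \<omega> - B (?ts j) \<omega>))) = integral\<^sup>L (centered_normal (\<sigma> * sqrt (1 / real m))) (f j)"
      by (simp add: integral_distr)
  qed
  finally show ?thesis .
qed

lemma standard_BM_scaled_path:
  assumes B: "standard_BM N B" and \<omega>: "\<omega> \<in> space N"
  shows "continuous_on {0..1} (\<lambda>t. \<sigma> * B t \<omega>)" "\<sigma> * B 0 \<omega> = 0"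
  using B \<omega> unfolding standard_BM_def by (auto intro!: continuous_intros)

lemma borel_measurable_standard_BM_functional:
  assumes B: "standard_BM N B" and H: "sup_lipschitz k H" and k: "0 \<le> k"
  shows "(\<lambda>\<omega>. H (\<lambda>t. \<sigma> * B t \<omega>)) \<in> borel_measurable N"
proof (rule borel_measurable_LIMSEQ_real)
  have [measurable]: "B t \<in> borel_measurable N" for t using B unfolding standard_BM_def by blast
  show "(\<lambda>\<omega>. H (step_path m (\<lambda>j. \<sigma> * B (real j / real m) \<omega>))) \<in> borel_measurable N" for m
    by (rule borel_measurable_step_path[OF H]) simp
  show "(\<lambda>m. H (step_path m (\<lambda>j. \<sigma> * B (real j / real m) \<omega>))) \<longlonglongrightarrow> H (\<lambda>t. \<sigma> * B t \<omega>)" if "\<omega> \<in> space N" for \<omega>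
    by (rule sup_lipschitz_tendsto_step_path[OF H k standard_BM_scaled_path(1)[OF B that]])
qed

context signed_innovations
begin

text \<open>A coarse step path consists of partial sums of at most \<open>m\<close> increments, so
  \<open>H\<close> becomes a function of the increments with Lipschitz constant
  \<open>k * m\<close>.\<close>

lemma block_path_tendsto:
  assumes B: "standard_BM N B" and H: "sup_lipschitz k H" and k: "0 \<le> k"
    and HK: "\<And>x. cadlag x \<Longrightarrow> \<bar>H x\<bar> \<le> K" and m: "0 < m"
  shows "(\<lambda>n. expectation (\<lambda>\<omega>. H (step_path m (\<lambda>j. V (n * j div m) \<omega> / sqrt n))))
    \<longlonglongrightarrow> integral\<^sup>L N (\<lambda>\<omega>. H (step_path m (\<lambda>j. \<sigma> * B (real j / real m) \<omega>)))"
proof -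
  interpret N: prob_space N using B unfolding standard_BM_def by blast
  have B_M [measurable]: "B t \<in> borel_measurable N" for t using B unfolding standard_BM_def by blast
  define h where "h d = H (step_path m (\<lambda>j. \<Sum>i<j. d i))" for d :: "nat \<Rightarrow> real"
  define Z where "Z j \<omega> = \<sigma> * (B (real (Suc j) / real m) \<omega> - B (real j / real m) \<omega>)" for j \<omega>
  have Z_M [measurable]: "Z j \<in> borel_measurable N" for j unfolding Z_def by measurable
  have hX: "H (step_path m (\<lambda>j. V (n * j div m) \<omega> / sqrt n)) = h (\<lambda>j. block_increment m n j \<omega>)" for n \<omega>
    unfolding h_def block_path_eq_sum[OF m] ..
  have hZ: "H (step_path m (\<lambda>j. \<sigma> * B (real j / real m) \<omega>)) = h (\<lambda>j. Z j \<omega>)" if "\<omega> \<in> space N" for \<omega>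
  proof -
    have "(\<Sum>i<j. Z i \<omega>) = \<sigma> * B (real j / real m) \<omega>" for j
      using standard_BM_scaled_path(2)[OF B that, of \<sigma>]
      by (induction j) (auto simp: Z_def algebra_simps)
    then show ?thesis unfolding h_def by simp
  qed
  have "(\<lambda>n. expectation (\<lambda>\<omega>. h (\<lambda>j. block_increment m n j \<omega>))) \<longlonglongrightarrow> integral\<^sup>L N (\<lambda>\<omega>. h (\<lambda>j. Z j \<omega>))"
  proof (rule prod_test_functions_imp_lipschitz[where k="k * m" and K=K and m=m and h=h and X="block_increment m" and Z=Z])
    show "prob_space M" "prob_space N" by unfold_locales
    show "\<bar>h x\<bar> \<le> K" for x unfolding h_def by (rule HK[OF cadlag_step_path])
    show "(\<lambda>\<omega>. h (\<lambda>j. block_increment m n j \<omega>)) \<in> borel_measurable M" for n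
      unfolding h_def by (rule borel_measurable_step_path[OF H]) measurable
    show "(\<lambda>\<omega>. h (\<lambda>j. Z j \<omega>)) \<in> borel_measurable N"
      unfolding h_def by (rule borel_measurable_step_path[OF H]) measurable
    show "\<bar>h x - h y\<bar> \<le> k * real m * d" if xy: "\<And>j. j < m \<Longrightarrow> \<bar>x j - y j\<bar> \<le> d" and d: "0 \<le> d" for x y d
    proof -
      have "\<bar>h x - h y\<bar> \<le> k * (real m * d)"
        unfolding h_def
      proof (rule sup_lipschitzD[OF H cadlag_step_path cadlag_step_path], rule step_path_diff_le)
        fix i assume i: "i \<le> m"
        have "\<bar>(\<Sum>i<i. x i) - (\<Sum>i<i. y i)\<bar> \<le> (\<Sum>j<i. \<bar>x j - y j\<bar>)"
          unfolding sum_subtractf[symmetric] by (rule sum_abs)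
        also have "\<dots> \<le> (\<Sum>j<i. d)" using i by (intro sum_mono xy) auto
        also have "\<dots> \<le> real m * d" using i d by (simp add: mult_right_mono)
        finally show "\<bar>(\<Sum>i<i. x i) - (\<Sum>i<i. y i)\<bar> \<le> real m * d" .
      qed
      then show ?thesis by (simp add: mult.assoc)
    qed
    fix f :: "nat \<Rightarrow> real \<Rightarrow> real"
    assume f: "\<And>j. continuous_on UNIV (f j)" "\<And>j x. 0 \<le> f j x \<and> f j x \<le> 1"
    show "(\<lambda>n. expectation (\<lambda>\<omega>. \<Prod>j<m. f j (block_increment m n j \<omega>))) \<longlonglongrightarrow> integral\<^sup>L N (\<lambda>\<omega>. \<Prod>j<m. f j (Z j \<omega>))"
      unfolding Z_def standard_BM_increments_prod[OF B m f] by (rule block_increments_clt[OF m f])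
  qed (use k in auto)
  also have "integral\<^sup>L N (\<lambda>\<omega>. h (\<lambda>j. Z j \<omega>)) = integral\<^sup>L N (\<lambda>\<omega>. H (step_path m (\<lambda>j. \<sigma> * B (real j / real m) \<omega>)))"
    by (rule Bochner_Integration.integral_cong) (simp_all add: hZ)
  finally show ?thesis unfolding hX .
qed

text \<open>Order of choices: \<open>\<eta>\<close> fixes the tolerated oscillation; then
  \<open>m\<close> is taken large for the discretised Brownian motion and for the summed oscillation
  probabilities, which decay like \<open>1 / m\<close>; only then does \<open>n\<close> grow, with
  \<open>m\<close> fixed.\<close>

theorem signed_walk_fclt:
  assumes B: "standard_BM N B" and H: "sup_lipschitz k H" and k: "0 \<le> k"
    and HK: "\<And>x. cadlag x \<Longrightarrow> \<bar>H x\<bar> \<le> K"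
  shows "(\<lambda>n. expectation (\<lambda>\<omega>. H (step_path n (\<lambda>i. V i \<omega> / sqrt n)))) \<longlonglongrightarrow> integral\<^sup>L N (\<lambda>\<omega>. H (\<lambda>t. \<sigma> * B t \<omega>))"
proof (rule tendstoI)
  fix e :: real assume e: "0 < e"
  interpret N: prob_space N using B unfolding standard_BM_def by blast
  have B_M [measurable]: "B t \<in> borel_measurable N" for t using B unfolding standard_BM_def by blast
  have K: "0 \<le> K" using HK[OF cadlag_step_path[of 0 "\<lambda>_. 0"]] by linarith
  define \<eta> where "\<eta> = e / (8 * (k + 1))"
  have \<eta>: "0 < \<eta>" using e k by (simp add: \<eta>_def)
  have "\<eta> * (8 * (k + 1)) = e" using k by (simp add: \<eta>_def)
  then have k\<eta>: "k * (2 * \<eta>) \<le> e / 4" using \<eta> by (simp add: algebra_simps)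
  have "(\<lambda>m. integral\<^sup>L N (\<lambda>\<omega>. H (step_path m (\<lambda>j. \<sigma> * B (real j / real m) \<omega>)))) \<longlonglongrightarrow> integral\<^sup>L N (\<lambda>\<omega>. H (\<lambda>t. \<sigma> * B t \<omega>))"
  proof (rule integral_dominated_convergence[where w="\<lambda>_. K"])
    show "(\<lambda>\<omega>. H (step_path m (\<lambda>j. \<sigma> * B (real j / real m) \<omega>))) \<in> borel_measurable N" for m
      by (rule borel_measurable_step_path[OF H]) simp
    show "(\<lambda>\<omega>. H (\<lambda>t. \<sigma> * B t \<omega>)) \<in> borel_measurable N"
      by (rule borel_measurable_standard_BM_functional[OF B H k])
    show "AE \<omega> in N. (\<lambda>m. H (step_path m (\<lambda>j. \<sigma> * B (real j / real m) \<omega>))) \<longlonglongrightarrow> H (\<lambda>t. \<sigma> * B t \<omega>)"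
      by (intro AE_I2 sup_lipschitz_tendsto_step_path[OF H k] standard_BM_scaled_path(1)[OF B])
    show "AE \<omega> in N. norm (H (step_path m (\<lambda>j. \<sigma> * B (real j / real m) \<omega>))) \<le> K" for m
      using HK[OF cadlag_step_path] by simp
  qed simp
  then have ev1: "eventually (\<lambda>m. dist (integral\<^sup>L N (\<lambda>\<omega>. H (step_path m (\<lambda>j. \<sigma> * B (real j / real m) \<omega>)))) (integral\<^sup>L N (\<lambda>\<omega>. H (\<lambda>t. \<sigma> * B t \<omega>))) < e / 4) sequentially"
    by (rule tendstoD) (use e in simp)
  obtain m1 :: nat where m1: "2 * \<sigma>\<^sup>2 / \<eta>\<^sup>2 < m1" using reals_Archimedean2 by blast
  have "(\<lambda>m. (2 * K * (7 * \<sigma> ^ 4 / \<eta> ^ 4)) / real m) \<longlonglongrightarrow> 0" by (rule lim_const_over_n)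
  then have ev2: "eventually (\<lambda>m. (2 * K * (7 * \<sigma> ^ 4 / \<eta> ^ 4)) / real m < e / 4) sequentially"
    by (rule order_tendstoD) (use e in simp)
  from eventually_conj[OF ev1 eventually_conj[OF ev2 eventually_ge_at_top[of "Suc m1"]]]
  obtain m where m: "dist (integral\<^sup>L N (\<lambda>\<omega>. H (step_path m (\<lambda>j. \<sigma> * B (real j / real m) \<omega>)))) (integral\<^sup>L N (\<lambda>\<omega>. H (\<lambda>t. \<sigma> * B t \<omega>))) < e / 4"
    "(2 * K * (7 * \<sigma> ^ 4 / \<eta> ^ 4)) / real m < e / 4" "Suc m1 \<le> m"
    by (auto dest: eventually_happens)
  have m0: "0 < m" and m2: "2 * \<sigma>\<^sup>2 / \<eta>\<^sup>2 < real m" using m(3) m1 by linarith+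
  have "eventually (\<lambda>n. \<forall>j\<in>{..<m}. prob (oscillation m n \<eta> j) \<le> 7 * \<sigma> ^ 4 / (real m ^ 2 * \<eta> ^ 4)) sequentially"
    by (intro eventually_ball_finite ballI prob_oscillation[OF m2 \<eta>]) simp
  moreover have "eventually (\<lambda>n. dist (expectation (\<lambda>\<omega>. H (step_path m (\<lambda>j. V (n * j div m) \<omega> / sqrt n)))) (integral\<^sup>L N (\<lambda>\<omega>. H (step_path m (\<lambda>j. \<sigma> * B (real j / real m) \<omega>)))) < e / 4) sequentially"
    using block_path_tendsto[OF B H k HK m0] by (rule tendstoD) (use e in auto)
  ultimately show "eventually (\<lambda>n. dist (expectation (\<lambda>\<omega>. H (step_path n (\<lambda>i. V i \<omega> / sqrt n)))) (integral\<^sup>L N (\<lambda>\<omega>. H (\<lambda>t. \<sigma> * B t \<omega>))) < e) sequentially"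
    using eventually_gt_at_top[of 0]
  proof eventually_elim
    case (elim n)
    let ?O = "\<Union>j<m. oscillation m n \<eta> j"
    have "prob ?O \<le> (\<Sum>j<m. prob (oscillation m n \<eta> j))"
      by (rule measure_UNION_le) auto
    also have "\<dots> \<le> (\<Sum>j<m. 7 * \<sigma> ^ 4 / (real m ^ 2 * \<eta> ^ 4))" using elim(1) by (intro sum_mono) auto
    also have "\<dots> = (7 * \<sigma> ^ 4 / \<eta> ^ 4) / real m" using m0 by (simp add: power2_eq_square)
    finally have "2 * K * prob ?O \<le> 2 * K * ((7 * \<sigma> ^ 4 / \<eta> ^ 4) / real m)"
      using K by (intro mult_left_mono) auto
    then have O: "2 * K * prob ?O < e / 4" using m(2) by simp
    have "\<bar>expectation (\<lambda>\<omega>. H (step_path n (\<lambda>i. V i \<omega> / sqrt n))) - expectation (\<lambda>\<omega>. H (step_path m (\<lambda>j. V (n * j div m) \<omega> / sqrt n)))\<bar>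
       \<le> k * (2 * \<eta>) + 2 * K * prob ?O"
    proof (rule expectation_diff_le)
      show "(\<lambda>\<omega>. H (step_path n (\<lambda>i. V i \<omega> / sqrt n))) \<in> borel_measurable M"
        by (rule borel_measurable_step_path[OF H]) simp
      show "(\<lambda>\<omega>. H (step_path m (\<lambda>j. V (n * j div m) \<omega> / sqrt n))) \<in> borel_measurable M"
        by (rule borel_measurable_step_path[OF H]) simp
      show "\<bar>H (step_path n (\<lambda>i. V i \<omega> / sqrt n)) - H (step_path m (\<lambda>j. V (n * j div m) \<omega> / sqrt n))\<bar> \<le> k * (2 * \<eta>)"
        if "\<omega> \<in> space M" "\<omega> \<notin> ?O" for \<omega>
        by (rule sup_lipschitzD[OF H cadlag_step_path cadlag_step_path], rule path_near_block_path)
           (use that m0 elim(3) \<eta> in auto)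
      show "0 \<le> k * (2 * \<eta>)" using k \<eta> by simp
    qed (auto intro: HK cadlag_step_path)
    \<comment> \<open>Four quarters of \<open>e\<close>: oscillation within blocks, the exceptional
      event, convergence of the block path, and discretisation of Brownian motion.\<close>
    then show ?case using O k\<eta> elim(2) m(1) unfolding dist_real_def by linarith
  qed
qed

end

section \<open>The threshold autoregressive model\<close>

text \<open>The generated sigma-algebra, as the pullback along a single map into the product space;
  in this form independence of disjoint groups of variables applies directly.\<close>

definition past_algebra :: "'a measure \<Rightarrow> ('i \<Rightarrow> 'a \<Rightarrow> real) \<Rightarrow> 'i set \<Rightarrow> 'a measure" where
  "past_algebra M X I = vimage_algebra (space M) (\<lambda>\<omega>. \<lambda>i\<in>I. X i \<omega>) (Pi\<^sub>M I (\<lambda>_. borel))"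

lemma measurable_past_algebra: "i \<in> I \<Longrightarrow> X i \<in> borel_measurable (past_algebra M X I)"
proof -
  assume i: "i \<in> I"
  have "(\<lambda>\<omega>. \<lambda>i\<in>I. X i \<omega>) \<in> measurable (past_algebra M X I) (Pi\<^sub>M I (\<lambda>_. borel))"
    unfolding past_algebra_def by (rule measurable_vimage_algebra1) (auto simp: space_PiM)
  from measurable_compose[OF this measurable_component_singleton[OF i]] show ?thesis using i by simp
qed

lemma sets_past_algebra_subset:
  assumes "space S = space M" "\<And>i. i \<in> I \<Longrightarrow> X i \<in> borel_measurable S"
  shows "sets (past_algebra M X I) \<subseteq> sets S"
  unfolding past_algebra_def
  by (rule sets_image_in_sets[OF assms(1)]) (intro measurable_restrict assms(2))

lemma (in prob_space) indep_set_past_algebra: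
  assumes ind: "indep_vars (\<lambda>_. borel) X I" and J: "J \<subseteq> I" "i \<in> I" "i \<notin> J"
  shows "indep_set (sets (past_algebra M X J)) {X i -` A \<inter> space M | A. A \<in> sets borel}"
proof -
  have "indep_var (Pi\<^sub>M J (\<lambda>_. borel)) (\<lambda>\<omega>. \<lambda>i\<in>J. X i \<omega>) (Pi\<^sub>M {i} (\<lambda>_. borel)) (\<lambda>\<omega>. \<lambda>i\<in>{i}. X i \<omega>)"
    by (rule indep_var_restrict[OF ind]) (use J in auto)
  then have ind': "indep_set (sets (past_algebra M X J)) (sigma_sets (space M) {(\<lambda>\<omega>. \<lambda>i\<in>{i}. X i \<omega>) -` A \<inter> space M | A. A \<in> sets (Pi\<^sub>M {i} (\<lambda>_. borel))})"
    unfolding indep_var_eq past_algebra_def sets_vimage_algebra by blast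
  have "{X i -` A \<inter> space M | A. A \<in> sets borel} \<subseteq>
     sigma_sets (space M) {(\<lambda>\<omega>. \<lambda>i\<in>{i}. X i \<omega>) -` A \<inter> space M | A. A \<in> sets (Pi\<^sub>M {i} (\<lambda>_. borel))}"
  proof safe
    fix A :: "real set" assume "A \<in> sets borel"
    then have "(\<lambda>f. f i) -` A \<inter> space (Pi\<^sub>M {i} (\<lambda>_. borel)) \<in> sets (Pi\<^sub>M {i} (\<lambda>_. borel))"
      by (intro measurable_sets[OF measurable_component_singleton]) auto
    moreover have "X i -` A \<inter> space M = (\<lambda>\<omega>. \<lambda>i\<in>{i}. X i \<omega>) -` ((\<lambda>f. f i) -` A \<inter> space (Pi\<^sub>M {i} (\<lambda>_. borel))) \<inter> space M"
      by (auto simp: space_PiM)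
    ultimately show "X i -` A \<inter> space M \<in> sigma_sets (space M) {(\<lambda>\<omega>. \<lambda>i\<in>{i}. X i \<omega>) -` A \<inter> space M | A. A \<in> sets (Pi\<^sub>M {i} (\<lambda>_. borel))}"
      by (intro sigma_sets.Basic) blast
  qed
  then show ?thesis using ind' unfolding indep_sets2_eq by blast
qed

lemma sup_lipschitz_abs:
  assumes "sup_lipschitz k H"
  shows "sup_lipschitz k (\<lambda>x. H (\<lambda>t. \<bar>x t\<bar>))"
  unfolding sup_lipschitz_def
proof (intro allI impI)
  fix x y d assume "cadlag x" "cadlag y" and d: "\<forall>t\<in>{0..1}. \<bar>x t - y t\<bar> \<le> d"
  then show "\<bar>H (\<lambda>t. \<bar>x t\<bar>) - H (\<lambda>t. \<bar>y t\<bar>)\<bar> \<le> k * d"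
  proof (intro sup_lipschitzD[OF assms] cadlag_abs)
    fix t :: real assume "0 \<le> t" "t \<le> 1"
    then have "\<bar>x t - y t\<bar> \<le> d" using d by auto
    then show "\<bar>\<bar>x t\<bar> - \<bar>y t\<bar>\<bar> \<le> d" by linarith
  qed
qed

lemma sup_lipschitz_mono: "sup_lipschitz k H \<Longrightarrow> k \<le> l \<Longrightarrow> sup_lipschitz l H"
  unfolding sup_lipschitz_def
  by (smt (verit) atLeastAtMost_iff mult_right_mono)

text \<open>Union bound over \<open>n\<close> innovations of equal law; the tail estimate for a
  square-integrable variable absorbs the factor \<open>n\<close>.\<close>

lemma (in signed_innovations) max_innovation_tendsto:
  assumes \<eta>: "0 < \<eta>"
  shows "(\<lambda>n. prob {\<omega>\<in>space M. \<exists>s<n. \<bar>\<xi> s \<omega>\<bar> > \<eta> * sqrt n}) \<longlonglongrightarrow> 0"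
proof (rule Lim_null_comparison[OF always_eventually square_integrable_tail[OF _ integrable_\<xi>2_0 \<eta>]], rule allI)
  fix n :: nat
  have eq: "prob {\<omega>\<in>space M. \<bar>\<xi> s \<omega>\<bar> > l} = prob {\<omega>\<in>space M. \<bar>\<xi> 0 \<omega>\<bar> > l}" for s l
  proof -
    have S: "{x. \<bar>x\<bar> > l} \<in> sets (borel :: real measure)" by measurable
    have "prob {\<omega>\<in>space M. \<bar>\<xi> s \<omega>\<bar> > l} = measure (distr M borel (\<xi> s)) {x. \<bar>x\<bar> > l}" for s
      using S by (subst measure_distr) (auto intro!: arg_cong[where f=prob])
    then show ?thesis using distr_\<xi>[of s] by simp
  qed
  have "{\<omega>\<in>space M. \<exists>s<n. \<bar>\<xi> s \<omega>\<bar> > \<eta> * sqrt n} = (\<Union>s<n. {\<omega>\<in>space M. \<bar>\<xi> s \<omega>\<bar> > \<eta> * sqrt n})" by auto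
  then have "prob {\<omega>\<in>space M. \<exists>s<n. \<bar>\<xi> s \<omega>\<bar> > \<eta> * sqrt n} \<le> (\<Sum>s<n. prob {\<omega>\<in>space M. \<bar>\<xi> s \<omega>\<bar> > \<eta> * sqrt n})"
    by (simp only:) (rule measure_UNION_le; measurable)
  also have "\<dots> = (\<Sum>s<n. prob {\<omega>\<in>space M. \<bar>\<xi> 0 \<omega>\<bar> > \<eta> * sqrt n})" by (rule sum.cong[OF refl eq])
  finally show "norm (prob {\<omega>\<in>space M. \<exists>s<n. \<bar>\<xi> s \<omega>\<bar> > \<eta> * sqrt n}) \<le> real n * prob {\<omega>\<in>space M. \<bar>\<xi> 0 \<omega>\<bar> > \<eta> * sqrt n}"
    by simp
qed simp

theorem theorem3p1:
  fixes M :: "'a measure" and eps :: "nat \<Rightarrow> 'a \<Rightarrow> real" and Y0 :: "'a \<Rightarrow> real"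
    and \<alpha> \<beta> r \<sigma> :: real
  assumes "prob_space M"
    and "\<And>t. t \<ge> 1 \<Longrightarrow> eps t \<in> borel_measurable M"
    and "Y0 \<in> borel_measurable M"
    and "prob_space.indep_vars M (\<lambda>_. borel)
           (\<lambda>i. case i of None \<Rightarrow> Y0 | Some t \<Rightarrow> eps t) (insert None (Some ` {1..}))"
    and "\<And>t. t \<ge> 1 \<Longrightarrow> distr M borel (eps t) = distr M borel (eps 1)"
    and "integrable M (\<lambda>\<omega>. (eps 1 \<omega>)\<^sup>2)"
    and "integral\<^sup>L M (eps 1) = 0"
    and "\<sigma> > 0" and "integral\<^sup>L M (\<lambda>\<omega>. (eps 1 \<omega>)\<^sup>2) = \<sigma>\<^sup>2"
    and "integrable M (\<lambda>\<omega>. (Y0 \<omega>)\<^sup>2)"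
    and "(\<alpha> = 1 \<and> \<beta> < 1 \<and> r \<le> 0) \<or> (\<alpha> = 1 \<and> \<beta> = -1)"
  shows "\<And>(N :: 'b measure) B. standard_BM N B \<Longrightarrow>
           weak_conv_D M
             (\<lambda>n \<omega> t. tar1 \<alpha> \<beta> r Y0 eps (nat \<lfloor>real n * t\<rfloor>) \<omega> / sqrt (real n))
             N (\<lambda>\<omega> t. \<sigma> * \<bar>B t \<omega>\<bar>)"
proof -
  fix N :: "'b measure" and B
  assume B: "standard_BM N B"
  interpret prob_space M by fact
  interpret N: prob_space N using B unfolding standard_BM_def by blast
  have eps_M: "eps (Suc t) \<in> borel_measurable M" for t using assms(2) by simp
  note [measurable] = eps_M assms(3)
  define X where "X i = (case i of None \<Rightarrow> Y0 | Some t \<Rightarrow> eps t)" for i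
  define I where "I t = insert None (Some ` {1..t::nat})" for t
  define F where "F t = past_algebra M X (I t)" for t
  have space_F: "space (F t) = space M" for t by (simp add: F_def past_algebra_def)
  have XF: "X i \<in> borel_measurable (F t)" if "i \<in> I t" for i t
    unfolding F_def by (rule measurable_past_algebra[OF that])
  have Y0_F: "Y0 \<in> borel_measurable (F t)" for t using XF[of None t] by (simp add: X_def I_def)
  have eps_F: "eps s \<in> borel_measurable (F t)" if "1 \<le> s" "s \<le> t" for s t
    using XF[of "Some s" t] that by (simp add: X_def I_def)
  have Y_F: "tar1 a b r Y0 eps s \<in> borel_measurable (F t)" if "s \<le> t" for a b s t
    using that
  proof (induction s)
    case 0
    then show ?case using Y0_F by simp
  next
    case (Suc s)
    have [measurable]: "tar1 a b r Y0 eps s \<in> borel_measurable (F t)" "eps (Suc s) \<in> borel_measurable (F t)"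
      using Suc eps_F by auto
    show ?case by simp
  qed
  have sign_F: "tar_sign r Y0 eps s \<in> borel_measurable (F t)" if "s \<le> Suc t" for s t
    using that
  proof (induction s)
    case 0
    then show ?case by simp
  next
    case (Suc s)
    have [measurable]: "tar1 1 (-1) r Y0 eps s \<in> borel_measurable (F t)" "tar_sign r Y0 eps s \<in> borel_measurable (F t)"
      using Suc Y_F[of s t 1 "-1"] by auto
    show ?case by simp
  qed
  have X_M: "X i \<in> borel_measurable M" if "i \<in> I t" for i t
    using that assms(2,3) by (auto simp: X_def I_def)
  \<comment> \<open>The shift is natural because \<open>eps 0\<close> never enters the recursion.
    The signs come from the model with coefficient \<open>-1\<close> even when
    \<open>\<beta>\<close> is different.\<close>
  interpret signed_innovations M F "\<lambda>t. eps (Suc t)" "\<lambda>t. tar_sign r Y0 eps (Suc t)" \<sigma>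
  proof
    show "subalgebra M (F t)" for t
      unfolding subalgebra_def
    proof (intro conjI space_F)
      show "sets (F t) \<subseteq> sets M"
        unfolding F_def by (rule sets_past_algebra_subset[OF refl]) (rule X_M)
    qed
    show "sets (F s) \<subseteq> sets (F t)" if "s \<le> t" for s t
      unfolding F_def[of s]
    proof (rule sets_past_algebra_subset[OF space_F])
      fix i assume "i \<in> I s"
      then show "X i \<in> borel_measurable (F t)" using that by (intro XF) (auto simp: I_def)
    qed
    show "eps (Suc t) \<in> borel_measurable (F (Suc t))" for t by (rule eps_F) auto
    show "tar_sign r Y0 eps (Suc t) \<in> borel_measurable (F t)" for t by (rule sign_F) auto
    show "tar_sign r Y0 eps (Suc t) \<omega> = 1 \<or> tar_sign r Y0 eps (Suc t) \<omega> = -1" for t \<omega> by (rule tar_sign_cases)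
    show "indep_set (sets (F t)) {eps (Suc t) -` A \<inter> space M | A. A \<in> sets borel}" for t
    proof -
      have "indep_set (sets (F t)) {X (Some (Suc t)) -` A \<inter> space M | A. A \<in> sets borel}"
        unfolding F_def
        by (rule indep_set_past_algebra[OF assms(4)[folded X_def[abs_def]]]) (auto simp: I_def)
      then show ?thesis by (simp add: X_def)
    qed
    show "distr M borel (eps (Suc t)) = distr M borel (eps (Suc 0))" for t using assms(5)[of "Suc t"] by simp
  qed (use assms(6-9) in simp_all)
  have V_eq: "V t \<omega> = signed_walk r Y0 eps t \<omega>" for t \<omega> by (simp add: V_def signed_walk_def)
  obtain C where C: "0 \<le> C" "\<And>\<omega> D n t. \<bar>Y0 \<omega>\<bar> \<le> D \<Longrightarrow> \<bar>r\<bar> \<le> D \<Longrightarrow>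
    (\<And>k. 1 \<le> k \<Longrightarrow> k \<le> n \<Longrightarrow> \<bar>eps k \<omega>\<bar> \<le> D) \<Longrightarrow> t \<le> n \<Longrightarrow>
    \<bar>tar1 \<alpha> \<beta> r Y0 eps t \<omega> - \<bar>V t \<omega>\<bar>\<bar> \<le> C * D"
    using tar1_near_abs_signed_walk[OF assms(11)] unfolding V_eq by metis
  have Y_M [measurable]: "tar1 a b r Y0 eps s \<in> borel_measurable M" for a b s
    by (rule measurable_F_M[OF Y_F[OF order.refl]])
  let ?Y = "\<lambda>n \<omega>. step_path n (\<lambda>i. tar1 \<alpha> \<beta> r Y0 eps i \<omega> / sqrt n)"
  have "weak_conv_D M ?Y N (\<lambda>\<omega> t. \<bar>\<sigma> * B t \<omega>\<bar>)"
  proof (rule weak_conv_D_sup_lipschitzI)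
    show "prob_space M" "prob_space N" by unfold_locales
    show "cadlag (?Y n \<omega>)" for n \<omega> by (rule cadlag_step_path)
    show "cadlag (\<lambda>t. \<bar>\<sigma> * B t \<omega>\<bar>)" if "\<omega> \<in> space N" for \<omega>
      by (rule cadlag_abs[OF cadlag_continuous[OF standard_BM_scaled_path(1)[OF B that]]])
    show "(\<lambda>\<omega>. H (?Y n \<omega>)) \<in> borel_measurable M" if "sup_lipschitz k H" for n k H
      by (rule borel_measurable_step_path[OF that]) simp
    \<comment> \<open>Here \<open>k\<close> may be negative, hence the passage to
      \<open>\<bar>k\<bar>\<close>.\<close>
    show "(\<lambda>\<omega>. H (\<lambda>t. \<bar>\<sigma> * B t \<omega>\<bar>)) \<in> borel_measurable N" if "sup_lipschitz k H" for k H
      using borel_measurable_standard_BM_functional[OF B sup_lipschitz_abs[OF sup_lipschitz_mono[OF that, of "\<bar>k\<bar>"]]] by auto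
    fix k K H
    assume k: "0 \<le> k" and H: "sup_lipschitz k H" and HK: "\<And>x. cadlag x \<Longrightarrow> \<bar>H x\<bar> \<le> K"
    have K: "0 \<le> K" using HK[OF cadlag_step_path[of 0 "\<lambda>_. 0"]] by linarith
    let ?V = "\<lambda>n \<omega>. step_path n (\<lambda>i. V i \<omega> / sqrt n)"
    let ?G = "\<lambda>x. H (\<lambda>t. \<bar>x t\<bar>)"
    have G: "sup_lipschitz k ?G" by (rule sup_lipschitz_abs[OF H])
    have GK: "\<bar>?G x\<bar> \<le> K" if "cadlag x" for x by (rule HK[OF cadlag_abs[OF that]])
    have lim: "(\<lambda>n. expectation (\<lambda>\<omega>. ?G (?V n \<omega>))) \<longlonglongrightarrow> integral\<^sup>L N (\<lambda>\<omega>. ?G (\<lambda>t. \<sigma> * B t \<omega>))"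
      by (rule signed_walk_fclt[OF B G k GK])
    have "(\<lambda>n. expectation (\<lambda>\<omega>. H (?Y n \<omega>)) - expectation (\<lambda>\<omega>. ?G (?V n \<omega>))) \<longlonglongrightarrow> 0"
    proof (rule tendstoI)
      fix e :: real assume e: "0 < e"
      define \<eta> where "\<eta> = e / (2 * (k * C + 1))"
      have kC: "0 \<le> k * C" using k C by simp
      have \<eta>: "0 < \<eta>" using e kC by (simp add: \<eta>_def)
      have "\<eta> * (2 * (k * C + 1)) = e" using kC by (simp add: \<eta>_def)
      then have k\<eta>: "k * (C * \<eta>) \<le> e / 2" using \<eta> by (simp add: algebra_simps)
      \<comment> \<open>Off both events, and for \<open>n\<close> large against \<open>r\<close>,
        the number \<open>\<eta> * sqrt n\<close> bounds \<open>Y0\<close>, \<open>r\<close> and all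
        innovations up to time \<open>n\<close> at once: it is the \<open>D\<close> of the pathwise
        comparison.\<close>
      define E1 where "E1 n = {\<omega>\<in>space M. \<exists>s<n. \<bar>eps (Suc s) \<omega>\<bar> > \<eta> * sqrt n}" for n :: nat
      define E2 where "E2 n = {\<omega>\<in>space M. \<bar>Y0 \<omega>\<bar> > \<eta> * sqrt n}" for n :: nat
      have [measurable]: "E1 n \<in> sets M" "E2 n \<in> sets M" for n unfolding E1_def E2_def by measurable
      \<comment> \<open>The tail estimate for \<open>Y0\<close> carries a factor \<open>n\<close>,
        which for \<open>n \<ge> 1\<close> only enlarges the bound on
        \<open>prob (E2 n)\<close>.\<close>
      have "(\<lambda>n. 2 * K * (prob (E1 n) + real n * prob (E2 n))) \<longlonglongrightarrow> 2 * K * (0 + 0)"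
        unfolding E1_def E2_def
        by (intro tendsto_mult tendsto_const tendsto_add max_innovation_tendsto[OF \<eta>] square_integrable_tail[OF assms(3,10) \<eta>])
      then have ev1: "eventually (\<lambda>n. 2 * K * (prob (E1 n) + real n * prob (E2 n)) < e / 2) sequentially"
        by (rule order_tendstoD) (use e in simp)
      obtain n0 :: nat where n0: "(\<bar>r\<bar> / \<eta>)\<^sup>2 < n0" using reals_Archimedean2 by blast
      from ev1 eventually_ge_at_top[of "Suc n0"]
      show "eventually (\<lambda>n. dist (expectation (\<lambda>\<omega>. H (?Y n \<omega>)) - expectation (\<lambda>\<omega>. ?G (?V n \<omega>))) 0 < e) sequentially"
      proof eventually_elim
        case (elim n)
        have n: "0 < real n" using elim(2) by simp
        have "(\<bar>r\<bar> / \<eta>)\<^sup>2 \<le> real n" using n0 elim(2) by linarith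
        then have "\<bar>r\<bar> / \<eta> \<le> sqrt n" by (rule real_le_rsqrt)
        then have r: "\<bar>r\<bar> \<le> \<eta> * sqrt n" using \<eta> by (simp add: field_simps)
        have "prob (E1 n \<union> E2 n) \<le> prob (E1 n) + prob (E2 n)" by (rule measure_Un_le) auto
        also have "prob (E2 n) \<le> real n * prob (E2 n)" using elim(2) by (intro mult_le_cancel_right1[THEN iffD2]) (auto simp: measure_le_0_iff)
        finally have "2 * K * prob (E1 n \<union> E2 n) \<le> 2 * K * (prob (E1 n) + real n * prob (E2 n))"
          using K by (intro mult_left_mono) auto
        moreover have "\<bar>expectation (\<lambda>\<omega>. H (?Y n \<omega>)) - expectation (\<lambda>\<omega>. ?G (?V n \<omega>))\<bar> \<le> k * (C * \<eta>) + 2 * K * prob (E1 n \<union> E2 n)"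
        proof (rule expectation_diff_le)
          show "(\<lambda>\<omega>. H (?Y n \<omega>)) \<in> borel_measurable M"
            by (rule borel_measurable_step_path[OF H]) simp
          show "(\<lambda>\<omega>. ?G (?V n \<omega>)) \<in> borel_measurable M"
            by (rule borel_measurable_step_path[OF G]) simp
          show "\<bar>H (?Y n \<omega>) - ?G (?V n \<omega>)\<bar> \<le> k * (C * \<eta>)" if \<omega>: "\<omega> \<in> space M" "\<omega> \<notin> E1 n \<union> E2 n" for \<omega>
          proof (rule sup_lipschitzD[OF H cadlag_step_path cadlag_abs[OF cadlag_step_path]])
            fix t :: real assume t: "0 \<le> t" "t \<le> 1"
            define i where "i = nat \<lfloor>real n * t\<rfloor>"
            have i: "i \<le> n" unfolding i_def by (rule nat_floor_le[OF t])
            have "\<bar>eps j \<omega>\<bar> \<le> \<eta> * sqrt n" if "1 \<le> j" "j \<le> n" for j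
              using \<omega> that unfolding E1_def by (auto simp: not_less dest!: spec[of _ "j - 1"])
            then have "\<bar>tar1 \<alpha> \<beta> r Y0 eps i \<omega> - \<bar>V i \<omega>\<bar>\<bar> \<le> C * (\<eta> * sqrt n)"
              using \<omega> r i unfolding E2_def by (intro C(2)[of \<omega> "\<eta> * sqrt n" n]) auto
            then have "\<bar>tar1 \<alpha> \<beta> r Y0 eps i \<omega> - \<bar>V i \<omega>\<bar>\<bar> / sqrt n \<le> C * (\<eta> * sqrt n) / sqrt n"
              by (intro divide_right_mono) auto
            also have "C * (\<eta> * sqrt n) / sqrt n = C * \<eta>" using n by simp
            finally show "\<bar>?Y n \<omega> t - \<bar>?V n \<omega> t\<bar>\<bar> \<le> C * \<eta>"
              unfolding step_path_def i_def[symmetric]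
              by (simp add: diff_divide_distrib[symmetric] abs_divide)
          qed
          show "0 \<le> k * (C * \<eta>)" using k C \<eta> by simp
        qed (auto intro: HK cadlag_step_path cadlag_abs)
        ultimately show ?case using elim(1) k\<eta> unfolding dist_real_def by linarith
      qed
    qed
    from tendsto_add[OF this lim]
    show "(\<lambda>n. expectation (\<lambda>\<omega>. H (?Y n \<omega>))) \<longlonglongrightarrow> integral\<^sup>L N (\<lambda>\<omega>. H (\<lambda>t. \<bar>\<sigma> * B t \<omega>\<bar>))" by simp
  qed
  then show "weak_conv_D M (\<lambda>n \<omega> t. tar1 \<alpha> \<beta> r Y0 eps (nat \<lfloor>real n * t\<rfloor>) \<omega> / sqrt (real n)) N (\<lambda>\<omega> t. \<sigma> * \<bar>B t \<omega>\<bar>)"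
    using assms(8) unfolding step_path_def[abs_def] by (simp add: abs_mult)
qed

end
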